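(* For every smooth conic $C_1\subset\mathbb{P}^3$ and every $J\in\mathbb{C}$, there is a smooth conic $C_2\subset\mathbb{P}^3$, spanning a plane different from that of $C_1$, such that the edge curve of $C_1,C_2$ is a smooth genus one curve with $j$-invariant $J$. Moreover, suppose that $C_1$ is real and that $S\subset C_1$ is a real set of four distinct points such that the double cover of $C_1\cong\mathbb{P}^1$ branched over $S$ has $j$-invariant $J$. Then, for a suitable choice of affine $\mathbb{R}^3\subset\mathbb{RP}^3$, the conic $C_2$ may be chosen to be a circle in that $\mathbb{R}^3$, with the projection of the edge curve to $C_1$ branched over $S$.
   Context: Here $\mathbb{P}^3=\mathbb{CP}^3$. "Real" means defined over $\mathbb{R}$ (stable under complex conjugation). A circle in an affine $\mathbb{R}^3\subset\mathbb{RP}^3$ is identified with the complex conic that is its Zariski closure in $\mathbb{P}^3$. For smooth conics $C_1,C_2\subset\mathbb{P}^3$ spanning different planes, a stationary bisecant is a line $\overline{p,q}$ spanned by points $p\in C_1$, $q\in C_2$, $p\neq q$, such that the tangent lines $T_pC_1$ and $T_qC_2$ meet. The edge curve is the Zariski closure in $C_1\times C_2$ of the set of such pairs $(p,q)$; it is a curve of bidegree $(2,2)$ in $C_1\times C_2\cong\mathbb{P}^1\times\mathbb{P}^1$, so its projection to $C_1$ has degree two. The $j$-invariant of a smooth genus one curve with a degree two map to $\mathbb{P}^1$ branched, in suitable coordinates, over $\{0,1,\lambda,\infty\}$ is $2^8\cdot\frac{(\lambda^2-\lambda+1)^3}{\lambda^2(\lambda-1)^2}$. *)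

theory Defs
  imports "HOL-Analysis.Analysis" "HOL-Library.Function_Algebras"
begin

text \<open>
  A point of the complex projective space of \<open>complex^'n\<close> is a one-dimensional subspace of
  \<open>complex^'n\<close>; so the index type \<open>2\<close> gives the projective line and \<open>4\<close> gives projective 3-space.
  Lines and planes are linear subspaces of dimension 2 and 3.
\<close>

type_synonym 'n point = "(complex^'n) set"

definition proj_space :: "'n::finite point set" where
  "proj_space = {vec.span {v} | v. v \<noteq> 0}"

text \<open>
  Homogeneous polynomials are represented by the functions they define, which loses nothing
  over an infinite field.
\<close>

definition forms :: "nat \<Rightarrow> (complex^'n::finite \<Rightarrow> complex) set" where
  "forms d = {(\<lambda>x. \<Sum>\<alpha>\<in>{\<alpha>. (\<Sum>i\<in>UNIV. \<alpha> i) = d}. c \<alpha> * (\<Prod>i\<in>UNIV. x $ i ^ \<alpha> i)) | c. True}"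

definition vanishing_forms :: "'n::finite point set \<Rightarrow> nat \<Rightarrow> (complex^'n \<Rightarrow> complex) set" where
  "vanishing_forms X d = {f \<in> forms d. \<forall>p\<in>X. \<forall>x\<in>p. f x = 0}"

definition zariski_closed :: "'n::finite point set \<Rightarrow> bool" where
  "zariski_closed X \<longleftrightarrow>
     (\<exists>F \<subseteq> (\<Union>d. forms d). X = {p \<in> proj_space. \<forall>f\<in>F. \<forall>x\<in>p. f x = 0})"

definition zariski_closure :: "'n::finite point set \<Rightarrow> 'n point set" where
  "zariski_closure A = \<Inter>{Z. zariski_closed Z \<and> A \<subseteq> Z}"

definition irreducible_set :: "'n::finite point set \<Rightarrow> bool" where
  "irreducible_set X \<longleftrightarrow> X \<noteq> {} \<and>
     (\<forall>A B. zariski_closed A \<and> zariski_closed B \<and> X \<subseteq> A \<union> B \<longrightarrow> X \<subseteq> A \<or> X \<subseteq> B)"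

text \<open>
  The Zariski tangent space of the affine cone over \<open>X\<close> at a representative of \<open>p\<close>; as a linear
  subspace it is the embedded projective tangent space of \<open>X\<close> at \<open>p\<close>, and its vector space
  dimension exceeds that of the latter by one.
\<close>

definition tangent_space :: "'n::finite point set \<Rightarrow> 'n point \<Rightarrow> (complex^'n) set" where
  "tangent_space X p =
     {w. \<forall>d. \<forall>f \<in> vanishing_forms X d. \<forall>x \<in> p - {0}. deriv (\<lambda>t. f (x + t *s w)) 0 = 0}"

text \<open>
  The degree \<open>n\<close> part of the homogeneous coordinate ring of \<open>X\<close> is the space of forms of degree
  \<open>n\<close> restricted to the cone over \<open>X\<close>.
\<close>

definition hilbert_function :: "'n::finite point set \<Rightarrow> nat \<Rightarrow> nat" where
  "hilbert_function X n =
     vector_space.dim (\<lambda>(c::complex) g x. c * g x)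
       ((\<lambda>f x. if x \<in> \<Union>X then f x else 0) ` forms n)"

text \<open>
  A projective variety is a curve if its Hilbert polynomial has degree one; that polynomial is
  then \<open>deg X * n + 1 - p\<^sub>a(X)\<close>, and for smooth curves the arithmetic genus \<open>p\<^sub>a\<close> is the genus.
\<close>

definition smooth_curve_of_genus :: "nat \<Rightarrow> 'n::finite point set \<Rightarrow> bool" where
  "smooth_curve_of_genus g X \<longleftrightarrow>
     zariski_closed X \<and> irreducible_set X \<and>
     (\<exists>d>0. \<forall>\<^sub>F n in sequentially. int (hilbert_function X n) = int d * int n + 1 - int g) \<and>
     (\<forall>p\<in>X. vec.dim (tangent_space X p) = 2)"

definition regular_map ::
    "'n::finite point set \<Rightarrow> 'm::finite point set \<Rightarrow> ('n point \<Rightarrow> 'm point) \<Rightarrow> bool" where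
  "regular_map X Y f \<longleftrightarrow> f ` X \<subseteq> Y \<and>
     (\<forall>p\<in>X. \<exists>d F. (\<forall>i. (\<lambda>x. F x $ i) \<in> forms d) \<and> (\<exists>x\<in>p. F x \<noteq> 0) \<and>
        (\<forall>q\<in>X. \<forall>x\<in>q. F x \<noteq> 0 \<longrightarrow> f q = vec.span {F x}))"

definition isomorphism ::
    "'n::finite point set \<Rightarrow> 'm::finite point set \<Rightarrow> ('n point \<Rightarrow> 'm point) \<Rightarrow> bool" where
  "isomorphism X Y f \<longleftrightarrow>
     bij_betw f X Y \<and> regular_map X Y f \<and> regular_map Y X (inv_into X f)"

text \<open>
  \<open>f\<close> is a map of degree two from the curve \<open>X\<close> to the curve \<open>Y\<close> whose set of branch points is
  \<open>B\<close>. Meant for smooth irreducible projective curves, where degree and branching are read off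
  from the cardinalities of the fibres.
\<close>

definition double_cover ::
    "'n::finite point set \<Rightarrow> 'm::finite point set \<Rightarrow> ('n point \<Rightarrow> 'm point) \<Rightarrow> 'm point set \<Rightarrow> bool"
  where
  "double_cover X Y f B \<longleftrightarrow> regular_map X Y f \<and> finite B \<and> B \<subseteq> Y \<and>
     (\<forall>y \<in> Y - B. card {x\<in>X. f x = y} = 2) \<and> (\<forall>y \<in> B. card {x\<in>X. f x = y} = 1)"

definition P1_point :: "complex \<Rightarrow> 2 point" where
  "P1_point z = vec.span {vector [z, 1]}"

definition P1_infinity :: "2 point" where
  "P1_infinity = vec.span {vector [1, 0]}"

text \<open>
  For a curve \<open>Y\<close> isomorphic to the projective line and \<open>B \<subseteq> Y\<close>: the double cover of \<open>Y\<close>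
  branched over \<open>B\<close> is a smooth curve of genus one with \<open>j\<close>-invariant \<open>J\<close>.
\<close>

definition branch_j_invariant :: "'n::finite point set \<Rightarrow> 'n point set \<Rightarrow> complex \<Rightarrow> bool" where
  "branch_j_invariant Y B J \<longleftrightarrow>
     (\<exists>\<phi> lam. isomorphism Y (proj_space :: 2 point set) \<phi> \<and> lam \<noteq> 0 \<and> lam \<noteq> 1 \<and>
        \<phi> ` B = {P1_point 0, P1_point 1, P1_point lam, P1_infinity} \<and>
        J = 2^8 * ((lam^2 - lam + 1)^3 / (lam^2 * (lam - 1)^2)))"

text \<open>
  Meant for smooth genus one curves; all degree two maps to the projective line then give the
  same value.
\<close>

definition has_j_invariant :: "'n::finite point set \<Rightarrow> complex \<Rightarrow> bool" where
  "has_j_invariant X J \<longleftrightarrow>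
     (\<exists>f B. double_cover X (proj_space :: 2 point set) f B \<and>
        branch_j_invariant (proj_space :: 2 point set) B J)"

definition smooth_conic :: "4 point set \<Rightarrow> bool" where
  "smooth_conic C \<longleftrightarrow>
     (\<exists>W. \<exists>q \<in> forms 2. vec.subspace W \<and> vec.dim W = 3 \<and>
        C = {p \<in> proj_space. p \<subseteq> W \<and> (\<forall>x\<in>p. q x = 0)} \<and>
        (\<forall>x\<in>W. x \<noteq> 0 \<and> q x = 0 \<longrightarrow> (\<exists>w\<in>W. deriv (\<lambda>t. q (x + t *s w)) 0 \<noteq> 0)))"

definition spanned_plane :: "4 point set \<Rightarrow> (complex^4) set" where
  "spanned_plane C = vec.span (\<Union>C)"

text \<open>The product of two projective spaces is regarded as a projective variety by the Segre embedding.\<close>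

definition segre :: "'n::finite point \<times> 'm::finite point \<Rightarrow> ('n \<times> 'm) point" where
  "segre = (\<lambda>(p, q). vec.span {(\<chi> k. x $ fst k * y $ snd k) | x y. x \<in> p \<and> y \<in> q})"

definition first_projection :: "('n::finite \<times> 'm::finite) point \<Rightarrow> 'n point" where
  "first_projection e = (THE p. p \<in> proj_space \<and> (\<exists>q \<in> proj_space. e = segre (p, q)))"

definition stationary_pairs :: "4 point set \<Rightarrow> 4 point set \<Rightarrow> (4 point \<times> 4 point) set" where
  "stationary_pairs C1 C2 =
     {(p, q) \<in> C1 \<times> C2. p \<noteq> q \<and> tangent_space C1 p \<inter> tangent_space C2 q \<noteq> {0}}"

text \<open>Since \<open>C1 \<times> C2\<close> is closed, this is also the closure inside \<open>C1 \<times> C2\<close>.\<close>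

definition edge_curve :: "4 point set \<Rightarrow> 4 point set \<Rightarrow> (4 \<times> 4) point set" where
  "edge_curve C1 C2 = zariski_closure (segre ` stationary_pairs C1 C2)"

definition conj_point :: "'n::finite point \<Rightarrow> 'n point" where
  "conj_point p = (\<lambda>v. \<chi> i. cnj (v $ i)) ` p"

definition real_set :: "'n::finite point set \<Rightarrow> bool" where
  "real_set X \<longleftrightarrow> conj_point ` X = X"

text \<open>
  An affine real 3-space in the real projective 3-space, identified with \<open>real^3\<close>, is given by a
  system of real projective coordinates, that is, by an invertible real matrix \<open>A\<close>.
\<close>

definition affine_chart :: "real^4^4 \<Rightarrow> real^3 \<Rightarrow> 4 point" where
  "affine_chart A u =
     vec.span {\<chi> i. complex_of_real ((A *v vector [1, u $ 1, u $ 2, u $ 3]) $ i)}"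

definition circle :: "(real^3) set \<Rightarrow> bool" where
  "circle K \<longleftrightarrow> (\<exists>c n r. n \<noteq> 0 \<and> r > 0 \<and> K = {u \<in> sphere c r. n \<bullet> (u - c) = 0})"

definition is_circle_in :: "real^4^4 \<Rightarrow> 4 point set \<Rightarrow> bool" where
  "is_circle_in A C \<longleftrightarrow> (\<exists>K. circle K \<and> C = zariski_closure (affine_chart A ` K))"

end

theory Submission
  imports Defs "HOL-Computational_Algebra.Polynomial"
    "HOL-Computational_Algebra.Fundamental_Theorem_Algebra"
begin

text \<open>
  Let the planes of two conics meet in a line \<open>L\<close>. A tangent line of the first conic meets a tangent
  line of the second one if and only if they meet \<open>L\<close> in the same point, so the edge curve is the
  fibre product over \<open>L\<close> of the two double covers which send a point of a conic to the
  intersection of its tangent line with \<open>L\<close>. The cover given by the second conic is branched over the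
  two points \<open>a\<close> and \<open>b\<close> in which this conic meets \<open>L\<close>. Hence the projection of the edge curve to the
  first conic is branched over the four points whose tangent lines pass through \<open>a\<close> or \<open>b\<close>.

  Conversely, let four points of the first conic be given. Partition them into two pairs,
  let \<open>a\<close> and \<open>b\<close> be the poles of the two pairs, that is, the intersections of the two pairs of tangent
  lines, and take for the second conic any smooth conic through \<open>a\<close> and \<open>b\<close> in another plane through
  both points. There is a parametrisation \<open>s^2 u0 + 2 s t u1 + t^2 u2\<close> of the first conic in which the
  four points have parameters \<open>\<plusminus>1\<close> and \<open>\<plusminus>k\<close> (lemma \<open>symmetric_frame\<close>). Then \<open>a = u0 - u2\<close> and
  \<open>b = k^2 u0 - u2\<close>, the second conic is \<open>x^2 a + 2 x y v + y^2 b\<close> for some \<open>v\<close> outside the plane of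
  the first one, and the edge curve has the equation \<open>x^2 P = y^2 Q\<close> with \<open>P = s^2 - t^2\<close> and
  \<open>Q = s^2 - k^2 t^2\<close> (lemmas \<open>tangents_meet_iff\<close> and \<open>segre_stationary_pairs\<close>).

  The edge curve is therefore the image of the quartic space curve \<open>x^2 = Q\<close>, \<open>y^2 = P\<close> under a map
  given by quartic forms. A form of degree \<open>n\<close> pulls back to \<open>A + x y B\<close> modulo the ideal of the quartic,
  where \<open>A\<close> and \<open>B\<close> are forms of degrees \<open>4 n\<close> and \<open>4 n - 2\<close> in \<open>s\<close> and \<open>t\<close> (lemma \<open>normal_form\<close>).
  This normal form gives everything that is needed of the curve. It is irreducible because \<open>P Q\<close> is not
  a square; its Hilbert function is \<open>(4 n + 1) + (4 n - 1) = 8 n\<close>, so its arithmetic genus is one; and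
  tangent vectors of the quartic give tangent vectors of the curve, which together with the equations
  of the Segre variety and of the conics shows that the curve is smooth.

  For the first claim one chooses four points of the conic with the prescribed \<open>j\<close>-invariant. For the
  second one, the four given points are paired such that each pair is stable under complex
  conjugation, which is possible for every real set of four points. Then \<open>a\<close> and \<open>b\<close> are real points,
  and \<open>v\<close> can be chosen real, so the second conic has a real parametrisation. Such a conic is a circle in a
  suitable affine chart (lemma \<open>real_conic_is_circle\<close>).
\<close>

section \<open>Forms\<close>

lemma finite_exponents: "finite {\<alpha> :: 'n::finite \<Rightarrow> nat. (\<Sum>i\<in>UNIV. \<alpha> i) = d}"
proof (rule finite_subset)
  show "{\<alpha> :: 'n \<Rightarrow> nat. (\<Sum>i\<in>UNIV. \<alpha> i) = d} \<subseteq> UNIV \<rightarrow>\<^sub>E {..d}"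
    by (auto simp: PiE_def extensional_def intro: member_le_sum)
  show "finite (UNIV \<rightarrow>\<^sub>E {..d} :: ('n \<Rightarrow> nat) set)"
    by (intro finite_PiE) auto
qed

lemma forms_add:
  assumes "f \<in> forms d" "g \<in> forms d"
  shows "(\<lambda>x. f x + g x) \<in> forms d"
proof -
  obtain a b where "f = (\<lambda>x. \<Sum>\<alpha>\<in>{\<alpha>. (\<Sum>i\<in>UNIV. \<alpha> i) = d}. a \<alpha> * (\<Prod>i\<in>UNIV. x $ i ^ \<alpha> i))"
    "g = (\<lambda>x. \<Sum>\<alpha>\<in>{\<alpha>. (\<Sum>i\<in>UNIV. \<alpha> i) = d}. b \<alpha> * (\<Prod>i\<in>UNIV. x $ i ^ \<alpha> i))"
    using assms unfolding forms_def by blast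
  then have "(\<lambda>x. f x + g x) = (\<lambda>x. \<Sum>\<alpha>\<in>{\<alpha>. (\<Sum>i\<in>UNIV. \<alpha> i) = d}. (a \<alpha> + b \<alpha>) * (\<Prod>i\<in>UNIV. x $ i ^ \<alpha> i))"
    by (simp add: sum.distrib algebra_simps)
  then show ?thesis unfolding forms_def by (intro CollectI exI[where x="\<lambda>\<alpha>. a \<alpha> + b \<alpha>"]) simp
qed

lemma forms_cmult:
  assumes "f \<in> forms d"
  shows "(\<lambda>x. c * f x) \<in> forms d"
proof -
  obtain a where "f = (\<lambda>x. \<Sum>\<alpha>\<in>{\<alpha>. (\<Sum>i\<in>UNIV. \<alpha> i) = d}. a \<alpha> * (\<Prod>i\<in>UNIV. x $ i ^ \<alpha> i))"
    using assms unfolding forms_def by blast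
  then have "(\<lambda>x. c * f x) = (\<lambda>x. \<Sum>\<alpha>\<in>{\<alpha>. (\<Sum>i\<in>UNIV. \<alpha> i) = d}. (c * a \<alpha>) * (\<Prod>i\<in>UNIV. x $ i ^ \<alpha> i))"
    by (simp add: sum_distrib_left algebra_simps)
  then show ?thesis unfolding forms_def by (intro CollectI exI[where x="\<lambda>\<alpha>. c * a \<alpha>"]) simp
qed

lemma forms_zero: "(\<lambda>x. 0) \<in> forms d"
  unfolding forms_def by (intro CollectI exI[where x="\<lambda>\<alpha>. 0"]) simp

lemma forms_sum:
  assumes "\<And>i. i \<in> A \<Longrightarrow> f i \<in> forms d"
  shows "(\<lambda>x. \<Sum>i\<in>A. f i x) \<in> forms d"
  using assms by (induction A rule: infinite_finite_induct) (auto intro: forms_add forms_zero)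

lemma monomial_in_forms:
  assumes "(\<Sum>i\<in>UNIV. \<beta> i) = d"
  shows "(\<lambda>x. \<Prod>i\<in>UNIV. x $ i ^ \<beta> i) \<in> forms d"
proof -
  have "(\<Sum>\<alpha>\<in>{\<alpha>. (\<Sum>i\<in>UNIV. \<alpha> i) = d}. (if \<alpha> = \<beta> then 1 else 0) * (\<Prod>i\<in>UNIV. x $ i ^ \<alpha> i))
        = (\<Prod>i\<in>UNIV. x $ i ^ \<beta> i)" for x :: "complex^'a"
    using assms by (simp add: if_distrib[where f="\<lambda>c. c * _"] finite_exponents sum.delta cong: if_cong)
  then show ?thesis unfolding forms_def by (intro CollectI exI[where x="\<lambda>\<alpha>. if \<alpha> = \<beta> then 1 else 0"]) simp
qed

lemma forms_const: "(\<lambda>x. c) \<in> forms 0"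
  using forms_cmult[OF monomial_in_forms[of "\<lambda>_. 0" 0], of c] by simp

lemma forms_mult:
  assumes "f \<in> forms m" "g \<in> forms n"
  shows "(\<lambda>x. f x * g x) \<in> forms (m + n)"
proof -
  obtain a b where f: "f = (\<lambda>x. \<Sum>\<alpha>\<in>{\<alpha>. (\<Sum>i\<in>UNIV. \<alpha> i) = m}. a \<alpha> * (\<Prod>i\<in>UNIV. x $ i ^ \<alpha> i))"
    and g: "g = (\<lambda>x. \<Sum>\<alpha>\<in>{\<alpha>. (\<Sum>i\<in>UNIV. \<alpha> i) = n}. b \<alpha> * (\<Prod>i\<in>UNIV. x $ i ^ \<alpha> i))"
    using assms unfolding forms_def by blast
  have "(\<lambda>x. f x * g x) = (\<lambda>x. \<Sum>\<alpha>\<in>{\<alpha>. (\<Sum>i\<in>UNIV. \<alpha> i) = m}. \<Sum>\<beta>\<in>{\<alpha>. (\<Sum>i\<in>UNIV. \<alpha> i) = n}.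
      (a \<alpha> * b \<beta>) * (\<Prod>i\<in>UNIV. x $ i ^ (\<alpha> i + \<beta> i)))"
    unfolding f g by (simp add: sum_product power_add prod.distrib ac_simps)
  then show ?thesis
    by (auto intro!: forms_sum forms_cmult monomial_in_forms simp: sum.distrib)
qed

lemma forms_coord: "(\<lambda>x. x $ i) \<in> forms 1"
proof -
  have "(\<lambda>x. \<Prod>j\<in>UNIV. x $ j ^ (if j = i then 1 else 0)) \<in> forms 1"
    by (rule monomial_in_forms) simp
  moreover have "(\<Prod>j\<in>UNIV. x $ j ^ (if j = i then 1 else 0)) = x $ i" for x :: "complex^'a"
    by (simp add: if_distrib[where f="\<lambda>c. _ ^ c"] prod.delta cong: if_cong)
  ultimately show ?thesis by simp
qed

text \<open>
  All properties of forms below are proved by building a form up from constants: a monomial of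
  degree \<open>d + 1\<close> is a coordinate times a monomial of degree \<open>d\<close>.
\<close>

lemma forms_induct [consumes 1, case_names const coord add]:
  fixes f :: "complex^'n::finite \<Rightarrow> complex"
  assumes "f \<in> forms d"
    and const: "\<And>c. P 0 (\<lambda>x. c)"
    and coord: "\<And>d f i. f \<in> forms d \<Longrightarrow> P d f \<Longrightarrow> P (Suc d) (\<lambda>x. x $ i * f x)"
    and add: "\<And>d f g. f \<in> forms d \<Longrightarrow> g \<in> forms d \<Longrightarrow> P d f \<Longrightarrow> P d g \<Longrightarrow> P d (\<lambda>x. f x + g x)"
  shows "P d f"
proof -
  have zero: "P d (\<lambda>x. 0)" for d
  proof (induction d)
    case (Suc d)
    from coord[OF forms_zero Suc] show ?case by simp
  qed (rule const)
  have mono: "P d (\<lambda>x. c * (\<Prod>i\<in>UNIV. x $ i ^ \<alpha> i))" if "(\<Sum>i\<in>UNIV. \<alpha> i) = d" for c \<alpha> d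
    using that
  proof (induction d arbitrary: \<alpha>)
    case 0
    then have "\<alpha> = (\<lambda>_. 0)" by auto
    then show ?case using const by simp
  next
    case (Suc d)
    then obtain j where j: "\<alpha> j > 0"
      by (metis (no_types, lifting) gr0I nat.distinct(1) sum.neutral)
    define \<beta> where "\<beta> = \<alpha>(j := \<alpha> j - 1)"
    have s: "(\<Sum>i\<in>UNIV. \<beta> i) = d"
    proof -
      have "(\<Sum>i\<in>UNIV. \<alpha> i) = \<alpha> j + (\<Sum>i\<in>UNIV - {j}. \<alpha> i)"
        by (simp add: sum.remove)
      moreover have "(\<Sum>i\<in>UNIV. \<beta> i) = \<beta> j + (\<Sum>i\<in>UNIV - {j}. \<beta> i)"
        by (simp add: sum.remove)
      moreover have "(\<Sum>i\<in>UNIV - {j}. \<beta> i) = (\<Sum>i\<in>UNIV - {j}. \<alpha> i)"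
        by (rule sum.cong) (auto simp: \<beta>_def)
      ultimately show ?thesis using j Suc.prems by (simp add: \<beta>_def)
    qed
    have e: "(\<Prod>i\<in>UNIV. x $ i ^ \<alpha> i) = x $ j * (\<Prod>i\<in>UNIV. x $ i ^ \<beta> i)" for x :: "complex^'n"
    proof -
      have "(\<Prod>i\<in>UNIV. x $ i ^ \<alpha> i) = x $ j ^ \<alpha> j * (\<Prod>i\<in>UNIV - {j}. x $ i ^ \<alpha> i)"
        by (simp add: prod.remove)
      moreover have "(\<Prod>i\<in>UNIV. x $ i ^ \<beta> i) = x $ j ^ \<beta> j * (\<Prod>i\<in>UNIV - {j}. x $ i ^ \<beta> i)"
        by (simp add: prod.remove)
      moreover have "(\<Prod>i\<in>UNIV - {j}. x $ i ^ \<beta> i) = (\<Prod>i\<in>UNIV - {j}. x $ i ^ \<alpha> i)"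
        by (rule prod.cong) (auto simp: \<beta>_def)
      moreover have "x $ j ^ \<alpha> j = x $ j * x $ j ^ \<beta> j"
        using j by (simp add: \<beta>_def flip: power_Suc)
      ultimately show ?thesis by (simp add: mult.assoc)
    qed
    have "P (Suc d) (\<lambda>x. x $ j * (c * (\<Prod>i\<in>UNIV. x $ i ^ \<beta> i)))"
      by (intro coord Suc.IH s forms_cmult monomial_in_forms)
    then show ?case by (simp add: e ac_simps)
  qed
  obtain a where f: "f = (\<lambda>x. \<Sum>\<alpha>\<in>{\<alpha>. (\<Sum>i\<in>UNIV. \<alpha> i) = d}. a \<alpha> * (\<Prod>i\<in>UNIV. x $ i ^ \<alpha> i))"
    using assms(1) unfolding forms_def by blast
  have "P d (\<lambda>x. \<Sum>\<alpha>\<in>A. a \<alpha> * (\<Prod>i\<in>UNIV. x $ i ^ \<alpha> i))"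
    if "finite A" "A \<subseteq> {\<alpha>. (\<Sum>i\<in>UNIV. \<alpha> i) = d}" for A
    using that
  proof (induction A)
    case empty
    then show ?case using zero by simp
  next
    case (insert \<alpha> A)
    have "P d (\<lambda>x. a \<alpha> * (\<Prod>i\<in>UNIV. x $ i ^ \<alpha> i) + (\<Sum>\<alpha>\<in>A. a \<alpha> * (\<Prod>i\<in>UNIV. x $ i ^ \<alpha> i)))"
      using insert by (intro add mono insert.IH forms_sum forms_cmult monomial_in_forms) auto
    then show ?case using insert by simp
  qed
  then show ?thesis unfolding f using finite_exponents by blast
qed

lemma forms_homogeneous:
  assumes "f \<in> forms d"
  shows "f (c *s x) = c ^ d * f x"
  using assms by (induction rule: forms_induct) (auto simp: algebra_simps)

lemma forms_comp:
  assumes "f \<in> forms d" and F: "\<And>i. (\<lambda>x. F x $ i) \<in> forms e"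
  shows "(\<lambda>x. f (F x)) \<in> forms (d * e)"
  using assms(1)
proof (induction rule: forms_induct)
  case (const c)
  then show ?case using forms_const by simp
next
  case (coord d f i)
  then show ?case using forms_mult[OF F[of i] coord.IH] by simp
next
  case (add d f g)
  then show ?case by (intro forms_add)
qed

lemma functional_eq_sum:
  fixes l :: "complex^'n::finite \<Rightarrow> complex"
  assumes "Vector_Spaces.linear (*s) (*) l"
  shows "l x = (\<Sum>i\<in>UNIV. l (axis i 1) * x $ i)"
proof -
  interpret l: Vector_Spaces.linear "(*s)" "(*)" l by (rule assms)
  have "l x = l (\<Sum>i\<in>UNIV. x $ i *s axis i 1)" by (simp add: basis_expansion)
  then show ?thesis by (simp add: l.sum l.scale mult.commute)
qed

lemma forms_linear:
  assumes "Vector_Spaces.linear (*s) (*) l"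
  shows "l \<in> forms 1"
proof -
  have "l x = (\<Sum>i\<in>UNIV. l (axis i 1) * x $ i)" for x by (rule functional_eq_sum[OF assms])
  then have "l = (\<lambda>x. \<Sum>i\<in>UNIV. l (axis i 1) * x $ i)" by (rule ext)
  moreover have "\<dots> \<in> forms 1" by (intro forms_sum forms_cmult forms_coord)
  ultimately show ?thesis by simp
qed

text \<open>
  Tangent spaces are defined by derivatives along straight lines. Differentiating along a
  parametrised curve instead is possible because all these derivatives come from one gradient.
\<close>

lemma forms_chain_rule:
  fixes f :: "complex^'n::finite \<Rightarrow> complex"
  assumes "f \<in> forms d"
  shows "\<exists>g. \<forall>c c'. c t = x \<and> (\<forall>i. ((\<lambda>t. c t $ i) has_field_derivative c' $ i) (at t)) \<longrightarrow>
           ((\<lambda>t. f (c t)) has_field_derivative (\<Sum>i\<in>UNIV. g i * c' $ i)) (at t)"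
  using assms
proof (induction rule: forms_induct)
  case (const c)
  show ?case by (intro exI[of _ "\<lambda>_. 0"]) simp
next
  case (coord d f j)
  from coord.IH obtain g where
    g: "\<And>c c'. c t = x \<Longrightarrow> (\<And>i. ((\<lambda>t. c t $ i) has_field_derivative c' $ i) (at t)) \<Longrightarrow>
         ((\<lambda>t. f (c t)) has_field_derivative (\<Sum>i\<in>UNIV. g i * c' $ i)) (at t)" by blast
  show ?case
  proof (intro exI[of _ "\<lambda>i. x $ j * g i + (if i = j then f x else 0)"] allI impI, elim conjE)
    fix c c' assume c: "c t = x" "\<forall>i. ((\<lambda>t. c t $ i) has_field_derivative c' $ i) (at t)"
    have *: "(\<Sum>i\<in>UNIV. (x $ j * g i + (if i = j then f x else 0)) * c' $ i)
        = c' $ j * f (c t) + (\<Sum>i\<in>UNIV. g i * c' $ i) * (c t $ j)"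
      by (simp add: c distrib_right sum.distrib sum_distrib_left mult.assoc
          if_distrib[where f="\<lambda>z. z * _"] cong: if_cong) (simp add: ac_simps sum_distrib_left)
    show "((\<lambda>t. c t $ j * f (c t)) has_field_derivative
        (\<Sum>i\<in>UNIV. (x $ j * g i + (if i = j then f x else 0)) * c' $ i)) (at t)"
      unfolding * using c by (intro DERIV_mult g) auto
  qed
next
  case (add d f h)
  then obtain g g' where
    "\<And>c c'. c t = x \<Longrightarrow> (\<And>i. ((\<lambda>t. c t $ i) has_field_derivative c' $ i) (at t)) \<Longrightarrow>
         ((\<lambda>t. f (c t)) has_field_derivative (\<Sum>i\<in>UNIV. g i * c' $ i)) (at t)"
    "\<And>c c'. c t = x \<Longrightarrow> (\<And>i. ((\<lambda>t. c t $ i) has_field_derivative c' $ i) (at t)) \<Longrightarrow>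
         ((\<lambda>t. h (c t)) has_field_derivative (\<Sum>i\<in>UNIV. g' i * c' $ i)) (at t)" by metis
  then show ?case
    by (intro exI[of _ "\<lambda>i. g i + g' i"]) (auto simp: distrib_right sum.distrib intro!: DERIV_add)
qed

lemma forms_deriv_curve:
  fixes f :: "complex^'n::finite \<Rightarrow> complex"
  assumes "f \<in> forms d" and c: "\<And>i. ((\<lambda>t. c t $ i) has_field_derivative w $ i) (at 0)"
  shows "((\<lambda>t. f (c t)) has_field_derivative deriv (\<lambda>t. f (c 0 + t *s w)) 0) (at 0)"
proof -
  obtain g where g: "\<And>b b'. b 0 = c 0 \<Longrightarrow> (\<And>i. ((\<lambda>t. b t $ i) has_field_derivative b' $ i) (at 0)) \<Longrightarrow>
         ((\<lambda>t. f (b t)) has_field_derivative (\<Sum>i\<in>UNIV. g i * b' $ i)) (at 0)"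
    using forms_chain_rule[OF assms(1), of 0 "c 0"] by blast
  have "((\<lambda>t. f (c 0 + t *s w)) has_field_derivative (\<Sum>i\<in>UNIV. g i * w $ i)) (at 0)"
    by (rule g) (auto intro!: derivative_eq_intros)
  then have "deriv (\<lambda>t. f (c 0 + t *s w)) 0 = (\<Sum>i\<in>UNIV. g i * w $ i)" by (rule DERIV_imp_deriv)
  then show ?thesis using g[of c w] c by simp
qed

lemma forms_deriv_linear:
  fixes f :: "complex^'n::finite \<Rightarrow> complex"
  assumes "f \<in> forms d"
  shows "\<exists>g. \<forall>w. deriv (\<lambda>t. f (x + t *s w)) 0 = (\<Sum>i\<in>UNIV. g i * w $ i)"
proof -
  obtain g where g: "\<And>b b'. b 0 = x \<Longrightarrow> (\<And>i. ((\<lambda>t. b t $ i) has_field_derivative b' $ i) (at 0)) \<Longrightarrow>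
         ((\<lambda>t. f (b t)) has_field_derivative (\<Sum>i\<in>UNIV. g i * b' $ i)) (at 0)"
    using forms_chain_rule[OF assms(1), of 0 x] by blast
  have "((\<lambda>t. f (x + t *s w)) has_field_derivative (\<Sum>i\<in>UNIV. g i * w $ i)) (at 0)" for w
    by (rule g) (auto intro!: derivative_eq_intros)
  then show ?thesis by (meson DERIV_imp_deriv)
qed

section \<open>Projective points, closed sets and tangent spaces\<close>

lemma span_line: "vec.span {v} = range (\<lambda>c. c *s (v :: complex^'n::finite))"
  by (rule vec.span_singleton)

lemma line_base [simp]: "v \<in> vec.span {v :: complex^'n::finite}"
  by (simp add: vec.span_base)

lemma span_line_eq_iff:
  fixes v w :: "complex^'n::finite"
  assumes "w \<noteq> 0"
  shows "vec.span {v} = vec.span {w} \<longleftrightarrow> (\<exists>c. c \<noteq> 0 \<and> w = c *s v)"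
proof
  assume "vec.span {v} = vec.span {w}"
  then have "w \<in> range (\<lambda>c. c *s v)" using vec.span_base[of w "{w}"] span_line by blast
  then obtain c where "w = c *s v" by auto
  then show "\<exists>c. c \<noteq> 0 \<and> w = c *s v" using assms by auto
next
  assume "\<exists>c. c \<noteq> 0 \<and> w = c *s v"
  then obtain c where c: "c \<noteq> 0" "w = c *s v" by auto
  then have "v = (1 / c) *s w" by (simp add: vector_smult_assoc)
  then show "vec.span {v} = vec.span {w}" unfolding span_line using c
    by (auto simp: image_iff vector_smult_assoc intro!: exI[of _ "_ / c"])
qed

lemma span_line_scale: "c \<noteq> 0 \<Longrightarrow> vec.span {c *s v} = vec.span {v :: complex^'n::finite}"
  by (cases "v = 0") (use span_line_eq_iff[of "c *s v" v] in auto)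

lemma proj_spaceI: "v \<noteq> 0 \<Longrightarrow> vec.span {v} \<in> proj_space"
  unfolding proj_space_def by blast

lemma proj_space_cases:
  assumes "p \<in> proj_space"
  obtains v where "v \<noteq> 0" "p = vec.span {v}"
  using assms unfolding proj_space_def by blast

lemma form_vanishes_on_line:
  assumes "f \<in> forms d" "v \<noteq> 0" 
  shows "(\<forall>x\<in>vec.span {v}. f x = 0) \<longleftrightarrow> f v = 0"
  using assms vec.span_base[of v "{v}"] by (auto simp: span_line forms_homogeneous)

lemma zariski_closedI:
  assumes "X \<subseteq> proj_space"
    and "\<And>v. v \<noteq> 0 \<Longrightarrow> (\<And>d f. f \<in> vanishing_forms X d \<Longrightarrow> f v = 0) \<Longrightarrow> vec.span {v} \<in> X"
  shows "zariski_closed X"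
  unfolding zariski_closed_def
proof (intro exI[of _ "\<Union>d. vanishing_forms X d"] conjI)
  show "(\<Union>d. vanishing_forms X d) \<subseteq> \<Union> (range forms)"
    by (auto simp: vanishing_forms_def)
  show "X = {p \<in> proj_space. \<forall>f\<in>\<Union>d. vanishing_forms X d. \<forall>x\<in>p. f x = 0}"
  proof
    show "X \<subseteq> {p \<in> proj_space. \<forall>f\<in>\<Union>d. vanishing_forms X d. \<forall>x\<in>p. f x = 0}"
      using assms(1) by (auto simp: vanishing_forms_def)
    show "{p \<in> proj_space. \<forall>f\<in>\<Union>d. vanishing_forms X d. \<forall>x\<in>p. f x = 0} \<subseteq> X"
    proof safe
      fix p :: "'a point" assume p: "p \<in> proj_space" "\<forall>f\<in>\<Union>d. vanishing_forms X d. \<forall>x\<in>p. f x = 0"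
      then obtain v where v: "v \<noteq> 0" "p = vec.span {v}" by (rule_tac proj_space_cases)
      then show "p \<in> X" using p(2) vec.span_base[of v "{v}"] by (auto intro!: assms(2))
    qed
  qed
qed

lemma zariski_closed_mem:
  assumes "zariski_closed X" "v \<noteq> 0" "\<And>d f. f \<in> vanishing_forms X d \<Longrightarrow> f v = 0"
  shows "vec.span {v} \<in> X"
proof -
  obtain F where F: "F \<subseteq> (\<Union>d. forms d)" "X = {p \<in> proj_space. \<forall>f\<in>F. \<forall>x\<in>p. f x = 0}"
    using assms(1) unfolding zariski_closed_def by blast
  have "\<forall>x\<in>vec.span {v}. f x = 0" if "f \<in> F" for f
  proof -
    from that F obtain d where "f \<in> forms d" by auto
    moreover from this that F have "f \<in> vanishing_forms X d" by (auto simp: vanishing_forms_def)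
    ultimately show ?thesis using assms form_vanishes_on_line by blast
  qed
  then show ?thesis using F assms(2) by (auto intro: proj_spaceI)
qed

lemma zariski_closure_closed:
  assumes "zariski_closed X"
  shows "zariski_closure X = X"
  using assms unfolding zariski_closure_def by blast

lemma subspace_tangent_space: "vec.subspace (tangent_space X p)"
proof -
  have *: "vec.subspace {w. deriv (\<lambda>t. f (x + t *s w)) 0 = 0}" if "f \<in> vanishing_forms X d" for f x d
  proof -
    from that have "f \<in> forms d" by (simp add: vanishing_forms_def)
    from forms_deriv_linear[OF this, of x] obtain g
      where g: "\<And>w. deriv (\<lambda>t. f (x + t *s w)) 0 = (\<Sum>i\<in>UNIV. g i * w $ i)" by blast
    show ?thesis unfolding g
      by (rule vec.subspaceI) (auto simp: distrib_left sum.distrib mult.left_commute[of "g _"] simp flip: sum_distrib_left)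
  qed
  have eq: "tangent_space X p = (\<Inter>d. \<Inter>f\<in>vanishing_forms X d. \<Inter>x\<in>p - {0}. {w. deriv (\<lambda>t. f (x + t *s w)) 0 = 0})"
    unfolding tangent_space_def by auto
  show ?thesis unfolding eq by (intro vec.subspace_Inter ballI) (auto intro!: vec.subspace_Inter *)
qed

text \<open>
  By homogeneity the derivatives at two representatives of a point differ by a factor, so one
  representative suffices.
\<close>

lemma tangent_spaceI:
  assumes "v \<noteq> 0"
    and "\<And>d f. f \<in> vanishing_forms X d \<Longrightarrow> deriv (\<lambda>t. f (v + t *s w)) 0 = 0"
  shows "w \<in> tangent_space X (vec.span {v})"
  unfolding tangent_space_def
proof (intro CollectI allI ballI)
  fix d f x assume f: "f \<in> vanishing_forms X d" and x: "x \<in> vec.span {v} - {0}"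
  from x obtain c where c: "c \<noteq> 0" "x = c *s v" by (auto simp: span_line)
  have fd: "f \<in> forms d" using f by (simp add: vanishing_forms_def)
  have "((\<lambda>t. f (v + (t / c) *s w)) has_field_derivative (deriv (\<lambda>t. f (v + t *s ((1 / c) *s w))) 0)) (at 0)"
  proof -
    have "((\<lambda>t. (v + (t / c) *s w) $ i) has_field_derivative ((1 / c) *s w) $ i) (at 0)" for i
      using c by (auto intro!: derivative_eq_intros)
    from forms_deriv_curve[OF fd this] show ?thesis by simp
  qed
  moreover have "deriv (\<lambda>t. f (v + t *s ((1 / c) *s w))) 0 = 0"
  proof -
    obtain g where g: "\<And>w. deriv (\<lambda>t. f (v + t *s w)) 0 = (\<Sum>i\<in>UNIV. g i * w $ i)"
      using forms_deriv_linear[OF fd, of v] by blast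
    then show ?thesis using assms(2)[OF f]
      unfolding g by (simp add: sum_divide_distrib[symmetric])
  qed
  ultimately have "((\<lambda>t. c ^ d * f (v + (t / c) *s w)) has_field_derivative c ^ d * 0) (at 0)"
    by (intro DERIV_cmult) auto
  moreover have "c ^ d * f (v + (t / c) *s w) = f (x + t *s w)" for t
    unfolding forms_homogeneous[OF fd, symmetric] using c
    by (simp add: vector_add_ldistrib vector_smult_assoc)
  ultimately have "((\<lambda>t. f (x + t *s w)) has_field_derivative 0) (at 0)" by simp
  then show "deriv (\<lambda>t. f (x + t *s w)) 0 = 0" by (rule DERIV_imp_deriv)
qed

lemma tangent_spaceD:
  assumes "w \<in> tangent_space X (vec.span {v})" "v \<noteq> 0" "f \<in> vanishing_forms X d"
  shows "deriv (\<lambda>t. f (v + t *s w)) 0 = 0"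
proof -
  have "v \<in> vec.span {v} - {0}" using assms(2) vec.span_base[of v "{v}"] by simp
  moreover have "\<forall>d. \<forall>f \<in> vanishing_forms X d. \<forall>x \<in> vec.span {v} - {0}. deriv (\<lambda>t. f (x + t *s w)) 0 = 0"
    using assms(1) unfolding tangent_space_def by (rule CollectD)
  ultimately show ?thesis using assms(3) by (meson bspec)
qed

section \<open>Conics in a frame of coordinates\<close>

text \<open>
  Besides a basis, a frame carries the dual coordinates, in which equations are written. The conics
  below lie in the plane \<open>c3 = 0\<close>; the last basis vector only completes the basis.
\<close>

locale frame =
  fixes e0 e1 e2 e3 :: "complex^4" and c0 c1 c2 c3 :: "complex^4 \<Rightarrow> complex"
  assumes lin: "Vector_Spaces.linear (*s) (*) c0" "Vector_Spaces.linear (*s) (*) c1"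
      "Vector_Spaces.linear (*s) (*) c2" "Vector_Spaces.linear (*s) (*) c3"
    and dual [simp]: "c0 e0 = 1" "c0 e1 = 0" "c0 e2 = 0" "c0 e3 = 0"
      "c1 e0 = 0" "c1 e1 = 1" "c1 e2 = 0" "c1 e3 = 0"
      "c2 e0 = 0" "c2 e1 = 0" "c2 e2 = 1" "c2 e3 = 0"
      "c3 e0 = 0" "c3 e1 = 0" "c3 e2 = 0" "c3 e3 = 1"
    and expand: "\<And>z. z = c0 z *s e0 + c1 z *s e1 + c2 z *s e2 + c3 z *s e3"
begin

lemma coord_simps:
  "c0 (x + y) = c0 x + c0 y" "c1 (x + y) = c1 x + c1 y" "c2 (x + y) = c2 x + c2 y" "c3 (x + y) = c3 x + c3 y"
  "c0 (a *s x) = a * c0 x" "c1 (a *s x) = a * c1 x" "c2 (a *s x) = a * c2 x" "c3 (a *s x) = a * c3 x"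
  "c0 (x - y) = c0 x - c0 y" "c1 (x - y) = c1 x - c1 y" "c2 (x - y) = c2 x - c2 y" "c3 (x - y) = c3 x - c3 y"
  "c0 (- x) = - c0 x" "c1 (- x) = - c1 x" "c2 (- x) = - c2 x" "c3 (- x) = - c3 x"
  "c0 0 = 0" "c1 0 = 0" "c2 0 = 0" "c3 0 = 0"
proof -
  interpret l0: Vector_Spaces.linear "(*s)" "(*)" c0 by (rule lin)
  interpret l1: Vector_Spaces.linear "(*s)" "(*)" c1 by (rule lin)
  interpret l2: Vector_Spaces.linear "(*s)" "(*)" c2 by (rule lin)
  interpret l3: Vector_Spaces.linear "(*s)" "(*)" c3 by (rule lin)
  show
    "c0 (x + y) = c0 x + c0 y" "c1 (x + y) = c1 x + c1 y" "c2 (x + y) = c2 x + c2 y" "c3 (x + y) = c3 x + c3 y"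
    "c0 (a *s x) = a * c0 x" "c1 (a *s x) = a * c1 x" "c2 (a *s x) = a * c2 x" "c3 (a *s x) = a * c3 x"
    "c0 (x - y) = c0 x - c0 y" "c1 (x - y) = c1 x - c1 y" "c2 (x - y) = c2 x - c2 y" "c3 (x - y) = c3 x - c3 y"
    "c0 (- x) = - c0 x" "c1 (- x) = - c1 x" "c2 (- x) = - c2 x" "c3 (- x) = - c3 x"
  "c0 0 = 0" "c1 0 = 0" "c2 0 = 0" "c3 0 = 0"
    by (fact l0.add l1.add l2.add l3.add l0.scale l1.scale l2.scale l3.scale
      l0.diff l1.diff l2.diff l3.diff l0.neg l1.neg l2.neg l3.neg l0.zero l1.zero l2.zero l3.zero)+
qed

lemma coords_eqI: "c0 z = c0 w \<Longrightarrow> c1 z = c1 w \<Longrightarrow> c2 z = c2 w \<Longrightarrow> c3 z = c3 w \<Longrightarrow> z = w"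
  using expand[of z] expand[of w] by simp

lemma coords_eq_iff: "z = w \<longleftrightarrow> c0 z = c0 w \<and> c1 z = c1 w \<and> c2 z = c2 w \<and> c3 z = c3 w"
  using coords_eqI by blast

lemma forms_coords: "c0 \<in> forms 1" "c1 \<in> forms 1" "c2 \<in> forms 1" "c3 \<in> forms 1"
  by (intro forms_linear lin)+

end

lemma vector_4 [simp]:
  "(vector [w, x, y, z] :: 'a::zero ^ 4) $ 1 = w" "(vector [w, x, y, z] :: 'a ^ 4) $ 2 = x"
  "(vector [w, x, y, z] :: 'a ^ 4) $ 3 = y" "(vector [w, x, y, z] :: 'a ^ 4) $ 4 = z"
  unfolding vector_def by simp_all

text \<open>
  The coordinates are the rows of the inverse of the matrix with columns \<open>e0, e1, e2, e3\<close>.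
\<close>

lemma frame_exists:
  assumes "\<And>a b c d. a *s e0 + b *s e1 + c *s e2 + d *s e3 = 0 \<Longrightarrow> a = 0 \<and> b = 0 \<and> c = 0 \<and> d = 0"
  obtains c0 c1 c2 c3 where "frame e0 e1 e2 e3 c0 c1 c2 c3"
proof -
  define E :: "complex^4^4" where "E = (\<chi> i j. vector [e0 $ i, e1 $ i, e2 $ i, e3 $ i] $ j)"
  have E: "E *v x = x $ 1 *s e0 + x $ 2 *s e1 + x $ 3 *s e2 + x $ 4 *s e3" for x
    by (simp add: vec_eq_iff E_def matrix_vector_mult_def sum_4 mult.commute vector_4)
  have "x = 0" if "E *v x = 0" for x
    using assms[of "x $ 1" "x $ 2" "x $ 3" "x $ 4"] that unfolding E
    by (simp add: vec_eq_iff forall_4)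
  then obtain B where BE: "B ** E = mat 1" using matrix_left_invertible_ker[of E] by blast
  then have EB: "E ** B = mat 1" by (simp add: matrix_left_right_inverse)
  have BEv: "B *v (E *v x) = x" for x by (simp add: matrix_vector_mul_assoc BE)
  have EBv: "E *v (B *v x) = x" for x by (simp add: matrix_vector_mul_assoc EB)
  have e: "e0 = E *v axis 1 1" "e1 = E *v axis 2 1" "e2 = E *v axis 3 1" "e3 = E *v axis 4 1"
    unfolding E by (simp_all add: axis_def)
  have "frame e0 e1 e2 e3 (\<lambda>z. (B *v z) $ 1) (\<lambda>z. (B *v z) $ 2) (\<lambda>z. (B *v z) $ 3) (\<lambda>z. (B *v z) $ 4)"
  proof
    show "z = (B *v z) $ 1 *s e0 + (B *v z) $ 2 *s e1 + (B *v z) $ 3 *s e2 + (B *v z) $ 4 *s e3" for z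
      using EBv[of z] unfolding E by simp
    show "(B *v e0) $ 1 = 1" "(B *v e1) $ 1 = 0" "(B *v e2) $ 1 = 0" "(B *v e3) $ 1 = 0"
      "(B *v e0) $ 2 = 0" "(B *v e1) $ 2 = 1" "(B *v e2) $ 2 = 0" "(B *v e3) $ 2 = 0"
      "(B *v e0) $ 3 = 0" "(B *v e1) $ 3 = 0" "(B *v e2) $ 3 = 1" "(B *v e3) $ 3 = 0"
      "(B *v e0) $ 4 = 0" "(B *v e1) $ 4 = 0" "(B *v e2) $ 4 = 0" "(B *v e3) $ 4 = 1"
      unfolding e BEv by (simp_all add: axis_def)
  qed (simp_all add: matrix_vector_right_distrib vec.scale)
  then show ?thesis by (rule that)
qed

text \<open>
  The factor 2 makes this parametrisation of a conic stable under linear substitutions of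
  \<open>(s, t)\<close>, and its tangent line at \<open>(s, t)\<close> is spanned by \<open>s e0 + t e1\<close> and \<open>s e1 + t e2\<close>.
\<close>

definition conic_pt :: "complex^4 \<Rightarrow> complex^4 \<Rightarrow> complex^4 \<Rightarrow> complex \<Rightarrow> complex \<Rightarrow> complex^4" where
  "conic_pt e0 e1 e2 s t = s\<^sup>2 *s e0 + (2 * s * t) *s e1 + t\<^sup>2 *s e2"

definition conic_of :: "complex^4 \<Rightarrow> complex^4 \<Rightarrow> complex^4 \<Rightarrow> 4 point set" where
  "conic_of e0 e1 e2 = {vec.span {conic_pt e0 e1 e2 s t} | s t. (s, t) \<noteq> (0, 0)}"

lemma conic_pt_scale: "conic_pt e0 e1 e2 (c * s) (c * t) = c\<^sup>2 *s conic_pt e0 e1 e2 s t"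
  by (simp add: conic_pt_def vec_eq_iff power2_eq_square algebra_simps)

context frame
begin

abbreviation "pt \<equiv> conic_pt e0 e1 e2"
abbreviation "curve \<equiv> conic_of e0 e1 e2"

lemma coords_pt [simp]:
  "c0 (pt s t) = s\<^sup>2" "c1 (pt s t) = 2 * s * t" "c2 (pt s t) = t\<^sup>2" "c3 (pt s t) = 0"
  by (simp_all add: conic_pt_def coord_simps)

lemma pt_nonzero: "(s, t) \<noteq> (0, 0) \<Longrightarrow> pt s t \<noteq> 0"
  by (auto simp: coords_eq_iff coord_simps)

lemma pt_line_eq_iff:
  assumes "(s, t) \<noteq> (0, 0)" "(s', t') \<noteq> (0, 0)"
  shows "vec.span {pt s t} = vec.span {pt s' t'} \<longleftrightarrow> s * t' = s' * t"
proof
  assume "vec.span {pt s t} = vec.span {pt s' t'}"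
  then obtain c where c: "pt s' t' = c *s pt s t" using span_line_eq_iff[OF pt_nonzero[OF assms(2)]] by blast
  then have "s'\<^sup>2 = c * s\<^sup>2" "s' * t' = c * (s * t)" "t'\<^sup>2 = c * t\<^sup>2"
    by (auto simp: coords_eq_iff coord_simps)
  then have "(s * t' - s' * t)\<^sup>2 = 0" by algebra
  then show "s * t' = s' * t" by simp
next
  assume eq: "s * t' = s' * t"
  obtain k where "s' = k * s" "t' = k * t"
  proof (cases "s = 0")
    case True
    with eq assms show ?thesis by (intro that[of "t' / t"]) auto
  next
    case False
    with eq assms show ?thesis by (intro that[of "s' / s"]) (auto simp: field_simps)
  qed
  moreover have "k \<noteq> 0" using calculation assms(2) by auto
  ultimately show "vec.span {pt s t} = vec.span {pt s' t'}"
    by (simp add: conic_pt_scale span_line_scale)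
qed

lemma conic_mem_iff:
  assumes "z \<noteq> 0"
  shows "vec.span {z} \<in> curve \<longleftrightarrow> c3 z = 0 \<and> (c1 z)\<^sup>2 = 4 * c0 z * c2 z"
proof
  assume "vec.span {z} \<in> curve"
  then obtain s t where "vec.span {pt s t} = vec.span {z}" unfolding conic_of_def by auto
  then obtain c where "z = c *s pt s t" using span_line_eq_iff[OF assms] by blast
  then show "c3 z = 0 \<and> (c1 z)\<^sup>2 = 4 * c0 z * c2 z"
    by (simp add: coord_simps power2_eq_square)
next
  assume z: "c3 z = 0 \<and> (c1 z)\<^sup>2 = 4 * c0 z * c2 z"
  define s t where "s = csqrt (c0 z)" and "t = csqrt (c2 z)"
  have st: "s\<^sup>2 = c0 z" "t\<^sup>2 = c2 z" by (simp_all add: s_def t_def)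
  have "(c1 z)\<^sup>2 = (2 * s * t)\<^sup>2" using z st by (simp add: power_mult_distrib)
  then have "c1 z = 2 * s * t \<or> c1 z = 2 * s * (- t)" unfolding power2_eq_iff by simp
  moreover have "(- t)\<^sup>2 = c2 z" by (simp add: st)
  ultimately obtain t' where "c1 z = 2 * s * t'" "t'\<^sup>2 = c2 z" using st by blast
  then have "z = pt s t'" using z st by (simp add: coords_eq_iff)
  moreover have "(s, t') \<noteq> (0, 0)" using calculation assms by (auto simp: conic_pt_def)
  ultimately show "vec.span {z} \<in> curve" unfolding conic_of_def by blast
qed

lemma conic_subset_proj_space: "curve \<subseteq> proj_space"
  unfolding conic_of_def using pt_nonzero proj_spaceI by blast

lemma conicI: "(s, t) \<noteq> (0, 0) \<Longrightarrow> vec.span {pt s t} \<in> curve"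
  unfolding conic_of_def by blast

lemma quadric_in_forms: "(\<lambda>z. (c1 z)\<^sup>2 - 4 * c0 z * c2 z) \<in> forms 2"
proof -
  have "(\<lambda>z. c1 z * c1 z) \<in> forms (1 + 1)" "(\<lambda>z. c0 z * c2 z) \<in> forms (1 + 1)"
    by (intro forms_mult forms_coords)+
  from forms_add[OF this(1) forms_cmult[OF this(2), of "-4"]] show ?thesis
    by (simp add: power2_eq_square mult.assoc numeral_2_eq_2)
qed

lemma conic_mem_cases:
  assumes "p \<in> curve"
  obtains s t where "(s, t) \<noteq> (0, 0)" "p = vec.span {pt s t}"
  using assms unfolding conic_of_def by blast

lemma vanishing_on_conic: "c3 \<in> vanishing_forms curve 1"
  "(\<lambda>z. (c1 z)\<^sup>2 - 4 * c0 z * c2 z) \<in> vanishing_forms curve 2"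
  using forms_coords(4) quadric_in_forms
  by (auto simp: vanishing_forms_def span_line coord_simps power_mult_distrib power2_eq_square
      elim!: conic_mem_cases simp del: One_nat_def)

lemma zariski_closed_conic: "zariski_closed curve"
proof (rule zariski_closedI[OF conic_subset_proj_space])
  fix z :: "complex^4" assume z: "z \<noteq> 0" and v: "\<And>d f. f \<in> vanishing_forms curve d \<Longrightarrow> f z = 0"
  show "vec.span {z} \<in> curve"
    using v[OF vanishing_on_conic(1)] v[OF vanishing_on_conic(2)] conic_mem_iff[OF z] by simp
qed

lemma deriv_quadric:
  "deriv (\<lambda>\<tau>. (c1 (z + \<tau> *s w))\<^sup>2 - 4 * c0 (z + \<tau> *s w) * c2 (z + \<tau> *s w)) 0
     = 2 * c1 z * c1 w - 4 * (c0 z * c2 w + c2 z * c0 w)"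
  unfolding coord_simps by (rule DERIV_imp_deriv) (auto intro!: derivative_eq_intros simp: algebra_simps)

text \<open>
  The equations of the plane and of the conic bound the tangent space from above; it is bounded from
  below by the derivatives of the parametrisation, along which all forms vanishing on the conic
  vanish.
\<close>

lemma tangent_space_conic:
  assumes st: "(s, t) \<noteq> (0, 0)"
  shows "w \<in> tangent_space curve (vec.span {pt s t}) \<longleftrightarrow>
    (\<exists>p r. w = p *s (s *s e0 + t *s e1) + r *s (s *s e1 + t *s e2))"
proof
  assume w: "w \<in> tangent_space curve (vec.span {pt s t})"
  have d: "deriv (\<lambda>\<tau>. c3 (pt s t + \<tau> *s w)) 0 = c3 w"
    unfolding coord_simps by (rule DERIV_imp_deriv) (auto intro!: derivative_eq_intros)
  have 3: "c3 w = 0" using tangent_spaceD[OF w pt_nonzero[OF st] vanishing_on_conic(1)] d by simp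
  have "2 * c1 (pt s t) * c1 w - 4 * (c0 (pt s t) * c2 w + c2 (pt s t) * c0 w) = 0"
    using tangent_spaceD[OF w pt_nonzero[OF st] vanishing_on_conic(2)] unfolding deriv_quadric .
  then have "4 * (s * t * c1 w) = 4 * (s\<^sup>2 * c2 w + t\<^sup>2 * c0 w)" by (simp add: algebra_simps)
  then have eq: "s * t * c1 w = s\<^sup>2 * c2 w + t\<^sup>2 * c0 w" by (simp only: mult_cancel_left) simp
  show "\<exists>p r. w = p *s (s *s e0 + t *s e1) + r *s (s *s e1 + t *s e2)"
  proof (cases "s = 0")
    case True
    then have "t \<noteq> 0" using st by simp
    with True eq 3 show ?thesis
      by (intro exI[of _ "c1 w / t"] exI[of _ "c2 w / t"]) (simp add: coords_eq_iff coord_simps)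
  next
    case False
    have "c2 w = (c1 w - c0 w / s * t) / s * t"
      using eq False by (simp add: field_simps power2_eq_square)
    with False 3 show ?thesis
      by (intro exI[of _ "c0 w / s"] exI[of _ "(c1 w - c0 w / s * t) / s"]) (simp add: coords_eq_iff coord_simps)
  qed
next
  assume "\<exists>p r. w = p *s (s *s e0 + t *s e1) + r *s (s *s e1 + t *s e2)"
  then obtain p r where w: "w = p *s (s *s e0 + t *s e1) + r *s (s *s e1 + t *s e2)" by blast
  show "w \<in> tangent_space curve (vec.span {pt s t})"
  proof (rule tangent_spaceI[OF pt_nonzero[OF st]])
    fix d f assume f: "f \<in> vanishing_forms curve d"
    then have fd: "f \<in> forms d" by (simp add: vanishing_forms_def)
    have "((\<lambda>\<tau>. pt (s + \<tau> * (p / 2)) (t + \<tau> * (r / 2)) $ i) has_field_derivative w $ i) (at 0)" for i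
      unfolding w conic_pt_def by (auto intro!: derivative_eq_intros simp: algebra_simps)
    from forms_deriv_curve[OF fd this]
    have D: "((\<lambda>\<tau>. f (pt (s + \<tau> * (p / 2)) (t + \<tau> * (r / 2)))) has_field_derivative
        deriv (\<lambda>\<tau>. f (pt s t + \<tau> *s w)) 0) (at 0)" by simp
    have "f (pt s' t') = 0" for s' t'
    proof (cases "(s', t') = (0, 0)")
      case True
      have "vec.span {pt s t} \<in> curve" "0 \<in> vec.span {pt s t}"
        using conicI[OF st] by (auto simp: vec.span_zero)
      then show ?thesis using True f by (auto simp: conic_pt_def vanishing_forms_def)
    next
      case False
      then show ?thesis using f conicI[OF False] vec.span_base[of "pt s' t'" "{pt s' t'}"]
        by (auto simp: vanishing_forms_def)
    qed
    with D show "deriv (\<lambda>\<tau>. f (pt s t + \<tau> *s w)) 0 = 0" by (simp add: DERIV_const DERIV_unique[OF _ DERIV_const])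
  qed
qed

lemma plane_eq: "vec.span {e0, e1, e2} = {z. c3 z = 0}"
proof
  show "vec.span {e0, e1, e2} \<subseteq> {z. c3 z = 0}"
    by (rule vec.span_minimal) (auto intro!: vec.subspaceI simp: coord_simps)
  show "{z. c3 z = 0} \<subseteq> vec.span {e0, e1, e2}"
  proof
    fix z assume "z \<in> {z. c3 z = 0}"
    then have "z = c0 z *s e0 + c1 z *s e1 + c2 z *s e2" using expand[of z] by simp
    then show "z \<in> vec.span {e0, e1, e2}"
      by (metis insertCI vec.span_add vec.span_base vec.span_scale)
  qed
qed

lemma dim_plane: "vec.dim {z. c3 z = 0} = 3"
proof -
  have sub: "vec.subspace {z. c0 z = 0}" "vec.subspace {z. c1 z = 0}"
    by (auto intro!: vec.subspaceI simp: coord_simps)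
  have "e0 \<notin> vec.span {e1, e2}"
    using vec.span_minimal[OF _ sub(1), of "{e1, e2}"] by auto
  moreover have "e1 \<notin> vec.span {e2}"
    using vec.span_minimal[OF _ sub(2), of "{e2}"] by auto
  moreover have "e2 \<noteq> 0" by (auto simp: coords_eq_iff coord_simps)
  ultimately have "vec.independent {e0, e1, e2}"
    by (simp add: vec.independent_insert)
  moreover have "e0 \<noteq> e1" "e0 \<noteq> e2" "e1 \<noteq> e2" by (auto simp: coords_eq_iff)
  then have "card {e0, e1, e2} = 3" by simp
  ultimately show ?thesis unfolding plane_eq[symmetric]
    using vec.dim_span_eq_card_independent by metis
qed

lemma smooth_conic_conic: "smooth_conic curve"
  unfolding smooth_conic_def
proof (intro exI[of _ "{z. c3 z = 0}"] bexI[OF _ quadric_in_forms] conjI ballI impI)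
  show "vec.subspace {z. c3 z = 0}" by (auto intro!: vec.subspaceI simp: coord_simps)
  show "vec.dim {z. c3 z = 0} = 3" by (rule dim_plane)
  show "curve = {p \<in> proj_space. p \<subseteq> {z. c3 z = 0} \<and> (\<forall>x\<in>p. (c1 x)\<^sup>2 - 4 * c0 x * c2 x = 0)}"
  proof (intro equalityI subsetI)
    fix p assume "p \<in> curve"
    then show "p \<in> {p \<in> proj_space. p \<subseteq> {z. c3 z = 0} \<and> (\<forall>x\<in>p. (c1 x)\<^sup>2 - 4 * c0 x * c2 x = 0)}"
      using vanishing_on_conic conic_subset_proj_space by (auto simp: vanishing_forms_def)
  next
    fix p assume p: "p \<in> {p \<in> proj_space. p \<subseteq> {z. c3 z = 0} \<and> (\<forall>x\<in>p. (c1 x)\<^sup>2 - 4 * c0 x * c2 x = 0)}"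
    then obtain v where "v \<noteq> 0" "p = vec.span {v}" by (blast elim: proj_space_cases)
    then show "p \<in> curve" using p vec.span_base[of v "{v}"] conic_mem_iff[of v] by auto
  qed
  fix x assume "x \<in> {z. c3 z = 0}" "x \<noteq> 0 \<and> (c1 x)\<^sup>2 - 4 * c0 x * c2 x = 0"
  then consider "c0 x \<noteq> 0" | "c1 x \<noteq> 0" | "c2 x \<noteq> 0" by (auto simp: coords_eq_iff coord_simps)
  then show "\<exists>w\<in>{z. c3 z = 0}. deriv (\<lambda>\<tau>. (c1 (x + \<tau> *s w))\<^sup>2 - 4 * c0 (x + \<tau> *s w) * c2 (x + \<tau> *s w)) 0 \<noteq> 0"
    unfolding deriv_quadric
    by cases (rule bexI[of _ e2] bexI[of _ e1] bexI[of _ e0]; simp)+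
qed

lemma spanned_plane_conic: "spanned_plane curve = {z. c3 z = 0}"
proof
  have "\<Union>curve \<subseteq> {z. c3 z = 0}"
    using vanishing_on_conic(1) by (auto simp: vanishing_forms_def)
  then show "spanned_plane curve \<subseteq> {z. c3 z = 0}" unfolding spanned_plane_def
    by (intro vec.span_minimal) (auto intro!: vec.subspaceI simp: coord_simps)
  have pt: "pt s t \<in> vec.span (\<Union>curve)" if "(s, t) \<noteq> (0, 0)" for s t
    using conicI[OF that] line_base by (intro vec.span_base) blast
  have e: "pt 1 0 = e0" "pt 0 1 = e2" "(1/4) *s (pt 1 1 - pt 1 (-1)) = e1"
    by (simp_all add: coords_eq_iff coord_simps)
  have "e0 \<in> vec.span (\<Union>curve)" "e2 \<in> vec.span (\<Union>curve)"
    using pt[of 1 0] pt[of 0 1] by (simp_all add: e)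
  moreover have "(1/4) *s (pt 1 1 - pt 1 (-1)) \<in> vec.span (\<Union>curve)"
    by (intro vec.span_scale vec.span_diff pt) auto
  ultimately have "e0 \<in> vec.span (\<Union>curve)" "e2 \<in> vec.span (\<Union>curve)" "e1 \<in> vec.span (\<Union>curve)"
    by (simp_all only: e)
  then show "{z. c3 z = 0} \<subseteq> spanned_plane curve"
    unfolding plane_eq[symmetric] spanned_plane_def
    by (intro vec.span_minimal vec.subspace_span) auto
qed

end

subsection \<open>The isomorphism with the projective line\<close>

lemma vec2_eq_iff: "x = y \<longleftrightarrow> x $ 1 = y $ 1 \<and> x $ 2 = y $ (2::2)"
  by (simp add: vec_eq_iff forall_2)

lemma P1_cases:
  assumes "p \<in> (proj_space :: 2 point set)"
  obtains s t where "(s, t) \<noteq> (0, 0)" "p = vec.span {vector [s, t]}"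
proof -
  obtain v where v: "v \<noteq> 0" "p = vec.span {v}" using assms by (rule proj_space_cases)
  moreover have "v = vector [v $ 1, v $ 2]" by (simp add: vec2_eq_iff vector_2)
  moreover from v have "(v $ 1, v $ 2) \<noteq> (0, 0)" by (simp add: vec2_eq_iff)
  ultimately show ?thesis using that by metis
qed

lemma P1_line_in: "(s, t) \<noteq> (0, 0) \<Longrightarrow> vec.span {vector [s, t] :: complex^2} \<in> proj_space"
  by (rule proj_spaceI) (auto simp: vec2_eq_iff vector_2)

lemma P1_line_eq_iff:
  assumes "(s, t) \<noteq> (0, 0)" "(s', t') \<noteq> (0, 0)"
  shows "vec.span {vector [s, t] :: complex^2} = vec.span {vector [s', t']} \<longleftrightarrow> s * t' = s' * t"
proof
  assume eq: "vec.span {vector [s, t] :: complex^2} = vec.span {vector [s', t']}"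
  have "(vector [s', t'] :: complex^2) \<noteq> 0" using assms by (auto simp: vec2_eq_iff vector_2)
  then obtain c where "(vector [s', t'] :: complex^2) = c *s vector [s, t]"
    using eq span_line_eq_iff by blast
  then show "s * t' = s' * t" by (simp add: vec2_eq_iff vector_2)
next
  assume eq: "s * t' = s' * t"
  obtain k where "s' = k * s" "t' = k * t"
  proof (cases "s = 0")
    case True
    with eq assms show ?thesis by (intro that[of "t' / t"]) auto
  next
    case False
    with eq assms show ?thesis by (intro that[of "s' / s"]) (auto simp: field_simps)
  qed
  moreover from this have "(vector [s', t'] :: complex^2) = k *s vector [s, t]"
    by (simp add: vec2_eq_iff vector_2)
  moreover have "k \<noteq> 0" using calculation assms(2) by auto
  ultimately show "vec.span {vector [s, t] :: complex^2} = vec.span {vector [s', t']}"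
    by (simp add: span_line_scale)
qed

context frame
begin

text \<open>
  Points of the projective line are sets of vectors, so the inverse of the parametrisation can be
  written down without choosing representatives. It is given by \<open>2 c0 : c1\<close> and by \<open>c1 : 2 c2\<close>,
  which are both proportional to \<open>s : t\<close>.
\<close>

definition param_inverse :: "4 point \<Rightarrow> 2 point" where
  "param_inverse p = {x. x = 0 \<or> vec.span {pt (x $ 1) (x $ 2)} = p}"

lemma param_inverse:
  assumes "(s, t) \<noteq> (0, 0)"
  shows "param_inverse (vec.span {pt s t}) = vec.span {vector [s, t]}"
proof -
  have v: "(vector [s, t] :: complex^2) \<noteq> 0" using assms by (auto simp: vec2_eq_iff vector_2)
  have "x \<in> param_inverse (vec.span {pt s t}) \<longleftrightarrow> x \<in> vec.span {vector [s, t]}" for x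
  proof (cases "x = 0")
    case True
    then show ?thesis by (simp add: param_inverse_def vec.span_zero)
  next
    case False
    then have x: "(x $ 1, x $ 2) \<noteq> (0, 0)" by (simp add: vec2_eq_iff)
    have xe: "x = vector [x $ 1, x $ 2]" by (simp add: vec2_eq_iff vector_2)
    have "x \<in> param_inverse (vec.span {pt s t}) \<longleftrightarrow> x $ 1 * t = s * x $ 2"
      using False pt_line_eq_iff[OF x assms] by (simp add: param_inverse_def)
    also have "\<dots> \<longleftrightarrow> vec.span {x} = vec.span {vector [s, t]}"
      using P1_line_eq_iff[OF x assms] xe by simp
    also have "\<dots> \<longleftrightarrow> x \<in> vec.span {vector [s, t]}"
    proof
      assume "vec.span {x} = vec.span {vector [s, t]}"
      then show "x \<in> vec.span {vector [s, t]}" using vec.span_base[of x "{x}"] by auto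
    next
      assume "x \<in> vec.span {vector [s, t]}"
      then obtain c where c: "x = c *s vector [s, t]" by (auto simp: span_line)
      then have "c \<noteq> 0" using False by auto
      then show "vec.span {x} = vec.span {vector [s, t]}" by (simp add: c span_line_scale)
    qed
    finally show ?thesis .
  qed
  then show ?thesis by blast
qed

lemma isomorphism_param_inverse: "isomorphism curve (proj_space :: 2 point set) param_inverse"
  unfolding isomorphism_def
proof (intro conjI)
  show bij: "bij_betw param_inverse curve proj_space"
  proof (rule bij_betw_imageI[OF inj_onI equalityI], goal_cases)
    case (1 p q)
    then show ?case
      by (elim conic_mem_cases) (simp add: param_inverse P1_line_eq_iff pt_line_eq_iff)
  next
    case 2
    show ?case
    proof (rule image_subsetI)
      fix p assume "p \<in> curve"
      then obtain s t where "(s, t) \<noteq> (0, 0)" "p = vec.span {pt s t}" by (rule conic_mem_cases)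
      then show "param_inverse p \<in> proj_space" by (simp only: param_inverse P1_line_in not_False_eq_True)
    qed
  next
    case 3
    show ?case
    proof
      fix p :: "2 point" assume "p \<in> proj_space"
      then obtain s t where st: "(s, t) \<noteq> (0, 0)" "p = vec.span {vector [s, t]}" by (rule P1_cases)
      then show "p \<in> param_inverse ` curve"
        by (intro image_eqI[of _ _ "vec.span {pt s t}"]) (simp_all add: param_inverse conicI)
    qed
  qed
  show "regular_map curve proj_space param_inverse"
    unfolding regular_map_def
  proof (intro conjI ballI)
    show "param_inverse ` curve \<subseteq> proj_space" using bij by (simp add: bij_betw_def)
    fix p assume "p \<in> curve"
    then obtain s t where st: "(s, t) \<noteq> (0, 0)" "p = vec.span {pt s t}" by (rule conic_mem_cases)
    have val: "param_inverse q = vec.span {F x}" if q: "q \<in> curve" "x \<in> q" "F x \<noteq> 0"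
      and F: "F = (\<lambda>z. vector [2 * c0 z, c1 z]) \<or> F = (\<lambda>z. vector [c1 z, 2 * c2 z])" for q x F
    proof -
      from q obtain s' t' where st': "(s', t') \<noteq> (0, 0)" "q = vec.span {pt s' t'}" by (blast elim: conic_mem_cases)
      with q obtain c where c: "x = c *s pt s' t'" by (auto simp: span_line)
      have "F x = (2 * c * s') *s vector [s', t'] \<or> F x = (2 * c * t') *s vector [s', t']"
        using F by (auto simp: c vec2_eq_iff vector_2 coord_simps power2_eq_square)
      then obtain k where "F x = k *s vector [s', t']" by blast
      moreover have "k \<noteq> 0" using calculation q(3) by auto
      ultimately show ?thesis by (simp add: span_line_scale param_inverse[OF st'(1)] st'(2))
    qed
    have fm: "(\<lambda>z. (vector [2 * c0 z, c1 z] :: complex^2) $ i) \<in> forms 1"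
       "(\<lambda>z. (vector [c1 z, 2 * c2 z] :: complex^2) $ i) \<in> forms 1" for i
      using exhaust_2[of i] forms_coords by (auto simp: vector_2 intro: forms_cmult)
    have p: "pt s t \<in> p" using st by simp
    show "\<exists>d F. (\<forall>i. (\<lambda>x. F x $ i) \<in> forms d) \<and> (\<exists>x\<in>p. F x \<noteq> 0) \<and>
         (\<forall>q\<in>curve. \<forall>x\<in>q. F x \<noteq> 0 \<longrightarrow> param_inverse q = vec.span {F x})"
    proof (cases "s = 0")
      case True
      define F :: "complex^4 \<Rightarrow> complex^2" where "F = (\<lambda>z. vector [c1 z, 2 * c2 z])"
      have "F (pt s t) \<noteq> 0" using True st by (simp add: F_def vec2_eq_iff)
      moreover have "\<forall>i. (\<lambda>x. F x $ i) \<in> forms 1" unfolding F_def using fm(2) by blast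
      moreover have "\<forall>q\<in>curve. \<forall>x\<in>q. F x \<noteq> 0 \<longrightarrow> param_inverse q = vec.span {F x}"
        using val[of _ _ F] unfolding F_def by auto
      ultimately show ?thesis using p by (intro exI[of _ 1] exI[of _ F] conjI bexI[of _ "pt s t"])
    next
      case False
      define F :: "complex^4 \<Rightarrow> complex^2" where "F = (\<lambda>z. vector [2 * c0 z, c1 z])"
      have "F (pt s t) \<noteq> 0" using False by (simp add: F_def vec2_eq_iff)
      moreover have "\<forall>i. (\<lambda>x. F x $ i) \<in> forms 1" unfolding F_def using fm(1) by blast
      moreover have "\<forall>q\<in>curve. \<forall>x\<in>q. F x \<noteq> 0 \<longrightarrow> param_inverse q = vec.span {F x}"
        using val[of _ _ F] unfolding F_def by auto
      ultimately show ?thesis using p by (intro exI[of _ 1] exI[of _ F] conjI bexI[of _ "pt s t"])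
    qed
  qed
  show "regular_map proj_space curve (inv_into curve param_inverse)"
    unfolding regular_map_def
  proof (intro conjI ballI)
    show "inv_into curve param_inverse ` proj_space \<subseteq> curve"
      using bij_betw_inv_into[OF bij] by (simp add: bij_betw_def)
    have inv: "inv_into curve param_inverse (vec.span {x}) = vec.span {pt (x $ 1) (x $ 2)}"
      if "x \<noteq> 0" for x
    proof -
      have x: "(x $ 1, x $ 2) \<noteq> (0, 0)" using that by (simp add: vec2_eq_iff)
      have "vector [x $ 1, x $ 2] = x" by (simp add: vec2_eq_iff vector_2)
      then have "vec.span {x} = param_inverse (vec.span {pt (x $ 1) (x $ 2)})"
        using param_inverse[OF x] by simp
      then show ?thesis using bij conicI[OF x] by (simp add: bij_betw_def inv_into_f_f)
    qed
    have fm: "(\<lambda>x :: complex^2. pt (x $ 1) (x $ 2) $ i) \<in> forms 2" for i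
    proof -
      have "(\<lambda>x :: complex^2. e0 $ i * (x $ 1 * x $ 1) + (2 * e1 $ i * (x $ 1 * x $ 2) + e2 $ i * (x $ 2 * x $ 2))) \<in> forms (1 + 1)"
        by (intro forms_add forms_cmult forms_mult forms_coord)
      then show ?thesis by (simp add: conic_pt_def power2_eq_square algebra_simps numeral_2_eq_2)
    qed
    fix p :: "2 point" assume "p \<in> proj_space"
    then obtain v where v: "v \<noteq> 0" "p = vec.span {v}" by (rule proj_space_cases)
    have "pt (v $ 1) (v $ 2) \<noteq> 0" using v(1) by (intro pt_nonzero) (simp add: vec2_eq_iff)
    moreover have "inv_into curve param_inverse q = vec.span {pt (x $ 1) (x $ 2)}"
      if q: "q \<in> proj_space" "x \<in> q" "pt (x $ 1) (x $ 2) \<noteq> 0" for q x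
    proof -
      from q have x: "x \<noteq> 0" by (auto simp: conic_pt_def)
      from q(1) obtain w where "w \<noteq> 0" "q = vec.span {w}" by (rule proj_space_cases)
      then obtain c where "x = c *s w" "q = vec.span {w}" using q(2) by (auto simp: span_line)
      moreover have "c \<noteq> 0" using calculation x by auto
      ultimately have "q = vec.span {x}" by (simp add: span_line_scale)
      then show ?thesis using inv[OF x] by simp
    qed
    ultimately show "\<exists>d F. (\<forall>i. (\<lambda>x. F x $ i) \<in> forms d) \<and> (\<exists>x\<in>p. F x \<noteq> 0) \<and>
         (\<forall>q\<in>proj_space. \<forall>x\<in>q. F x \<noteq> 0 \<longrightarrow> inv_into curve param_inverse q = vec.span {F x})"
      using fm v(2) line_base[of v]
      by (intro exI[of _ 2] exI[of _ "\<lambda>x :: complex^2. pt (x $ 1) (x $ 2)"] conjI bexI[of _ v]) blast+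
  qed
qed

end

section \<open>Frames adapted to a smooth conic\<close>

lemma forms_1_eq:
  fixes f :: "complex^'n::finite \<Rightarrow> complex"
  assumes "f \<in> forms d" "d = 1"
  shows "\<exists>b. f = (\<lambda>x. \<Sum>i\<in>UNIV. b i * x $ i)"
proof -
  have "(d = 0 \<longrightarrow> (\<exists>c. f = (\<lambda>x. c))) \<and> (d = 1 \<longrightarrow> (\<exists>b. f = (\<lambda>x. \<Sum>i\<in>UNIV. b i * x $ i)))"
    using assms(1)
  proof (induction rule: forms_induct)
    case (coord d f j)
    have "\<exists>b. (\<lambda>x. x $ j * f x) = (\<lambda>x :: complex^'n. \<Sum>i\<in>UNIV. b i * x $ i)" if "d = 0"
    proof -
      from that coord.IH obtain c where c: "f = (\<lambda>x. c)" by auto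
      show ?thesis unfolding c
        by (intro exI[of _ "\<lambda>i. if i = j then c else 0"])
          (simp add: if_distrib[where f="\<lambda>z. z * _"] mult.commute[of _ c] cong: if_cong)
    qed
    then show ?case by simp
  next
    case (add d f g)
    have "\<exists>b. (\<lambda>x. f x + g x) = (\<lambda>x :: complex^'n. \<Sum>i\<in>UNIV. b i * x $ i)" if d: "d = 1"
    proof -
      obtain b b' where "f = (\<lambda>x. \<Sum>i\<in>UNIV. b i * x $ i)" "g = (\<lambda>x. \<Sum>i\<in>UNIV. b' i * x $ i)"
        using add.IH d by blast
      then show ?thesis by (intro exI[of _ "\<lambda>i. b i + b' i"]) (simp add: distrib_right sum.distrib)
    qed
    moreover have "\<exists>c. (\<lambda>x. f x + g x) = (\<lambda>x. c)" if "d = 0"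
    proof -
      have "\<exists>a. f = (\<lambda>x. a)" "\<exists>b. g = (\<lambda>x. b)" using add.IH that by simp_all
      then obtain a b where "f = (\<lambda>x. a)" "g = (\<lambda>x. b)" by (elim exE)
      then show ?thesis by (intro exI[of _ "a + b"]) simp
    qed
    ultimately show ?case by blast
  qed auto
  then show ?thesis using assms(2) by simp
qed

lemma forms_2_eq:
  fixes f :: "complex^'n::finite \<Rightarrow> complex"
  assumes "f \<in> forms d" "d = 2"
  shows "\<exists>b. f = (\<lambda>x. \<Sum>i\<in>UNIV. \<Sum>j\<in>UNIV. b i j * x $ i * x $ j)"
proof -
  have "d = 2 \<longrightarrow> (\<exists>b. f = (\<lambda>x. \<Sum>i\<in>UNIV. \<Sum>j\<in>UNIV. b i j * x $ i * x $ j))"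
    using assms(1)
  proof (induction rule: forms_induct)
    case (coord d f k)
    have "\<exists>b. (\<lambda>x. x $ k * f x) = (\<lambda>x :: complex^'n. \<Sum>i\<in>UNIV. \<Sum>j\<in>UNIV. b i j * x $ i * x $ j)" if "d = 1"
    proof -
      from forms_1_eq[OF coord.hyps that] obtain b where b: "f = (\<lambda>x. \<Sum>i\<in>UNIV. b i * x $ i)" by blast
      have "(\<Sum>i\<in>UNIV. \<Sum>j\<in>UNIV. (if i = k then b j else 0) * x $ i * x $ j) = x $ k * f x" for x
      proof -
        have "(\<Sum>i\<in>UNIV. \<Sum>j\<in>UNIV. (if i = k then b j else 0) * x $ i * x $ j)
            = (\<Sum>i\<in>UNIV. if i = k then (\<Sum>j\<in>UNIV. b j * x $ i * x $ j) else 0)"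
          by (intro sum.cong) auto
        then show ?thesis unfolding b by (simp add: sum_distrib_left ac_simps)
      qed
      then show ?thesis by (intro exI[of _ "\<lambda>i j. if i = k then b j else 0"]) (simp add: fun_eq_iff)
    qed
    then show ?case by simp
  next
    case (add d f g)
    show ?case
    proof
      assume "d = 2"
      then obtain b b' where "f = (\<lambda>x. \<Sum>i\<in>UNIV. \<Sum>j\<in>UNIV. b i j * x $ i * x $ j)"
        "g = (\<lambda>x. \<Sum>i\<in>UNIV. \<Sum>j\<in>UNIV. b' i j * x $ i * x $ j)"
        using add.IH by blast
      then show "\<exists>b. (\<lambda>x. f x + g x) = (\<lambda>x. \<Sum>i\<in>UNIV. \<Sum>j\<in>UNIV. b i j * x $ i * x $ j)"
        by (intro exI[of _ "\<lambda>i j. b i j + b' i j"]) (simp add: distrib_right sum.distrib)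
    qed
  qed simp
  then show ?thesis using assms(2) by simp
qed

locale bilinear_sym =
  fixes B :: "complex^'n::finite \<Rightarrow> complex^'n \<Rightarrow> complex"
  assumes sym: "B x y = B y x"
    and add_left: "B (x + y) z = B x z + B y z"
    and scale_left: "B (c *s x) z = c * B x z"
begin

lemma add_right: "B z (x + y) = B z x + B z y"
  by (metis sym add_left)

lemma scale_right: "B z (c *s x) = c * B z x"
  by (metis sym scale_left)

lemma diff_left: "B (x - y) z = B x z - B y z"
  using add_left[of "x - y" y z] by simp

lemma diff_right: "B z (x - y) = B z x - B z y"
  by (metis sym diff_left)

lemma zero_left: "B 0 z = 0"
  using scale_left[of 0 0 z] by simp

lemma zero_right: "B z 0 = 0"
  by (metis sym zero_left)

lemma isotropic_line_iff:
  assumes "vec.subspace W" "x \<noteq> 0"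
  shows "vec.span {x} \<in> {p \<in> proj_space. p \<subseteq> W \<and> (\<forall>y\<in>p. B y y = 0)} \<longleftrightarrow> x \<in> W \<and> B x x = 0"
proof
  assume "vec.span {x} \<in> {p \<in> proj_space. p \<subseteq> W \<and> (\<forall>y\<in>p. B y y = 0)}"
  then show "x \<in> W \<and> B x x = 0" using line_base[of x] by auto
next
  assume "x \<in> W \<and> B x x = 0"
  then show "vec.span {x} \<in> {p \<in> proj_space. p \<subseteq> W \<and> (\<forall>y\<in>p. B y y = 0)}"
    using proj_spaceI[OF assms(2)] vec.subspace_scale[OF assms(1)]
    by (auto simp: span_line scale_left scale_right)
qed

lemmas bilin = add_left scale_left add_right scale_right diff_left diff_right zero_left zero_right

end

text \<open>
  The polar form turns the smoothness condition in the definition of a conic into nondegeneracy of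
  a symmetric bilinear form.
\<close>

lemma polar_form:
  fixes q :: "complex^'n::finite \<Rightarrow> complex"
  assumes "q \<in> forms 2"
  obtains B where "bilinear_sym B" "\<And>x. q x = B x x"
    "\<And>x w. deriv (\<lambda>t. q (x + t *s w)) 0 = 2 * B x w"
proof -
  obtain b where b: "q = (\<lambda>x. \<Sum>i\<in>UNIV. \<Sum>j\<in>UNIV. b i j * x $ i * x $ j)"
    using forms_2_eq[OF assms] by blast
  define B where "B x y = (\<Sum>i\<in>UNIV. \<Sum>j\<in>UNIV. b i j * (x $ i * y $ j + y $ i * x $ j) / 2)" for x y
  have bil: "bilinear_sym B"
    unfolding B_def
    by unfold_locales
      (simp_all add: algebra_simps add_divide_distrib sum.distrib sum_distrib_left)
  interpret bilinear_sym B by (rule bil)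
  have qB: "q x = B x x" for x
    unfolding b B_def by (simp add: algebra_simps)
  have "deriv (\<lambda>t. q (x + t *s w)) 0 = 2 * B x w" for x w
  proof (rule DERIV_imp_deriv)
    have "q (x + t *s w) = B x x + t * (2 * B x w) + t * t * B w w" for t
      unfolding qB by (simp add: bilin sym[of w x] algebra_simps)
    then show "((\<lambda>t. q (x + t *s w)) has_field_derivative 2 * B x w) (at 0)"
      by (auto intro!: derivative_eq_intros)
  qed
  then show ?thesis using that bil qB by blast
qed

lemma span_of_three:
  fixes W :: "(complex^'n::finite) set"
  assumes "vec.dim W = 3" "x \<in> W" "y \<in> W" "z \<in> W"
    and ind: "\<And>a b c. a *s x + b *s y + c *s z = 0 \<Longrightarrow> a = 0 \<and> b = 0 \<and> c = 0"
    and "w \<in> W"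
  obtains a b c where "w = a *s x + b *s y + c *s z"
proof -
  have z: "z \<noteq> 0" using ind[of 0 0 1] by auto
  have y: "y \<notin> vec.span {z}"
  proof
    assume "y \<in> vec.span {z}"
    then obtain c where "y = c *s z" by (auto simp: span_line)
    then show False using ind[of 0 1 "- c"] by (simp add: vec_eq_iff)
  qed
  have x: "x \<notin> vec.span {y, z}"
  proof
    assume "x \<in> vec.span {y, z}"
    then obtain c where "x - c *s y \<in> vec.span {z}" unfolding vec.span_breakdown_eq by blast
    then obtain d where "x - c *s y = d *s z" unfolding span_line by blast
    then have "1 *s x + (- c) *s y + (- d) *s z = 0" by (simp add: vec_eq_iff)
    then show False using ind[of 1 "- c" "- d"] by simp
  qed
  have "vec.independent {x, y, z}" using x y z by (simp add: vec.independent_insert)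
  moreover have "x \<noteq> y" "x \<noteq> z" "y \<noteq> z"
    using x y vec.span_base[of x "{y, z}"] by auto
  then have "card {x, y, z} = 3" by simp
  ultimately have "W \<subseteq> vec.span {x, y, z}"
    using assms by (intro vec.card_ge_dim_independent) auto
  then have "w \<in> vec.span {x, y, z}" using assms by blast
  then obtain a b c where "w - a *s x - b *s y = c *s z"
    by (auto simp: vec.span_breakdown_eq span_line)
  then have "w = a *s x + b *s y + c *s z" by (simp add: vec_eq_iff algebra_simps)
  then show ?thesis by (rule that)
qed

lemma smooth_conicE:
  assumes "smooth_conic C"
  obtains W B where "vec.subspace W" "vec.dim W = 3" "bilinear_sym B"
    "C = {p \<in> proj_space. p \<subseteq> W \<and> (\<forall>x\<in>p. B x x = 0)}"
    "\<And>x. x \<in> W \<Longrightarrow> x \<noteq> 0 \<Longrightarrow> \<exists>w\<in>W. B x w \<noteq> 0"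
proof -
  obtain W q where q: "q \<in> forms 2" and W: "vec.subspace W" "vec.dim W = 3"
    and C: "C = {p \<in> proj_space. p \<subseteq> W \<and> (\<forall>x\<in>p. q x = 0)}"
    and sm: "\<forall>x\<in>W. x \<noteq> 0 \<and> q x = 0 \<longrightarrow> (\<exists>w\<in>W. deriv (\<lambda>t. q (x + t *s w)) 0 \<noteq> 0)"
    using assms unfolding smooth_conic_def by blast
  obtain B where B: "bilinear_sym B" "\<And>x. q x = B x x"
    "\<And>x w. deriv (\<lambda>t. q (x + t *s w)) 0 = 2 * B x w"
    using polar_form[OF q] by blast
  have "\<exists>w\<in>W. B x w \<noteq> 0" if "x \<in> W" "x \<noteq> 0" for x
    using sm that B by (cases "B x x = 0") auto
  then show ?thesis using that W B(1) C B(2) by simp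
qed

text \<open>
  Every two-dimensional subspace contains an isotropic vector \<open>x\<close>, and a vector \<open>w\<close> not orthogonal to it
  becomes isotropic after subtracting a multiple of \<open>x\<close>.
\<close>

lemma smooth_conic_two_points:
  assumes "smooth_conic C"
  obtains p q where "p \<in> C" "q \<in> C" "p \<noteq> q"
proof -
  obtain W B where W: "vec.subspace W" "vec.dim W = 3" and B: "bilinear_sym B"
    and C: "C = {p \<in> proj_space. p \<subseteq> W \<and> (\<forall>x\<in>p. B x x = 0)}"
    and nd: "\<And>x. x \<in> W \<Longrightarrow> x \<noteq> 0 \<Longrightarrow> \<exists>w\<in>W. B x w \<noteq> 0"
    using smooth_conicE[OF assms] by blast
  interpret bilinear_sym B by (rule B)
  have inC: "vec.span {x} \<in> C" if "x \<in> W" "x \<noteq> 0" "B x x = 0" for x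
    using isotropic_line_iff[OF W(1) that(2)] that unfolding C by blast
  have "\<not> W \<subseteq> vec.span {}" using vec.dim_le_card[of W "{}"] W(2) by auto
  then obtain w1 where w1: "w1 \<in> W" "w1 \<noteq> 0" by auto
  have "\<not> W \<subseteq> vec.span {w1}" using vec.dim_le_card[of W "{w1}"] W(2) by auto
  then obtain w2 where w2: "w2 \<in> W" "w2 \<notin> vec.span {w1}" by auto
  obtain x where x: "x \<in> W" "x \<noteq> 0" "B x x = 0"
  proof (cases "B w1 w1 = 0")
    case True
    then show ?thesis using that w1 by blast
  next
    case False
    define t where "t = (- B w1 w2 + csqrt ((B w1 w2)\<^sup>2 - B w1 w1 * B w2 w2)) / B w1 w1"
    have "(B w1 w1 * t + B w1 w2)\<^sup>2 = (B w1 w2)\<^sup>2 - B w1 w1 * B w2 w2"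
      using False by (simp add: t_def)
    then have "B w1 w1 * (B w2 w2 + 2 * t * B w1 w2 + t * t * B w1 w1) = 0"
      by (simp add: algebra_simps power2_eq_square)
    then have "B w2 w2 + 2 * t * B w1 w2 + t * t * B w1 w1 = 0" using False by simp
    then have "B (w2 + t *s w1) (w2 + t *s w1) = 0"
      by (simp add: bilin sym[of w2 w1] algebra_simps)
    moreover have "w2 + t *s w1 \<noteq> 0"
    proof
      assume "w2 + t *s w1 = 0"
      then have "w2 = (- t) *s w1" by (simp add: vec_eq_iff eq_neg_iff_add_eq_0)
      then have "w2 \<in> vec.span {w1}" unfolding span_line by (rule image_eqI) simp
      then show False using w2 by simp
    qed
    moreover have "w2 + t *s w1 \<in> W" using w1 w2 W(1) by (intro vec.subspace_add vec.subspace_scale)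
    ultimately show ?thesis using that by blast
  qed
  obtain w where w: "w \<in> W" "B x w \<noteq> 0" using nd x by blast
  define y where "y = w - (B w w / (2 * B x w)) *s x"
  have yW: "y \<in> W" unfolding y_def using w x W(1) by (intro vec.subspace_diff vec.subspace_scale)
  have xy: "B x y = B x w" by (simp add: y_def bilin x)
  have yy: "B y y = 0" using w by (simp add: y_def bilin x sym[of w x] field_simps)
  have "y \<noteq> 0" using xy w by (auto simp: bilin)
  moreover have "vec.span {x} \<noteq> vec.span {y}"
    using xy w x by (auto simp: span_line_eq_iff[OF \<open>y \<noteq> 0\<close>] bilin)
  ultimately show ?thesis using that inC x yW yy by metis
qed

text \<open>
  Two points of the conic and the pole of the line through them (the intersection of the two
  tangent lines) make up a frame of the plane, in which the conic is the standard one.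
\<close>

lemma smooth_conic_frame:
  assumes "smooth_conic C" "p \<in> C" "q \<in> C" "p \<noteq> q"
  obtains e0 e1 e2 where "p = vec.span {e0}" "q = vec.span {e2}" "C = conic_of e0 e1 e2"
    "\<And>v. v \<notin> spanned_plane C \<Longrightarrow> \<exists>c0 c1 c2 c3. frame e0 e1 e2 v c0 c1 c2 c3"
    "spanned_plane C \<noteq> UNIV"
proof -
  obtain W B where W: "vec.subspace W" "vec.dim W = 3" and B: "bilinear_sym B"
    and C: "C = {p \<in> proj_space. p \<subseteq> W \<and> (\<forall>x\<in>p. B x x = 0)}"
    and nd: "\<And>x. x \<in> W \<Longrightarrow> x \<noteq> 0 \<Longrightarrow> \<exists>w\<in>W. B x w \<noteq> 0"
    using smooth_conicE[OF assms(1)] by blast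
  interpret bilinear_sym B by (rule B)
  obtain x1 x2 where x1: "x1 \<noteq> 0" "p = vec.span {x1}" and x2: "x2 \<noteq> 0" "q = vec.span {x2}"
    using assms(2,3) C by (auto elim!: proj_space_cases)
  have x1': "x1 \<in> W" "B x1 x1 = 0" and x2': "x2 \<in> W" "B x2 x2 = 0"
    using assms(2,3) x1 x2 C line_base by auto
  have ind2: "a = 0 \<and> b = 0" if "a *s x1 + b *s x2 = 0" for a b
  proof -
    have "b = 0"
    proof (rule ccontr)
      assume "b \<noteq> 0"
      moreover from that have "x2 $ i * b = - a * x1 $ i" for i
        by (simp add: vec_eq_iff eq_neg_iff_add_eq_0 algebra_simps)
      ultimately have "x2 = (- a / b) *s x1" by (simp add: vec_eq_iff field_simps)
      moreover from this x2 have "a \<noteq> 0" by auto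
      ultimately have "vec.span {x2} = vec.span {x1}"
        using \<open>b \<noteq> 0\<close> by (metis divide_eq_0_iff neg_equal_0_iff_equal span_line_scale)
      then show False using assms(4) x1 x2 by simp
    qed
    with that x1 show ?thesis by simp
  qed
  have B12: "B x1 x2 \<noteq> 0"
  proof
    assume 0: "B x1 x2 = 0"
    obtain w where w: "w \<in> W" "B x1 w \<noteq> 0" using nd x1 x1' by blast
    define y where "y = x2 - (B x2 w / B x1 w) *s x1"
    have y0: "y \<noteq> 0" using ind2[of "- (B x2 w / B x1 w)" 1] by (auto simp: y_def vec_eq_iff)
    have yW: "y \<in> W" unfolding y_def using x1' x2' W(1) by (intro vec.subspace_diff vec.subspace_scale)
    have perp: "B y x1 = 0" "B y x2 = 0" "B y w = 0"
      using 0 w x1' x2' sym[of x2 x1] by (simp_all add: y_def bilin)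
    have ind: "a = 0 \<and> b = 0 \<and> c = 0" if "a *s x1 + b *s x2 + c *s w = 0" for a b c
    proof -
      have "B x1 (a *s x1 + b *s x2 + c *s w) = 0" using that by (simp add: bilin)
      then have "c = 0" using w 0 x1' by (simp add: bilin)
      then show ?thesis using that ind2 by simp
    qed
    obtain z where z: "z \<in> W" "B y z \<noteq> 0" using nd yW y0 by blast
    obtain a b c where "z = a *s x1 + b *s x2 + c *s w"
      by (rule span_of_three[OF W(2) x1'(1) x2'(1) w(1) ind z(1)])
    then show False using z perp by (simp add: bilin)
  qed
  have "\<not> W \<subseteq> vec.span {x1, x2}"
  proof
    assume "W \<subseteq> vec.span {x1, x2}"
    then have "3 \<le> card {x1, x2}" using vec.dim_le_card[of W "{x1, x2}"] W(2) by auto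
    moreover have "card {x1, x2} \<le> 2" by (simp add: card_insert_if)
    ultimately show False by simp
  qed
  then obtain w where w: "w \<in> W" "w \<notin> vec.span {x1, x2}" by blast
  define a where "a = w - (B w x2 / B x1 x2) *s x1 - (B w x1 / B x1 x2) *s x2"
  have aW: "a \<in> W" unfolding a_def using x1' x2' w W(1) by (intro vec.subspace_diff vec.subspace_scale)
  have perp: "B a x1 = 0" "B a x2 = 0" "B x1 a = 0" "B x2 a = 0"
    using B12 x1' x2' sym[of x2 x1] sym[of x1 w] sym[of x2 w] by (simp_all add: a_def bilin)
  have a0: "a \<noteq> 0"
  proof
    assume "a = 0"
    then have "w = (B w x2 / B x1 x2) *s x1 + (B w x1 / B x1 x2) *s x2" by (simp add: a_def algebra_simps)
    then have "w \<in> vec.span {x1, x2}"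
      by (metis insertCI vec.span_add vec.span_base vec.span_scale)
    then show False using w by simp
  qed
  have ind': "\<alpha> = 0 \<and> \<beta> = 0 \<and> \<gamma> = 0" if "\<alpha> *s x1 + \<beta> *s a + \<gamma> *s x2 = 0" for \<alpha> \<beta> \<gamma>
  proof -
    have "B x1 (\<alpha> *s x1 + \<beta> *s a + \<gamma> *s x2) = 0" "B x2 (\<alpha> *s x1 + \<beta> *s a + \<gamma> *s x2) = 0"
      using that by (simp_all add: bilin)
    then have "\<alpha> = 0" "\<gamma> = 0" using B12 x1' x2' perp sym[of x2 x1] by (simp_all add: bilin)
    then show ?thesis using that a0 by simp
  qed
  have Baa: "B a a \<noteq> 0"
  proof
    assume 0: "B a a = 0"
    obtain z where z: "z \<in> W" "B a z \<noteq> 0" using nd aW a0 by blast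
    obtain \<alpha> \<beta> \<gamma> where "z = \<alpha> *s x1 + \<beta> *s a + \<gamma> *s x2"
      by (rule span_of_three[OF W(2) x1'(1) aW x2'(1) ind' z(1)])
    then show False using z perp 0 by (simp add: bilin)
  qed
  \<comment> \<open>this multiple of \<open>x2\<close> makes the quadratic form a multiple of \<open>c1^2 - 4 c0 c2\<close>\<close>
  define \<kappa> where "\<kappa> = - 2 * B a a / B x1 x2"
  have \<kappa>: "\<kappa> \<noteq> 0" using Baa B12 by (simp add: \<kappa>_def)
  define e2 where "e2 = \<kappa> *s x2"
  have e2W: "e2 \<in> W" using x2' W(1) by (simp add: e2_def vec.subspace_scale)
  have ind: "\<alpha> = 0 \<and> \<beta> = 0 \<and> \<gamma> = 0" if "\<alpha> *s x1 + \<beta> *s a + \<gamma> *s e2 = 0" for \<alpha> \<beta> \<gamma>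
    using ind'[of \<alpha> \<beta> "\<gamma> * \<kappa>"] that \<kappa> by (simp add: e2_def vector_smult_assoc)
  have comb: "\<alpha> *s x1 + \<beta> *s a + \<gamma> *s e2 \<in> W" for \<alpha> \<beta> \<gamma>
    using x1' aW e2W W(1) by (intro vec.subspace_add vec.subspace_scale)
  have fr: "\<exists>c0 c1 c2 c3. frame x1 a e2 v c0 c1 c2 c3" if "v \<notin> W" for v
  proof -
    have "\<alpha> = 0 \<and> \<beta> = 0 \<and> \<gamma> = 0 \<and> \<delta> = 0" if eq: "\<alpha> *s x1 + \<beta> *s a + \<gamma> *s e2 + \<delta> *s v = 0" for \<alpha> \<beta> \<gamma> \<delta>
    proof -
      have "\<delta> = 0"
      proof (rule ccontr)
        assume d: "\<delta> \<noteq> 0"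
        from eq have "\<alpha> * x1 $ i + \<beta> * a $ i + \<gamma> * e2 $ i + \<delta> * v $ i = 0" for i
          by (simp add: vec_eq_iff)
        then have "\<delta> * v $ i = - (\<alpha> * x1 $ i + \<beta> * a $ i + \<gamma> * e2 $ i)" for i
          by (metis add.commute eq_neg_iff_add_eq_0)
        then have "v = (- 1 / \<delta>) *s (\<alpha> *s x1 + \<beta> *s a + \<gamma> *s e2)"
          using d by (simp add: vec_eq_iff field_simps)
        then have "v \<in> W" using vec.subspace_scale[OF W(1) comb] by metis
        then show False using \<open>v \<notin> W\<close> by simp
      qed
      then show ?thesis using eq ind by simp
    qed
    then obtain c0 c1 c2 c3 where "frame x1 a e2 v c0 c1 c2 c3" by (rule frame_exists)
    then show ?thesis by blast
  qed
  have "W \<noteq> UNIV"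
  proof
    assume "W = UNIV"
    then have "vec.dim W = CARD(4)" by (metis vec_dim_card)
    then show False using W(2) by simp
  qed
  then obtain v where v: "v \<notin> W" by blast
  obtain c0 c1 c2 c3 where F: "frame x1 a e2 v c0 c1 c2 c3" using fr[OF v] by blast
  interpret F: frame x1 a e2 v c0 c1 c2 c3 by (rule F)
  have W_eq: "W = {z. c3 z = 0}"
  proof
    show "W \<subseteq> {z. c3 z = 0}"
    proof
      fix z assume z: "z \<in> W"
      obtain \<alpha> \<beta> \<gamma> where "z = \<alpha> *s x1 + \<beta> *s a + \<gamma> *s e2"
        by (rule span_of_three[OF W(2) x1'(1) aW e2W ind z])
      then show "z \<in> {z. c3 z = 0}" by (simp add: F.coord_simps)
    qed
    show "{z. c3 z = 0} \<subseteq> W" unfolding F.plane_eq[symmetric]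
      using x1' aW e2W W(1) by (intro vec.span_minimal) auto
  qed
  have Bzz: "B z z = B a a * ((c1 z)\<^sup>2 - 4 * c0 z * c2 z)" if "z \<in> W" for z
  proof -
    have z: "z = c0 z *s x1 + c1 z *s a + c2 z *s e2" using F.expand[of z] that W_eq by simp
    show ?thesis using B12 x1' x2' perp sym[of x2 x1]
      by (subst (1 2) z) (simp add: e2_def bilin \<kappa>_def field_simps power2_eq_square)
  qed
  have mem: "vec.span {z} \<in> C \<longleftrightarrow> vec.span {z} \<in> F.curve" if "z \<noteq> 0" for z
  proof -
    have "vec.span {z} \<in> C \<longleftrightarrow> z \<in> W \<and> B z z = 0"
      unfolding C by (rule isotropic_line_iff[OF W(1) that])
    also have "\<dots> \<longleftrightarrow> c3 z = 0 \<and> (c1 z)\<^sup>2 = 4 * c0 z * c2 z"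
      using Bzz[of z] Baa by (auto simp: W_eq)
    finally show ?thesis using F.conic_mem_iff[OF that] by simp
  qed
  have CF: "C = F.curve"
  proof (rule set_eqI)
    fix r
    have "r \<in> proj_space" if "r \<in> C \<or> r \<in> F.curve" using that F.conic_subset_proj_space C by blast
    then show "r \<in> C \<longleftrightarrow> r \<in> F.curve" using mem by (metis proj_space_cases)
  qed
  have "spanned_plane C = W" unfolding CF W_eq by (rule F.spanned_plane_conic)
  moreover have "q = vec.span {e2}" unfolding e2_def x2(2) using \<kappa> by (simp add: span_line_scale)
  ultimately show ?thesis using that[OF x1(2) _ CF] fr \<open>W \<noteq> UNIV\<close> by metis
qed

text \<open>
  Any four points of a conic are, in a suitable parametrisation, symmetric with respect to the
  involution \<open>(s, t) \<mapsto> (- s, t)\<close>, and this can be done compatibly with a given partition into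
  two pairs. First normalise the four points to parameters \<open>\<infinity>, 0, \<rho>, 1/\<rho>\<close>; the
  involution \<open>z \<mapsto> 1/z\<close> has fixed points \<open>\<plusminus>1\<close>, which are then moved to \<open>\<infinity>\<close> and \<open>0\<close>.
\<close>

lemma symmetric_frame:
  assumes C: "smooth_conic C"
    and "s1 \<in> C" "s2 \<in> C" "s3 \<in> C" "s4 \<in> C" "distinct [s1, s2, s3, s4]"
  obtains u0 u1 u2 k where "C = conic_of u0 u1 u2" "k \<noteq> 0" "k\<^sup>2 \<noteq> 1"
    "s1 = vec.span {conic_pt u0 u1 u2 1 1}" "s2 = vec.span {conic_pt u0 u1 u2 1 (-1)}"
    "s3 = vec.span {conic_pt u0 u1 u2 k 1}" "s4 = vec.span {conic_pt u0 u1 u2 k (-1)}"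
    "\<And>v. v \<notin> spanned_plane C \<Longrightarrow> \<exists>c0 c1 c2 c3. frame u0 u1 u2 v c0 c1 c2 c3"
    "spanned_plane C \<noteq> UNIV"
proof -
  have "s1 \<noteq> s2" using assms by simp
  obtain e0 e1 e2 where s1: "s1 = vec.span {e0}" and s2: "s2 = vec.span {e2}"
    and Ce: "C = conic_of e0 e1 e2"
    and fr: "\<And>v. v \<notin> spanned_plane C \<Longrightarrow> \<exists>c0 c1 c2 c3. frame e0 e1 e2 v c0 c1 c2 c3"
    and pl: "spanned_plane C \<noteq> UNIV"
    using smooth_conic_frame[OF C assms(2,3) \<open>s1 \<noteq> s2\<close>] by metis
  obtain v0 where v0: "v0 \<notin> spanned_plane C" using pl by blast
  obtain c0 c1 c2 c3 where F: "frame e0 e1 e2 v0 c0 c1 c2 c3" using fr[OF v0] by blast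
  interpret F: frame e0 e1 e2 v0 c0 c1 c2 c3 by (rule F)
  have pt10: "F.pt s 0 = s\<^sup>2 *s e0" "F.pt 0 t = t\<^sup>2 *s e2" for s t by (simp_all add: conic_pt_def)
  have ex: "\<exists>\<sigma>. \<sigma> \<noteq> 0 \<and> r = vec.span {F.pt \<sigma> 1}" if r: "r \<in> C" "r \<noteq> s1" "r \<noteq> s2" for r
  proof -
    obtain s t where st: "(s, t) \<noteq> (0, 0)" "r = vec.span {F.pt s t}"
      using r(1) unfolding Ce by (rule F.conic_mem_cases)
    have "s \<noteq> 0"
    proof
      assume "s = 0"
      then show False using st r s2 by (simp add: pt10 span_line_scale)
    qed
    moreover have "t \<noteq> 0"
    proof
      assume "t = 0"
      then show False using st r s1 by (simp add: pt10 span_line_scale)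
    qed
    ultimately have "r = vec.span {F.pt (s / t) 1}"
      unfolding st(2) by (subst F.pt_line_eq_iff) auto
    then show ?thesis using \<open>s \<noteq> 0\<close> \<open>t \<noteq> 0\<close> by (intro exI[of _ "s / t"]) simp
  qed
  obtain \<sigma> where \<sigma>: "\<sigma> \<noteq> 0" "s3 = vec.span {F.pt \<sigma> 1}" using ex[of s3] assms by auto
  obtain \<tau> where \<tau>: "\<tau> \<noteq> 0" "s4 = vec.span {F.pt \<tau> 1}" using ex[of s4] assms by auto
  have "\<sigma> \<noteq> \<tau>" using assms(6) \<sigma> \<tau> by auto
  define r where "r = csqrt (1 / (\<sigma> * \<tau>))"
  have r2: "r\<^sup>2 * (\<sigma> * \<tau>) = 1" using \<sigma>(1) \<tau>(1) by (simp add: r_def)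
  then have r0: "r \<noteq> 0" by auto
  define \<rho> where "\<rho> = r * \<sigma>"
  have \<rho>0: "\<rho> \<noteq> 0" using r0 \<sigma> by (simp add: \<rho>_def)
  have \<rho>\<tau>: "\<rho> * (r * \<tau>) = 1" using r2 by (simp add: \<rho>_def power2_eq_square ac_simps)
  have \<rho>1: "\<rho> \<noteq> 1" "\<rho> \<noteq> -1"
  proof -
    have "\<rho>\<^sup>2 \<noteq> 1"
    proof
      assume "\<rho>\<^sup>2 = 1"
      then have "\<rho> * (r * \<tau>) = \<rho> * (r * \<sigma>)" using \<rho>\<tau> by (simp add: \<rho>_def power2_eq_square)
      then show False using \<rho>0 r0 \<open>\<sigma> \<noteq> \<tau>\<close> by simp
    qed
    then show "\<rho> \<noteq> 1" "\<rho> \<noteq> -1" by auto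
  qed
  define k where "k = (\<rho> + 1) / (\<rho> - 1)"
  define u0 u1 u2 where "u0 = e0 + (2 * r) *s e1 + r\<^sup>2 *s e2" and "u1 = e0 - r\<^sup>2 *s e2"
    and "u2 = e0 - (2 * r) *s e1 + r\<^sup>2 *s e2"
  have pt: "conic_pt u0 u1 u2 s t = F.pt (s + t) (r * (s - t))" for s t
    by (simp add: conic_pt_def u0_def u1_def u2_def vec_eq_iff power2_eq_square algebra_simps)
  show ?thesis
  proof (rule that[of u0 u1 u2 k])
    show "C = conic_of u0 u1 u2"
    proof (intro equalityI subsetI)
      fix p assume "p \<in> C"
      then obtain s t where st: "(s, t) \<noteq> (0, 0)" "p = vec.span {F.pt s t}"
        unfolding Ce by (rule F.conic_mem_cases)
      have "conic_pt u0 u1 u2 ((s + t / r) / 2) ((s - t / r) / 2) = F.pt s t"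
        unfolding pt using r0 by (simp add: field_simps)
      moreover have "((s + t / r) / 2, (s - t / r) / 2) \<noteq> (0, 0)"
        using st(1) r0 by (auto simp: eq_neg_iff_add_eq_0[symmetric])
      ultimately show "p \<in> conic_of u0 u1 u2" using st(2) unfolding conic_of_def by (metis (mono_tags, lifting) mem_Collect_eq)
    next
      fix p assume "p \<in> conic_of u0 u1 u2"
      then obtain s t where st: "(s, t) \<noteq> (0, 0)" "p = vec.span {F.pt (s + t) (r * (s - t))}"
        unfolding conic_of_def pt by blast
      moreover have "(s + t, r * (s - t)) \<noteq> (0, 0)"
        using st(1) r0 by (auto simp: add_eq_0_iff)
      ultimately show "p \<in> C" unfolding Ce using F.conicI by blast
    qed
    show "k \<noteq> 0" using \<rho>1 by (simp add: k_def add_eq_0_iff2)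
    have "(\<rho> + 1)\<^sup>2 \<noteq> (\<rho> - 1)\<^sup>2" using \<rho>0 by (simp add: power2_eq_square algebra_simps)
    then show "k\<^sup>2 \<noteq> 1" using \<rho>1 by (simp add: k_def power_divide)
    show "s1 = vec.span {conic_pt u0 u1 u2 1 1}" unfolding pt by (simp add: pt10 s1 span_line_scale)
    show "s2 = vec.span {conic_pt u0 u1 u2 1 (-1)}" unfolding pt using r0 by (simp add: pt10 s2 span_line_scale)
    have nz: "(k + 1, r * (k - 1)) \<noteq> (0, 0)" "(k - 1, r * (k + 1)) \<noteq> (0, 0)" using r0
      by (auto simp: add_eq_0_iff2)
    show "s3 = vec.span {conic_pt u0 u1 u2 k 1}" unfolding pt \<sigma>(2)
      using nz(1) \<rho>1 \<rho>0 by (subst F.pt_line_eq_iff) (simp_all add: k_def field_simps \<rho>_def)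
    have "\<tau> = 1 / (r * \<rho>)" using \<rho>\<tau> r0 \<rho>0 by (simp add: field_simps)
    then show "s4 = vec.span {conic_pt u0 u1 u2 k (-1)}" unfolding pt \<tau>(2)
      using nz(2) \<rho>1 \<rho>0 r0 by (subst F.pt_line_eq_iff) (simp_all add: k_def field_simps)
    show "spanned_plane C \<noteq> UNIV" by (rule pl)
    fix v assume "v \<notin> spanned_plane C"
    then obtain d0 d1 d2 d3 where G: "frame e0 e1 e2 v d0 d1 d2 d3" using fr by blast
    interpret G: frame e0 e1 e2 v d0 d1 d2 d3 by (rule G)
    have "\<alpha> = 0 \<and> \<beta> = 0 \<and> \<gamma> = 0 \<and> \<delta> = 0" if eq: "\<alpha> *s u0 + \<beta> *s u1 + \<gamma> *s u2 + \<delta> *s v = 0" for \<alpha> \<beta> \<gamma> \<delta>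
    proof -
      have "d0 (\<alpha> *s u0 + \<beta> *s u1 + \<gamma> *s u2 + \<delta> *s v) = 0" "d1 (\<alpha> *s u0 + \<beta> *s u1 + \<gamma> *s u2 + \<delta> *s v) = 0"
        "d2 (\<alpha> *s u0 + \<beta> *s u1 + \<gamma> *s u2 + \<delta> *s v) = 0" "d3 (\<alpha> *s u0 + \<beta> *s u1 + \<gamma> *s u2 + \<delta> *s v) = 0"
        by (simp_all only: eq G.coord_simps)
      then have "\<alpha> + \<beta> + \<gamma> = 0" "r * (\<alpha> - \<gamma>) = 0" "r\<^sup>2 * (\<alpha> - \<beta> + \<gamma>) = 0" "\<delta> = 0"
        by (simp_all add: u0_def u1_def u2_def G.coord_simps algebra_simps)
      then have "\<alpha> = \<gamma>" "\<alpha> + \<beta> + \<gamma> = 0" "\<alpha> - \<beta> + \<gamma> = 0" "\<delta> = 0" using r0 by simp_all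
      moreover have "\<beta> = 0"
      proof -
        have "2 * \<beta> = (\<alpha> + \<beta> + \<gamma>) - (\<alpha> - \<beta> + \<gamma>)" by simp
        then show ?thesis using calculation by simp
      qed
      ultimately show ?thesis by simp
    qed
    then obtain d0 d1 d2 d3 where "frame u0 u1 u2 v d0 d1 d2 d3" by (rule frame_exists)
    then show "\<exists>c0 c1 c2 c3. frame u0 u1 u2 v c0 c1 c2 c3" by blast
  qed
qed

section \<open>Binary forms\<close>

definition binary_form :: "nat \<Rightarrow> (complex \<Rightarrow> complex \<Rightarrow> complex) \<Rightarrow> bool" where
  "binary_form N g \<longleftrightarrow> (\<exists>p. degree p \<le> N \<and> g = (\<lambda>s t. \<Sum>i\<le>N. coeff p i * s ^ i * t ^ (N - i)))"

lemma binary_form_add: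
  assumes "binary_form N f" "binary_form N g"
  shows "binary_form N (\<lambda>s t. f s t + g s t)"
proof -
  obtain p q where "degree p \<le> N" "f = (\<lambda>s t. \<Sum>i\<le>N. coeff p i * s ^ i * t ^ (N - i))"
    "degree q \<le> N" "g = (\<lambda>s t. \<Sum>i\<le>N. coeff q i * s ^ i * t ^ (N - i))"
    using assms unfolding binary_form_def by blast
  then show ?thesis unfolding binary_form_def
    by (intro exI[of _ "p + q"]) (simp add: degree_add_le distrib_right sum.distrib)
qed

lemma binary_form_cmult:
  assumes "binary_form N f"
  shows "binary_form N (\<lambda>s t. c * f s t)"
proof -
  obtain p where "degree p \<le> N" "f = (\<lambda>s t. \<Sum>i\<le>N. coeff p i * s ^ i * t ^ (N - i))"
    using assms unfolding binary_form_def by blast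
  then show ?thesis unfolding binary_form_def
    by (intro exI[of _ "smult c p"]) (auto simp: sum_distrib_left mult.assoc intro: order_trans[OF degree_smult_le])
qed

lemma binary_form_zero: "binary_form N (\<lambda>s t. 0)"
  unfolding binary_form_def by (intro exI[of _ 0]) simp

lemma binary_form_sum:
  assumes "\<And>i. i \<in> I \<Longrightarrow> binary_form N (f i)"
  shows "binary_form N (\<lambda>s t. \<Sum>i\<in>I. f i s t)"
  using assms by (induction I rule: infinite_finite_induct) (auto intro: binary_form_zero binary_form_add)

lemma binary_form_monomial:
  assumes "i \<le> N"
  shows "binary_form N (\<lambda>s t. s ^ i * t ^ (N - i))"
  unfolding binary_form_def
  using assms by (intro exI[of _ "monom 1 i"])
    (simp add: degree_monom_eq fun_eq_iff if_distrib[where f="\<lambda>c. c * _"] cong: if_cong)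

lemma binary_form_const: "binary_form 0 (\<lambda>s t. c)"
  using binary_form_cmult[OF binary_form_monomial[of 0 0], of c] by simp

lemma binary_form_mult:
  assumes "binary_form M f" "binary_form N g"
  shows "binary_form (M + N) (\<lambda>s t. f s t * g s t)"
proof -
  obtain p q where f: "f = (\<lambda>s t. \<Sum>i\<le>M. coeff p i * s ^ i * t ^ (M - i))"
    and g: "g = (\<lambda>s t. \<Sum>i\<le>N. coeff q i * s ^ i * t ^ (N - i))"
    using assms unfolding binary_form_def by blast
  have *: "s ^ i * t ^ (M - i) * (s ^ j * t ^ (N - j)) = s ^ (i + j) * t ^ (M + N - (i + j))"
    if "i \<le> M" "j \<le> N" for i j and s t :: complex
  proof -
    have "M + N - (i + j) = (M - i) + (N - j)" using that by simp
    then show ?thesis by (simp add: power_add)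
  qed
  have "(coeff p i * s ^ i * t ^ (M - i)) * (coeff q j * s ^ j * t ^ (N - j))
      = (coeff p i * coeff q j) * (s ^ (i + j) * t ^ (M + N - (i + j)))"
    if "i \<le> M" "j \<le> N" for i j and s t :: complex
  proof -
    have "(coeff p i * s ^ i * t ^ (M - i)) * (coeff q j * s ^ j * t ^ (N - j))
      = (coeff p i * coeff q j) * (s ^ i * t ^ (M - i) * (s ^ j * t ^ (N - j)))" by (simp only: ac_simps)
    then show ?thesis using * that by simp
  qed
  then have "f s t * g s t = (\<Sum>i\<le>M. \<Sum>j\<le>N. (coeff p i * coeff q j) * (s ^ (i + j) * t ^ (M + N - (i + j))))" for s t
    unfolding f g sum_product by (intro sum.cong refl) simp
  then show ?thesis
    by (auto intro!: binary_form_sum binary_form_cmult binary_form_monomial)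
qed

lemma binary_form_quadratic:
  "binary_form 2 (\<lambda>s t. a * s\<^sup>2 + b * s * t + c * t\<^sup>2)"
proof -
  have "binary_form 2 (\<lambda>s t. a * (s ^ 2 * t ^ (2 - 2)) + b * (s ^ 1 * t ^ (2 - 1)) + c * (s ^ 0 * t ^ (2 - 0)))"
    by (intro binary_form_add binary_form_cmult binary_form_monomial) auto
  then show ?thesis by (simp add: mult.assoc)
qed

lemma binary_form_conic_coord: "binary_form 2 (\<lambda>s t. conic_pt e0 e1 e2 s t $ i)"
  using binary_form_quadratic[of "e0 $ i" "2 * e1 $ i" "e2 $ i"]
  by (simp add: conic_pt_def algebra_simps)

lemma binary_form_conic_pt:
  assumes "f \<in> forms d"
  shows "binary_form (2 * d) (\<lambda>s t. f (conic_pt e0 e1 e2 s t))"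
  using assms
proof (induction rule: forms_induct)
  case (const c)
  then show ?case using binary_form_const by simp
next
  case (coord d f i)
  from binary_form_mult[OF binary_form_conic_coord coord.IH] show ?case by simp
next
  case (add d f g)
  then show ?case by (intro binary_form_add)
qed

text \<open>
  Setting \<open>t = 1\<close> loses no information about a binary form, and makes the factorisation theory of
  univariate polynomials available.
\<close>

lemma binary_form_poly:
  assumes "binary_form N g"
  obtains p where "\<And>s. g s 1 = poly p s" "p = 0 \<Longrightarrow> g = (\<lambda>s t. 0)"
proof -
  obtain p where p: "degree p \<le> N" "g = (\<lambda>s t. \<Sum>i\<le>N. coeff p i * s ^ i * t ^ (N - i))"
    using assms unfolding binary_form_def by blast
  have "g s 1 = poly p s" for s
  proof -
    have "(\<Sum>i\<le>degree p. coeff p i * s ^ i) = (\<Sum>i\<le>N. coeff p i * s ^ i)"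
      using p(1) by (intro sum.mono_neutral_left) (auto simp: coeff_eq_0)
    then show ?thesis by (simp add: p(2) poly_altdef)
  qed
  moreover have "p = 0 \<Longrightarrow> g = (\<lambda>s t. 0)" by (simp add: p(2))
  ultimately show ?thesis by (rule that)
qed

text \<open>
  Differentiability along lines is all that is needed of the multipliers of the equations of a
  curve when a form vanishing on the curve is differentiated in a tangent direction.
\<close>

definition line_differentiable :: "(complex \<Rightarrow> complex \<Rightarrow> complex \<Rightarrow> complex \<Rightarrow> complex) \<Rightarrow> bool" where
  "line_differentiable U \<longleftrightarrow> (\<forall>s t x y s' t' x' y'.
     (\<lambda>\<tau>. U (s + \<tau> * s') (t + \<tau> * t') (x + \<tau> * x') (y + \<tau> * y')) field_differentiable at 0)"

lemma line_differentiable_add: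
  "line_differentiable U \<Longrightarrow> line_differentiable V \<Longrightarrow> line_differentiable (\<lambda>s t x y. U s t x y + V s t x y)"
  by (simp add: line_differentiable_def field_differentiable_add)

lemma line_differentiable_mult:
  "line_differentiable U \<Longrightarrow> line_differentiable V \<Longrightarrow> line_differentiable (\<lambda>s t x y. U s t x y * V s t x y)"
  by (simp add: line_differentiable_def field_differentiable_mult)

lemma line_differentiable_coord:
  "line_differentiable (\<lambda>s t x y. c)" "line_differentiable (\<lambda>s t x y. s)" "line_differentiable (\<lambda>s t x y. t)"
  "line_differentiable (\<lambda>s t x y. x)" "line_differentiable (\<lambda>s t x y. y)"
  by (auto simp: line_differentiable_def intro!: derivative_intros)

lemma line_differentiable_power:
  "line_differentiable U \<Longrightarrow> line_differentiable (\<lambda>s t x y. U s t x y ^ n)"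
  by (induction n) (auto intro: line_differentiable_mult line_differentiable_coord)

lemma line_differentiable_binary_form:
  assumes "binary_form N g"
  shows "line_differentiable (\<lambda>s t x y. g s t)"
proof -
  obtain p where g: "g = (\<lambda>s t. \<Sum>i\<le>N. coeff p i * s ^ i * t ^ (N - i))"
    using assms unfolding binary_form_def by blast
  have "line_differentiable (\<lambda>s t x y. \<Sum>i\<in>I. coeff p i * s ^ i * t ^ (N - i))" if "finite I" for I
    using that by induction
      (auto intro!: line_differentiable_add line_differentiable_mult line_differentiable_power line_differentiable_coord)
  then show ?thesis unfolding g by simp
qed

lemmas line_differentiable_intros = line_differentiable_add line_differentiable_mult
  line_differentiable_power line_differentiable_coord

section \<open>Tensors and the Segre embedding\<close>

definition tensor :: "complex^'n::finite \<Rightarrow> complex^'m::finite \<Rightarrow> complex^('n \<times> 'm)" where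
  "tensor x y = (\<chi> k. x $ fst k * y $ snd k)"

lemma tensor_nth [simp]: "tensor x y $ (i, j) = x $ i * y $ j"
  by (simp add: tensor_def)

lemma tensor_eq_iff: "z = w \<longleftrightarrow> (\<forall>i j. z $ (i, j) = w $ (i, j))"
  by (auto simp: vec_eq_iff)

lemma tensor_scale: "tensor (a *s x) (b *s y) = (a * b) *s tensor x y"
  by (simp add: tensor_eq_iff)

lemma tensor_nonzero: "x \<noteq> 0 \<Longrightarrow> y \<noteq> 0 \<Longrightarrow> tensor x y \<noteq> 0"
  by (auto simp: vec_eq_iff)

lemma segre_lines: "segre (vec.span {x}, vec.span {y}) = vec.span {tensor x y}"
proof -
  have "segre (vec.span {x}, vec.span {y}) = vec.span {tensor x' y' | x' y'. x' \<in> vec.span {x} \<and> y' \<in> vec.span {y}}"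
    by (simp add: segre_def tensor_def)
  also have "\<dots> = vec.span {tensor x y}"
  proof (rule vec.span_eq[THEN iffD2], intro conjI subsetI)
    fix z assume "z \<in> {tensor x' y' | x' y'. x' \<in> vec.span {x} \<and> y' \<in> vec.span {y}}"
    then show "z \<in> vec.span {tensor x y}" by (auto simp: span_line tensor_scale)
  next
    fix z assume "z \<in> {tensor x y}"
    then show "z \<in> vec.span {tensor x' y' | x' y'. x' \<in> vec.span {x} \<and> y' \<in> vec.span {y}}"
      using line_base[of x] line_base[of y] by (intro vec.span_base) blast
  qed
  finally show ?thesis .
qed

lemma tensor_line_eqD:
  assumes "x \<noteq> 0" "y \<noteq> 0" "x' \<noteq> 0" "y' \<noteq> 0"
    and eq: "vec.span {tensor x y} = vec.span {tensor x' y'}"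
  shows "vec.span {x} = vec.span {x'}" "vec.span {y} = vec.span {y'}"
proof -
  obtain c where c: "c \<noteq> 0" "tensor x' y' = c *s tensor x y"
    using eq span_line_eq_iff[OF tensor_nonzero[OF assms(3,4)]] by blast
  then have e: "x' $ i * y' $ j = c * (x $ i * y $ j)" for i j
    by (simp add: tensor_eq_iff)
  obtain j where j: "y' $ j \<noteq> 0" using assms(4) by (auto simp: vec_eq_iff)
  have "x' = (c * y $ j / y' $ j) *s x" using e[of _ j] j by (simp add: vec_eq_iff field_simps)
  moreover from this have "c * y $ j / y' $ j \<noteq> 0" using assms(3) by auto
  ultimately show "vec.span {x} = vec.span {x'}" using span_line_eq_iff[OF assms(3)] by blast
  obtain i where i: "x' $ i \<noteq> 0" using assms(3) by (auto simp: vec_eq_iff)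
  have "y' = (c * x $ i / x' $ i) *s y" using e[of i] i by (simp add: vec_eq_iff field_simps)
  moreover from this have "c * x $ i / x' $ i \<noteq> 0" using assms(4) by auto
  ultimately show "vec.span {y} = vec.span {y'}" using span_line_eq_iff[OF assms(4)] by blast
qed

lemma first_projection_tensor:
  assumes "x \<noteq> 0" "y \<noteq> 0"
  shows "first_projection (vec.span {tensor x y}) = vec.span {x}"
  unfolding first_projection_def
proof (rule the_equality)
  show "vec.span {x} \<in> proj_space \<and> (\<exists>q\<in>proj_space. vec.span {tensor x y} = segre (vec.span {x}, q))"
    using assms by (auto simp: segre_lines proj_spaceI intro!: bexI[of _ "vec.span {y}"])
  fix p :: "'a point" assume "p \<in> proj_space \<and> (\<exists>q\<in>proj_space. vec.span {tensor x y} = segre (p, q))"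
  then obtain x' y' where "x' \<noteq> 0" "p = vec.span {x'}" "y' \<noteq> (0 :: complex^'b)"
    "vec.span {tensor x y} = segre (p, vec.span {y'})"
    by (auto elim!: proj_space_cases)
  then show "p = vec.span {x}" using tensor_line_eqD(1)[OF assms] by (simp add: segre_lines)
qed

section \<open>The edge curve in coordinates\<close>

locale edge = frame u0 u1 u2 v c0 c1 c2 c3 for u0 u1 u2 v c0 c1 c2 c3 +
  fixes k :: complex
  assumes k0: "k \<noteq> 0" and k1: "k\<^sup>2 \<noteq> 1"
begin

text \<open>
  In the common line of the two planes these are the points in which the second conic meets it. The
  vectors \<open>a, v, b, u1\<close> form a frame as well, and \<open>d0\<close>, \<open>d2\<close> are the coordinates dual to \<open>a\<close>, \<open>b\<close>
  in it.
\<close>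

definition a where "a = u0 - u2"
definition b where "b = k\<^sup>2 *s u0 - u2"

definition d0 where "d0 z = - (1 / (k\<^sup>2 - 1)) * (c0 z + k\<^sup>2 * c2 z)"
definition d2 where "d2 z = (1 / (k\<^sup>2 - 1)) * (c0 z + c2 z)"

lemma k1': "k\<^sup>2 - 1 \<noteq> 0" using k1 by simp

lemma coords_ab [simp]: "c0 a = 1" "c1 a = 0" "c2 a = -1" "c3 a = 0"
   "c0 b = k\<^sup>2" "c1 b = 0" "c2 b = -1" "c3 b = 0"
  by (simp_all add: a_def b_def coord_simps)

sublocale F2: frame a v b u1 d0 c3 d2 c1
proof (rule frame.intro)
  define \<kappa> where "\<kappa> = 1 / (k\<^sup>2 - 1)"
  have \<kappa>: "\<kappa> * (k\<^sup>2 - 1) = 1" using k1' by (simp add: \<kappa>_def)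
  have d: "d0 z = - \<kappa> * (c0 z + k\<^sup>2 * c2 z)" "d2 z = \<kappa> * (c0 z + c2 z)" for z
    by (simp_all add: d0_def d2_def \<kappa>_def)
  show "z = d0 z *s a + c3 z *s v + d2 z *s b + c1 z *s u1" for z
  proof (rule coords_eqI)
    show "c0 z = c0 (d0 z *s a + c3 z *s v + d2 z *s b + c1 z *s u1)"
      using \<kappa> unfolding coord_simps coords_ab dual d by algebra
    show "c2 z = c2 (d0 z *s a + c3 z *s v + d2 z *s b + c1 z *s u1)"
      using \<kappa> unfolding coord_simps coords_ab dual d by algebra
  qed (simp_all add: coord_simps)
  show "d0 a = 1" "d0 b = 0" "d2 a = 0" "d2 b = 1" "d0 v = 0" "d0 u1 = 0" "d2 v = 0" "d2 u1 = 0"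
    using k1' by (simp_all add: d0_def d2_def field_simps)
  show "Vector_Spaces.linear (*s) (*) d0" "Vector_Spaces.linear (*s) (*) d2"
    by unfold_locales (simp_all add: d coord_simps algebra_simps)
qed (rule lin | simp)+

abbreviation "C2 \<equiv> conic_of a v b"
abbreviation "pt2 \<equiv> conic_pt a v b"

text \<open>
  The zeros of \<open>P\<close> and \<open>Q\<close> are the parameters of the points of the first conic whose tangent line
  passes through \<open>a\<close> and \<open>b\<close>, respectively. The equation of the edge curve in the two parameters \<open>(s, t)\<close> and
  \<open>(x, y)\<close> is \<open>x^2 P s t = y^2 Q s t\<close>.
\<close>

definition P where "P s t = s\<^sup>2 - t\<^sup>2" for s t :: complex
definition Q where "Q s t = s\<^sup>2 - k\<^sup>2 * t\<^sup>2" for s t :: complex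

lemma binary_form_PQ: "binary_form 2 P" "binary_form 2 Q"
  using binary_form_quadratic[of 1 0 "-1"] binary_form_quadratic[of 1 0 "- k\<^sup>2"]
  by (simp_all add: P_def[abs_def] Q_def[abs_def])

lemma PQ_coprime: "P s t = 0 \<Longrightarrow> Q s t = 0 \<Longrightarrow> s = 0 \<and> t = 0"
proof -
  assume "P s t = 0" "Q s t = 0"
  then have "s\<^sup>2 = t\<^sup>2" "(k\<^sup>2 - 1) * t\<^sup>2 = 0" by (simp_all add: P_def Q_def algebra_simps)
  then show "s = 0 \<and> t = 0" using k1' by simp
qed

text \<open>
  The edge curve is the image of the space quartic curve \<open>x^2 = Q s t\<close>, \<open>y^2 = P s t\<close> under the
  map \<open>\<Gamma>\<close> given by quartic forms.
\<close>

definition \<Gamma> where "\<Gamma> s t x y = tensor (pt s t) (pt2 x y)"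

definition E where
  "E = {vec.span {\<Gamma> s t x y} | s t x y. (s, t) \<noteq> (0, 0) \<and> x\<^sup>2 = Q s t \<and> y\<^sup>2 = P s t}"

lemma quartic_xy_nonzero:
  assumes "(s, t) \<noteq> (0, 0)" "x\<^sup>2 = Q s t" "y\<^sup>2 = P s t"
  shows "(x, y) \<noteq> (0, 0)"
  using PQ_coprime[of s t] assms by (metis Pair_inject zero_power2)

lemma \<Gamma>_nonzero:
  assumes "(s, t) \<noteq> (0, 0)" "x\<^sup>2 = Q s t" "y\<^sup>2 = P s t"
  shows "\<Gamma> s t x y \<noteq> 0"
  unfolding \<Gamma>_def using assms quartic_xy_nonzero[OF assms] by (intro tensor_nonzero pt_nonzero F2.pt_nonzero)

lemma \<Gamma>_scale: "\<Gamma> (c * s) (c * t) (c * x) (c * y) = c ^ 4 *s \<Gamma> s t x y"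
  unfolding \<Gamma>_def conic_pt_scale tensor_scale by (simp flip: power_add)

text \<open>
  The tangent lines meet the common line of the two planes in \<open>s^2 u0 - t^2 u2\<close> and
  \<open>x^2 a - y^2 b\<close> respectively, so they meet if and only if these points are equal.
\<close>

lemma tangents_meet_iff:
  assumes st: "(s, t) \<noteq> (0, 0)" and xy: "(x, y) \<noteq> (0, 0)"
  shows "tangent_space curve (vec.span {pt s t}) \<inter> tangent_space C2 (vec.span {pt2 x y}) \<noteq> {0}
     \<longleftrightarrow> x\<^sup>2 * P s t = y\<^sup>2 * Q s t"
proof
  assume ne: "tangent_space curve (vec.span {pt s t}) \<inter> tangent_space C2 (vec.span {pt2 x y}) \<noteq> {0}"
  have "0 \<in> tangent_space curve (vec.span {pt s t}) \<inter> tangent_space C2 (vec.span {pt2 x y})"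
    using vec.subspace_0[OF subspace_tangent_space] by blast
  with ne obtain w where w: "w \<noteq> 0" "w \<in> tangent_space curve (vec.span {pt s t})"
    "w \<in> tangent_space C2 (vec.span {pt2 x y})" by blast
  then obtain p r p' r' where w1: "w = p *s (s *s u0 + t *s u1) + r *s (s *s u1 + t *s u2)"
    and w2: "w = p' *s (x *s a + y *s v) + r' *s (x *s v + y *s b)"
    using tangent_space_conic[OF st] F2.tangent_space_conic[OF xy] by metis
  have e: "c0 w = p * s" "c1 w = p * t + r * s" "c2 w = r * t" "c3 w = 0"
    unfolding w1 by (simp_all add: coord_simps algebra_simps)
  have e': "c0 w = p' * x + k\<^sup>2 * r' * y" "c1 w = 0" "c2 w = - (p' * x + r' * y)" "c3 w = p' * y + r' * x"
    unfolding w2 by (simp_all add: coord_simps algebra_simps)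
  have e1: "p * t + r * s = 0" "p' * y + r' * x = 0" using e e' by auto
  have "\<exists>m. p = m * s \<and> r = - m * t"
  proof (cases "s = 0")
    case True
    then show ?thesis using st e1 by (intro exI[of _ "- r / t"]) auto
  next
    case False
    then show ?thesis using e1 by (intro exI[of _ "p / s"]) (auto simp: field_simps eq_neg_iff_add_eq_0)
  qed
  then obtain m where m: "p = m * s" "r = - m * t" by blast
  have "\<exists>n. p' = n * x \<and> r' = - n * y"
  proof (cases "x = 0")
    case True
    then show ?thesis using xy e1 by (intro exI[of _ "- r' / y"]) auto
  next
    case False
    then show ?thesis using e1 by (intro exI[of _ "p' / x"]) (auto simp: field_simps eq_neg_iff_add_eq_0)
  qed
  then obtain n where n: "p' = n * x" "r' = - n * y" by blast
  have f: "c0 w = m * s\<^sup>2" "c2 w = - m * t\<^sup>2" "c0 w = n * (x\<^sup>2 - k\<^sup>2 * y\<^sup>2)" "c2 w = - n * (x\<^sup>2 - y\<^sup>2)"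
  proof -
    show "c0 w = m * s\<^sup>2" "c2 w = - m * t\<^sup>2"
      using e(1,3) unfolding m by (simp_all add: power2_eq_square)
    show "c0 w = n * (x\<^sup>2 - k\<^sup>2 * y\<^sup>2)" "c2 w = - n * (x\<^sup>2 - y\<^sup>2)"
      using e'(1,3) unfolding n by (simp_all add: power2_eq_square algebra_simps)
  qed
  have "m \<noteq> 0"
  proof
    assume "m = 0"
    then have "w = 0" using f e e' by (simp add: coords_eq_iff coord_simps)
    then show False using w(1) by simp
  qed
  have "n \<noteq> 0"
  proof
    assume "n = 0"
    then have "w = 0" using f e e' by (simp add: coords_eq_iff coord_simps)
    then show False using w(1) by simp
  qed
  have "m * s\<^sup>2 = n * (x\<^sup>2 - k\<^sup>2 * y\<^sup>2)" "m * t\<^sup>2 = n * (x\<^sup>2 - y\<^sup>2)" using f by auto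
  then have "m * n * (x\<^sup>2 * P s t - y\<^sup>2 * Q s t) = 0" unfolding P_def Q_def by algebra
  then show "x\<^sup>2 * P s t = y\<^sup>2 * Q s t" using \<open>m \<noteq> 0\<close> \<open>n \<noteq> 0\<close> by simp
next
  assume eq: "x\<^sup>2 * P s t = y\<^sup>2 * Q s t"
  then have eq': "s\<^sup>2 * (x\<^sup>2 - y\<^sup>2) = t\<^sup>2 * (x\<^sup>2 - k\<^sup>2 * y\<^sup>2)" unfolding P_def Q_def by algebra
  have nz: "x\<^sup>2 - y\<^sup>2 \<noteq> 0 \<or> x\<^sup>2 - k\<^sup>2 * y\<^sup>2 \<noteq> 0"
  proof (rule ccontr)
    assume "\<not> ?thesis"
    then have "x\<^sup>2 = y\<^sup>2" "(k\<^sup>2 - 1) * y\<^sup>2 = 0" by (auto simp: algebra_simps)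
    then show False using k1' xy by simp
  qed
  obtain m n where mn: "m * s\<^sup>2 = n * (x\<^sup>2 - k\<^sup>2 * y\<^sup>2)" "m * t\<^sup>2 = n * (x\<^sup>2 - y\<^sup>2)" "m \<noteq> 0"
  proof (cases "t = 0")
    case True
    then have "s \<noteq> 0" using st by simp
    then show ?thesis using True eq' nz by (intro that[of "x\<^sup>2 - k\<^sup>2 * y\<^sup>2" "s\<^sup>2"]) auto
  next
    case False
    then have "x\<^sup>2 - y\<^sup>2 \<noteq> 0" using eq' nz by auto
    then show ?thesis using eq' by (intro that[of "x\<^sup>2 - y\<^sup>2" "t\<^sup>2"]) (simp_all add: mult.commute)
  qed
  define w where "w = (m * s) *s (s *s u0 + t *s u1) + (- m * t) *s (s *s u1 + t *s u2)"
  have w': "w = (n * x) *s (x *s a + y *s v) + (- n * y) *s (x *s v + y *s b)"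
    using mn(1,2) unfolding w_def
    by (intro coords_eqI) (simp_all add: coord_simps power2_eq_square algebra_simps)
  have "w \<in> tangent_space curve (vec.span {pt s t})" "w \<in> tangent_space C2 (vec.span {pt2 x y})"
    using tangent_space_conic[OF st] F2.tangent_space_conic[OF xy] w_def w' by blast+
  moreover have "w \<noteq> 0"
  proof
    assume "w = 0"
    then have "c0 w = 0" "c2 w = 0" by (simp_all add: coord_simps)
    then have "m * s\<^sup>2 = 0" "m * t\<^sup>2 = 0" by (simp_all add: w_def coord_simps power2_eq_square)
    then show False using mn(3) st by simp
  qed
  ultimately show "tangent_space curve (vec.span {pt s t}) \<inter> tangent_space C2 (vec.span {pt2 x y}) \<noteq> {0}"
    by blast
qed

text \<open>
  A common point would lie on the common line of the two planes, which the first conic meets in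
  \<open>u0\<close>, \<open>u2\<close> and the second one in \<open>a\<close>, \<open>b\<close>. Hence two tangent lines that meet always give a
  bisecant.
\<close>

lemma conics_disjoint:
  assumes "(s, t) \<noteq> (0, 0)" "(x, y) \<noteq> (0, 0)"
  shows "vec.span {pt s t} \<noteq> vec.span {pt2 x y}"
proof
  assume "vec.span {pt s t} = vec.span {pt2 x y}"
  then obtain c where c: "c \<noteq> 0" "pt2 x y = c *s pt s t"
    using span_line_eq_iff[OF F2.pt_nonzero[OF assms(2)]] by blast
  have "c0 (pt2 x y) = x\<^sup>2 + k\<^sup>2 * y\<^sup>2" "c1 (pt2 x y) = 0" "c2 (pt2 x y) = - (x\<^sup>2 + y\<^sup>2)" "c3 (pt2 x y) = 2 * x * y"
    by (simp_all add: conic_pt_def coord_simps)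
  then have "x\<^sup>2 + k\<^sup>2 * y\<^sup>2 = c * s\<^sup>2" "c * (s * t) = 0" "- (x\<^sup>2 + y\<^sup>2) = c * t\<^sup>2" "x * y = 0"
    using c(2) by (simp_all add: coord_simps)
  then show False using c(1) assms k0 by (cases "s = 0"; cases "x = 0") (auto simp: add_eq_0_iff2)
qed

text \<open>
  The equation \<open>x^2 P = y^2 Q\<close> says that \<open>(x^2, y^2)\<close> is proportional to \<open>(Q, P)\<close>, so a
  representative of \<open>(x, y)\<close> can be chosen for which they are equal.
\<close>

lemma rescale_to_quartic:
  assumes "(s, t) \<noteq> (0, 0)" "(x, y) \<noteq> (0, 0)" "x\<^sup>2 * P s t = y\<^sup>2 * Q s t"
  obtains g where "g \<noteq> 0" "(g * x)\<^sup>2 = Q s t" "(g * y)\<^sup>2 = P s t"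
proof (cases "x = 0")
  case True
  then have y: "y \<noteq> 0" using assms by simp
  then have Q: "Q s t = 0" using assms True by simp
  then have P: "P s t \<noteq> 0" using PQ_coprime[of s t] assms(1) by blast
  show ?thesis using True y Q P by (intro that[of "csqrt (P s t) / y"]) auto
next
  case False
  then have "Q s t \<noteq> 0" using PQ_coprime[of s t] assms by auto
  then show ?thesis using False assms
    by (intro that[of "csqrt (Q s t) / x"]) (auto simp: power_mult_distrib power_divide field_simps)
qed

lemma stationary_pairs_eq:
  "stationary_pairs curve C2 = {(vec.span {pt s t}, vec.span {pt2 x y}) | s t x y.
     (s, t) \<noteq> (0, 0) \<and> (x, y) \<noteq> (0, 0) \<and> x\<^sup>2 * P s t = y\<^sup>2 * Q s t}"
proof (intro set_eqI, clarify)
  fix p q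
  show "(p, q) \<in> stationary_pairs curve C2 \<longleftrightarrow> (p, q) \<in> {(vec.span {pt s t}, vec.span {pt2 x y}) | s t x y.
     (s, t) \<noteq> (0, 0) \<and> (x, y) \<noteq> (0, 0) \<and> x\<^sup>2 * P s t = y\<^sup>2 * Q s t}"
  proof
    assume "(p, q) \<in> stationary_pairs curve C2"
    then have pq: "p \<in> curve" "q \<in> C2" "tangent_space curve p \<inter> tangent_space C2 q \<noteq> {0}"
      by (auto simp: stationary_pairs_def)
    obtain s t where st: "(s, t) \<noteq> (0, 0)" "p = vec.span {pt s t}" using pq(1) by (rule conic_mem_cases)
    obtain x y where xy: "(x, y) \<noteq> (0, 0)" "q = vec.span {pt2 x y}" using pq(2) by (rule F2.conic_mem_cases)
    show "(p, q) \<in> {(vec.span {pt s t}, vec.span {pt2 x y}) | s t x y.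
     (s, t) \<noteq> (0, 0) \<and> (x, y) \<noteq> (0, 0) \<and> x\<^sup>2 * P s t = y\<^sup>2 * Q s t}"
      using pq(3) st xy tangents_meet_iff[OF st(1) xy(1)] by blast
  next
    assume "(p, q) \<in> {(vec.span {pt s t}, vec.span {pt2 x y}) | s t x y.
     (s, t) \<noteq> (0, 0) \<and> (x, y) \<noteq> (0, 0) \<and> x\<^sup>2 * P s t = y\<^sup>2 * Q s t}"
    then obtain s t x y where h: "(s, t) \<noteq> (0, 0)" "(x, y) \<noteq> (0, 0)" "x\<^sup>2 * P s t = y\<^sup>2 * Q s t"
      and pq: "p = vec.span {pt s t}" "q = vec.span {pt2 x y}" by blast
    have "p \<in> curve" "q \<in> C2" "p \<noteq> q"
      unfolding pq by (rule conicI[OF h(1)] F2.conicI[OF h(2)] conics_disjoint[OF h(1,2)])+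
    moreover have "tangent_space curve p \<inter> tangent_space C2 q \<noteq> {0}"
      unfolding pq tangents_meet_iff[OF h(1,2)] by (rule h(3))
    ultimately show "(p, q) \<in> stationary_pairs curve C2"
      by (simp add: stationary_pairs_def)
  qed
qed

lemma segre_stationary_pairs: "segre ` stationary_pairs curve C2 = E"
proof (intro equalityI subsetI)
  fix e assume "e \<in> segre ` stationary_pairs curve C2"
  then obtain s t x y where h: "(s, t) \<noteq> (0, 0)" "(x, y) \<noteq> (0, 0)" "x\<^sup>2 * P s t = y\<^sup>2 * Q s t"
    and "e = segre (vec.span {pt s t}, vec.span {pt2 x y})"
    unfolding stationary_pairs_eq by blast
  then have e: "e = vec.span {tensor (pt s t) (pt2 x y)}" by (simp only: segre_lines)
  obtain g where g: "g \<noteq> 0" "(g * x)\<^sup>2 = Q s t" "(g * y)\<^sup>2 = P s t" using rescale_to_quartic[OF h] .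
  have "\<Gamma> s t (g * x) (g * y) = g\<^sup>2 *s tensor (pt s t) (pt2 x y)"
    unfolding \<Gamma>_def conic_pt_scale using tensor_scale[of 1 "pt s t"] by simp
  then have "e = vec.span {\<Gamma> s t (g * x) (g * y)}" using e g(1) by (simp add: span_line_scale)
  then show "e \<in> E" unfolding E_def using h(1) g by blast
next
  fix e assume "e \<in> E"
  then obtain s t x y where h: "(s, t) \<noteq> (0, 0)" "x\<^sup>2 = Q s t" "y\<^sup>2 = P s t" "e = vec.span {\<Gamma> s t x y}"
    unfolding E_def by blast
  then have "e = segre (vec.span {pt s t}, vec.span {pt2 x y})" by (simp add: segre_lines \<Gamma>_def)
  moreover have "(vec.span {pt s t}, vec.span {pt2 x y}) \<in> stationary_pairs curve C2"
  proof -
    have "x\<^sup>2 * P s t = y\<^sup>2 * Q s t" using h(2,3) by (simp only: mult.commute)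
    then show ?thesis unfolding stationary_pairs_eq using h(1) quartic_xy_nonzero[OF h(1-3)] by blast
  qed
  ultimately show "e \<in> segre ` stationary_pairs curve C2" by blast
qed

subsection \<open>Normal forms of functions on the curve\<close>

text \<open>
  Modulo the two equations \<open>x^2 = Q\<close> and \<open>y^2 = P\<close> of the quartic every polynomial in \<open>x, y\<close> which
  is even under \<open>(x, y) \<mapsto> (-x, -y)\<close> reduces to \<open>A + x y B\<close>.
\<close>

lemma normal_form:
  assumes "f \<in> forms n"
  shows "\<exists>A B U V. binary_form (4 * n) A \<and> (n = 0 \<and> B = (\<lambda>s t. 0) \<or> n > 0 \<and> binary_form (4 * n - 2) B) \<and>
    line_differentiable U \<and> line_differentiable V \<and>
    (\<forall>s t x y. f (\<Gamma> s t x y) = A s t + x * y * B s t + (x\<^sup>2 - Q s t) * U s t x y + (y\<^sup>2 - P s t) * V s t x y)"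
  using assms
proof (induction rule: forms_induct)
  case (const c)
  show ?case
    by (intro exI[of _ "\<lambda>s t. c"] exI[of _ "\<lambda>s t. 0"] exI[of _ "\<lambda>s t x y. 0"])
      (simp add: binary_form_const line_differentiable_coord)
next
  case (coord d f l)
  obtain i j where l: "l = (i, j)" by (cases l)
  from coord.IH obtain A B U V where A: "binary_form (4 * d) A"
    and B: "d = 0 \<and> B = (\<lambda>s t. 0) \<or> d > 0 \<and> binary_form (4 * d - 2) B"
    and U: "line_differentiable U" and V: "line_differentiable V"
    and f: "\<And>s t x y. f (\<Gamma> s t x y) = A s t + x * y * B s t + (x\<^sup>2 - Q s t) * U s t x y + (y\<^sup>2 - P s t) * V s t x y"
    by blast
  define m where "m s t = pt s t $ i" for s t
  define \<alpha> \<beta> \<gamma> where "\<alpha> = a $ j" and "\<beta> = v $ j" and "\<gamma> = b $ j"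
  have m: "binary_form 2 m" unfolding m_def[abs_def] by (rule binary_form_conic_coord)
  have z: "\<Gamma> s t x y $ l = m s t * (\<alpha> * x\<^sup>2 + 2 * \<beta> * (x * y) + \<gamma> * y\<^sup>2)" for s t x y
    by (simp add: \<Gamma>_def l m_def \<alpha>_def \<beta>_def \<gamma>_def conic_pt_def[of a v b] algebra_simps)
  have R: "binary_form 2 (\<lambda>s t. \<alpha> * Q s t + \<gamma> * P s t)"
    by (intro binary_form_add binary_form_cmult binary_form_PQ)
  have mR: "binary_form 4 (\<lambda>s t. m s t * (\<alpha> * Q s t + \<gamma> * P s t))"
    using binary_form_mult[OF m R] by simp
  have Bq: "binary_form (4 * d + 2) (\<lambda>s t. g s t * B s t)" if "binary_form 4 g" for g
    using B
  proof
    assume "d = 0 \<and> B = (\<lambda>s t. 0)" then show ?thesis by (simp add: binary_form_zero)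
  next
    assume d: "d > 0 \<and> binary_form (4 * d - 2) B"
    then have "binary_form (4 + (4 * d - 2)) (\<lambda>s t. g s t * B s t)" using that by (intro binary_form_mult) auto
    moreover have "4 + (4 * d - 2) = 4 * d + 2" using d by simp
    ultimately show ?thesis by metis
  qed
  have Bd: "line_differentiable (\<lambda>s t x y. B s t)"
    using B by (auto intro: line_differentiable_coord line_differentiable_binary_form)
  note md = line_differentiable_binary_form[OF m] and Ad = line_differentiable_binary_form[OF A]
    and Qd = line_differentiable_binary_form[OF binary_form_PQ(2)]
  define A' where "A' s t = (m s t * (\<alpha> * Q s t + \<gamma> * P s t)) * A s t + (2 * \<beta>) * (P s t * Q s t) * (m s t * B s t)" for s t
  define B' where "B' s t = (2 * \<beta>) * (m s t * A s t) + (m s t * (\<alpha> * Q s t + \<gamma> * P s t)) * B s t" for s t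
  define U' where "U' s t x y = U s t x y * (m s t * (\<alpha> * x\<^sup>2 + 2 * \<beta> * (x * y) + \<gamma> * y\<^sup>2))
    + \<alpha> * m s t * (A s t + x * y * B s t) + 2 * \<beta> * m s t * B s t * y\<^sup>2" for s t x y
  define V' where "V' s t x y = V s t x y * (m s t * (\<alpha> * x\<^sup>2 + 2 * \<beta> * (x * y) + \<gamma> * y\<^sup>2))
    + \<gamma> * m s t * (A s t + x * y * B s t) + 2 * \<beta> * m s t * B s t * Q s t" for s t x y
  have "binary_form (4 * Suc d) A'"
  proof -
    have 1: "binary_form (4 + 4 * d) (\<lambda>s t. (m s t * (\<alpha> * Q s t + \<gamma> * P s t)) * A s t)"
      by (intro binary_form_mult mR A)
    have PQ: "binary_form (2 + 2) (\<lambda>s t. P s t * Q s t)" by (intro binary_form_mult binary_form_PQ)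
    have "binary_form (2 + (4 * d + 2)) (\<lambda>s t. m s t * ((P s t * Q s t) * B s t))"
      using PQ by (intro binary_form_mult m Bq) simp
    moreover have "2 + (4 * d + 2) = 4 + 4 * d" by simp
    ultimately have "binary_form (4 + 4 * d) (\<lambda>s t. m s t * ((P s t * Q s t) * B s t))" by metis
    then have "binary_form (4 + 4 * d) (\<lambda>s t. (2 * \<beta>) * (m s t * ((P s t * Q s t) * B s t)))"
      by (rule binary_form_cmult)
    from binary_form_add[OF 1 this] show ?thesis by (simp add: A'_def[abs_def] ac_simps)
  qed
  moreover have "binary_form (4 * Suc d - 2) B'"
  proof -
    have 1: "binary_form (4 * d + 2) (\<lambda>s t. (2 * \<beta>) * (m s t * A s t))"
    proof -
      have "binary_form (2 + 4 * d) (\<lambda>s t. m s t * A s t)" by (rule binary_form_mult[OF m A])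
      then show ?thesis by (intro binary_form_cmult) (simp only: add.commute)
    qed
    from binary_form_add[OF 1 Bq[OF mR]] have "binary_form (4 * d + 2) B'" by (simp add: B'_def[abs_def])
    moreover have "4 * Suc d - 2 = 4 * d + 2" by simp
    ultimately show ?thesis by metis
  qed
  moreover have "line_differentiable U'"
    unfolding U'_def[abs_def] by (intro line_differentiable_intros U Bd Ad md)
  moreover have "line_differentiable V'"
    unfolding V'_def[abs_def] by (intro line_differentiable_intros V Bd Ad md Qd)
  moreover have "\<Gamma> s t x y $ l * f (\<Gamma> s t x y) =
      A' s t + x * y * B' s t + (x\<^sup>2 - Q s t) * U' s t x y + (y\<^sup>2 - P s t) * V' s t x y" for s t x y
    unfolding z f A'_def B'_def U'_def V'_def by algebra
  ultimately show ?case by (intro exI[of _ A'] exI[of _ B'] exI[of _ U'] exI[of _ V']) simp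
next
  case (add d f g)
  from add.IH(1) obtain A B U V where f: "binary_form (4 * d) A"
    "d = 0 \<and> B = (\<lambda>s t. 0) \<or> d > 0 \<and> binary_form (4 * d - 2) B"
    "line_differentiable U" "line_differentiable V"
    "\<And>s t x y. f (\<Gamma> s t x y) = A s t + x * y * B s t + (x\<^sup>2 - Q s t) * U s t x y + (y\<^sup>2 - P s t) * V s t x y"
    by blast
  from add.IH(2) obtain A' B' U' V' where g: "binary_form (4 * d) A'"
    "d = 0 \<and> B' = (\<lambda>s t. 0) \<or> d > 0 \<and> binary_form (4 * d - 2) B'"
    "line_differentiable U'" "line_differentiable V'"
    "\<And>s t x y. g (\<Gamma> s t x y) = A' s t + x * y * B' s t + (x\<^sup>2 - Q s t) * U' s t x y + (y\<^sup>2 - P s t) * V' s t x y"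
    by blast
  show ?case
  proof (intro exI conjI)
    show "binary_form (4 * d) (\<lambda>s t. A s t + A' s t)" using f g by (intro binary_form_add)
    show "d = 0 \<and> (\<lambda>s t. B s t + B' s t) = (\<lambda>s t. 0) \<or> d > 0 \<and> binary_form (4 * d - 2) (\<lambda>s t. B s t + B' s t)"
      using f(2) g(2) by (auto intro: binary_form_add)
    show "line_differentiable (\<lambda>s t x y. U s t x y + U' s t x y)"
      "line_differentiable (\<lambda>s t x y. V s t x y + V' s t x y)"
      using f g by (auto intro: line_differentiable_add)
    show "\<forall>s t x y. f (\<Gamma> s t x y) + g (\<Gamma> s t x y) = (A s t + A' s t) + x * y * (B s t + B' s t)
       + (x\<^sup>2 - Q s t) * (U s t x y + U' s t x y) + (y\<^sup>2 - P s t) * (V s t x y + V' s t x y)"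
      unfolding f g by (simp add: algebra_simps)
  qed
qed

text \<open>
  The functions \<open>A + x y B\<close> form a domain: the norm \<open>A^2 - P Q B^2\<close> is multiplicative, and it
  vanishes only if \<open>A = B = 0\<close>, because \<open>P Q\<close> has a simple zero at \<open>s = t\<close>.
\<close>

lemma nonsquare:
  fixes A B :: "complex poly"
  assumes "A * A = [:-1, 0, 1:] * [:- k\<^sup>2, 0, 1:] * (B * B)"
  shows "A = 0 \<and> B = 0"
proof (rule ccontr)
  assume not: "\<not> ?thesis"
  have B: "B \<noteq> 0"
  proof
    assume "B = 0"
    then have "A = 0" using assms by simp
    then show False using \<open>B = 0\<close> not by simp
  qed
  define h where "h = [:1, 1:] * [:- k\<^sup>2, 0, 1:]"
  have h1: "poly h 1 \<noteq> 0" using k1 by (simp add: h_def)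
  then have h0: "h \<noteq> 0" by auto
  have eq: "A * A = [:-1, 1:] * h * (B * B)" unfolding assms h_def by simp
  have A: "A \<noteq> 0"
  proof
    assume "A = 0"
    then have "[:-1, 1:] * h * (B * B) = 0" using eq by (metis mult_zero_left)
    moreover have "[:-1, 1 :: complex:] \<noteq> 0" by simp
    ultimately show False using B h0 by (metis no_zero_divisors)
  qed
  have "order 1 (A * A) = 2 * order 1 A" using A by (subst order_mult) auto
  moreover have "order 1 ([:-1, 1:] * h * (B * B)) = 1 + 2 * order 1 B"
  proof -
    have nz: "[:-1, 1 :: complex:] * h \<noteq> 0" "B * B \<noteq> 0"
      using B h0 by (metis no_zero_divisors pCons_eq_0_iff zero_neq_one, simp)
    have "order 1 ([:-1, 1:] * h * (B * B)) = order 1 [:-1, 1::complex:] + order 1 h + (order 1 B + order 1 B)"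
      using nz by (metis no_zero_divisors order_mult)
    moreover have "order 1 h = 0" using h1 order_root by blast
    moreover have "order 1 [:-1, 1::complex:] = 1" using order_power_n_n[of "1::complex" 1] by simp
    ultimately show ?thesis by simp
  qed
  ultimately have "2 * order 1 A = 1 + 2 * order 1 B" using eq by simp
  then show False by presburger
qed

lemma quartic_functions_domain:
  assumes "binary_form n1 A1" "binary_form n2 B1" "binary_form n3 A2" "binary_form n4 B2"
    and zero: "\<And>s t x y. (s, t) \<noteq> (0, 0) \<Longrightarrow> x\<^sup>2 = Q s t \<Longrightarrow> y\<^sup>2 = P s t \<Longrightarrow>
      (A1 s t + x * y * B1 s t) * (A2 s t + x * y * B2 s t) = 0"
  shows "A1 = (\<lambda>s t. 0) \<and> B1 = (\<lambda>s t. 0) \<or> A2 = (\<lambda>s t. 0) \<and> B2 = (\<lambda>s t. 0)"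
proof -
  obtain a1 where a1: "\<And>s. A1 s 1 = poly a1 s" "a1 = 0 \<Longrightarrow> A1 = (\<lambda>s t. 0)" using binary_form_poly[OF assms(1)] by blast
  obtain b1 where b1: "\<And>s. B1 s 1 = poly b1 s" "b1 = 0 \<Longrightarrow> B1 = (\<lambda>s t. 0)" using binary_form_poly[OF assms(2)] by blast
  obtain a2 where a2: "\<And>s. A2 s 1 = poly a2 s" "a2 = 0 \<Longrightarrow> A2 = (\<lambda>s t. 0)" using binary_form_poly[OF assms(3)] by blast
  obtain b2 where b2: "\<And>s. B2 s 1 = poly b2 s" "b2 = 0 \<Longrightarrow> B2 = (\<lambda>s t. 0)" using binary_form_poly[OF assms(4)] by blast
  define H where "H = [:-1, 0, 1:] * [:- k\<^sup>2, 0, 1:]"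
  have H: "poly H s = P s 1 * Q s 1" for s by (simp add: H_def P_def Q_def power2_eq_square algebra_simps)
  have "poly ((a1 * a1 - H * (b1 * b1)) * (a2 * a2 - H * (b2 * b2))) s = 0" for s
  proof -
    define x y where "x = csqrt (Q s 1)" and "y = csqrt (P s 1)"
    have xy: "x\<^sup>2 = Q s 1" "y\<^sup>2 = P s 1" by (simp_all add: x_def y_def)
    have "(poly a1 s + x * y * poly b1 s) * (poly a2 s + x * y * poly b2 s) = 0"
      using zero[of s 1 x y] xy a1 b1 a2 b2 by simp
    moreover have "(poly a1 s + (- x) * y * poly b1 s) * (poly a2 s + (- x) * y * poly b2 s) = 0"
      using zero[of s 1 "- x" y] xy a1 b1 a2 b2 by simp
    ultimately have "((poly a1 s)\<^sup>2 - x\<^sup>2 * y\<^sup>2 * (poly b1 s)\<^sup>2) * ((poly a2 s)\<^sup>2 - x\<^sup>2 * y\<^sup>2 * (poly b2 s)\<^sup>2) = 0"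
      by algebra
    then show ?thesis unfolding xy by (simp add: H power2_eq_square algebra_simps)
  qed
  then have "(a1 * a1 - H * (b1 * b1)) * (a2 * a2 - H * (b2 * b2)) = 0" using poly_all_0_iff_0 by blast
  then have "a1 * a1 = H * (b1 * b1) \<or> a2 * a2 = H * (b2 * b2)" by simp
  then have "a1 = 0 \<and> b1 = 0 \<or> a2 = 0 \<and> b2 = 0" unfolding H_def using nonsquare by blast
  then show ?thesis using a1 b1 a2 b2 by blast
qed

text \<open>
  If a form vanishes on the curve, the part \<open>A + x y B\<close> of its normal form is zero, so that its
  pullback lies in the ideal of the quartic.
\<close>

lemma vanishing_normal_form:
  assumes "f \<in> vanishing_forms E n"
  obtains U V where "line_differentiable U" "line_differentiable V"
    "\<And>s t x y. f (\<Gamma> s t x y) = (x\<^sup>2 - Q s t) * U s t x y + (y\<^sup>2 - P s t) * V s t x y"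
proof -
  have f: "f \<in> forms n" using assms by (simp add: vanishing_forms_def)
  from normal_form[OF f] obtain A B U V where A: "binary_form (4 * n) A"
    and B: "n = 0 \<and> B = (\<lambda>s t. 0) \<or> n > 0 \<and> binary_form (4 * n - 2) B"
    and UV: "line_differentiable U" "line_differentiable V"
    and eq: "\<And>s t x y. f (\<Gamma> s t x y) = A s t + x * y * B s t + (x\<^sup>2 - Q s t) * U s t x y + (y\<^sup>2 - P s t) * V s t x y"
    by blast
  obtain m where B': "binary_form m B" using B binary_form_zero by blast
  have one: "binary_form 0 (\<lambda>s t. 1)" "binary_form 0 (\<lambda>s t. 0)" by (rule binary_form_const)+
  have "A = (\<lambda>s t. 0) \<and> B = (\<lambda>s t. 0) \<or> (\<lambda>s t. 1) = (\<lambda>(s :: complex) (t :: complex). 0 :: complex) \<and> (\<lambda>s t. 0) = (\<lambda>(s :: complex) (t :: complex). 0 :: complex)"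
  proof (rule quartic_functions_domain[OF A B' one])
    fix s t x y assume h: "(s, t) \<noteq> (0, 0)" "x\<^sup>2 = Q s t" "y\<^sup>2 = P s t"
    then have "vec.span {\<Gamma> s t x y} \<in> E" unfolding E_def by blast
    then have "f (\<Gamma> s t x y) = 0" using assms line_base unfolding vanishing_forms_def by blast
    then show "(A s t + x * y * B s t) * (1 + x * y * 0) = 0" using eq[of s t x y] h by simp
  qed
  then have "A = (\<lambda>s t. 0)" "B = (\<lambda>s t. 0)" by (auto simp: fun_eq_iff)
  then show ?thesis using that[OF UV] eq by simp
qed

end

text \<open>
  The coordinate functions of the product of two frames are linear forms on the space of tensors.
\<close>

lemma tensor_functional:
  assumes "Vector_Spaces.linear (*s) (*) c" "Vector_Spaces.linear (*s) (*) d"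
  obtains L where "Vector_Spaces.linear (*s) (*) L" "\<And>x y. L (tensor x y) = c x * d y"
proof -
  define L where "L z = (\<Sum>i\<in>UNIV. \<Sum>j\<in>UNIV. c (axis i 1) * d (axis j 1) * z $ (i, j))" for z
  have "Vector_Spaces.linear (*s) (*) L"
    by unfold_locales (simp_all add: L_def algebra_simps sum.distrib sum_distrib_left)
  moreover have "L (tensor x y) = c x * d y" for x y
    by (subst functional_eq_sum[OF assms(1)], subst functional_eq_sum[OF assms(2)])
      (simp add: L_def sum_product ac_simps)
  ultimately show ?thesis by (rule that)
qed

context edge
begin

section \<open>The edge curve is closed and irreducible\<close>

lemma vanishing_E_I:
  assumes "f \<in> forms d"
    and "\<And>s t x y. (s, t) \<noteq> (0, 0) \<Longrightarrow> x\<^sup>2 = Q s t \<Longrightarrow> y\<^sup>2 = P s t \<Longrightarrow> f (\<Gamma> s t x y) = 0"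
  shows "f \<in> vanishing_forms E d"
proof -
  have "f z = 0" if e: "e \<in> E" and z: "z \<in> e" for e z
  proof -
    obtain s t x y where h: "(s, t) \<noteq> (0, 0)" "x\<^sup>2 = Q s t" "y\<^sup>2 = P s t" and "e = vec.span {\<Gamma> s t x y}"
      using e unfolding E_def by blast
    then show ?thesis using form_vanishes_on_line[OF assms(1) \<Gamma>_nonzero[OF h]] assms(2)[OF h] z by blast
  qed
  then show ?thesis using assms(1) unfolding vanishing_forms_def by blast
qed

lemma E_cases:
  assumes "e \<in> E"
  obtains s t x y where "(s, t) \<noteq> (0, 0)" "x\<^sup>2 = Q s t" "y\<^sup>2 = P s t" "e = vec.span {\<Gamma> s t x y}"
  using assms unfolding E_def by blast

lemma E_I: "(s, t) \<noteq> (0, 0) \<Longrightarrow> x\<^sup>2 = Q s t \<Longrightarrow> y\<^sup>2 = P s t \<Longrightarrow> vec.span {\<Gamma> s t x y} \<in> E"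
  unfolding E_def by blast

lemma E_subset_proj_space: "E \<subseteq> proj_space"
  by (auto elim!: E_cases intro!: proj_spaceI dest!: \<Gamma>_nonzero[rotated])

lemma segre_quadric_vanishing:
  "(\<lambda>z. z $ (i, j) * z $ (m, l) - z $ (i, l) * z $ (m, j)) \<in> vanishing_forms E 2"
proof (rule vanishing_E_I)
  have "(\<lambda>z :: complex^(4 \<times> 4). z $ (i, j) * z $ (m, l) + (-1) * (z $ (i, l) * z $ (m, j))) \<in> forms (1 + 1)"
    by (intro forms_add forms_cmult forms_mult forms_coord)
  then show "(\<lambda>z. z $ (i, j) * z $ (m, l) - z $ (i, l) * z $ (m, j)) \<in> forms 2"
    by (simp add: numeral_2_eq_2)
qed (simp add: \<Gamma>_def)

lemma row_vanishing:
  assumes "f \<in> vanishing_forms curve d"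
  shows "(\<lambda>z. f (\<chi> i. z $ (i, l))) \<in> vanishing_forms E d"
proof (rule vanishing_E_I)
  have f: "f \<in> forms d" using assms by (simp add: vanishing_forms_def)
  have "(\<lambda>z :: complex^(4 \<times> 4). f (\<chi> i. z $ (i, l))) \<in> forms (d * 1)"
    by (rule forms_comp[OF f]) (use forms_coord in simp)
  then show "(\<lambda>z. f (\<chi> i. z $ (i, l))) \<in> forms d" by simp
  fix s t x y assume h: "(s, t) \<noteq> (0, 0)" "x\<^sup>2 = Q s t" "y\<^sup>2 = P s t"
  have "(\<chi> i. \<Gamma> s t x y $ (i, l)) = pt2 x y $ l *s pt s t"
    by (simp add: \<Gamma>_def vec_eq_iff)
  moreover have "f (pt s t) = 0" using assms conicI[OF h(1)] line_base unfolding vanishing_forms_def by blast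
  ultimately show "f (\<chi> i. \<Gamma> s t x y $ (i, l)) = 0" by (simp add: forms_homogeneous[OF f])
qed

lemma column_vanishing:
  assumes "f \<in> vanishing_forms C2 d"
  shows "(\<lambda>z. f (\<chi> j. z $ (l, j))) \<in> vanishing_forms E d"
proof (rule vanishing_E_I)
  have f: "f \<in> forms d" using assms by (simp add: vanishing_forms_def)
  have "(\<lambda>z :: complex^(4 \<times> 4). f (\<chi> j. z $ (l, j))) \<in> forms (d * 1)"
    by (rule forms_comp[OF f]) (use forms_coord in simp)
  then show "(\<lambda>z. f (\<chi> j. z $ (l, j))) \<in> forms d" by simp
  fix s t x y assume h: "(s, t) \<noteq> (0, 0)" "x\<^sup>2 = Q s t" "y\<^sup>2 = P s t"
  have "(\<chi> j. \<Gamma> s t x y $ (l, j)) = pt s t $ l *s pt2 x y"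
    by (simp add: \<Gamma>_def vec_eq_iff)
  moreover have "f (pt2 x y) = 0"
    using assms F2.conicI[OF quartic_xy_nonzero[OF h]] line_base unfolding vanishing_forms_def by blast
  ultimately show "f (\<chi> j. \<Gamma> s t x y $ (l, j)) = 0" by (simp add: forms_homogeneous[OF f])
qed

text \<open>
  The equation \<open>x^2 P = y^2 Q\<close> of bidegree (2, 2) is linear in the coordinates of the ambient space
  of the product of the two conics.
\<close>

lemma edge_functional:
  obtains R where "Vector_Spaces.linear (*s) (*) R"
    "\<And>X Y. R (tensor X Y) = (c0 X - c2 X) * d0 Y - (c0 X - k\<^sup>2 * c2 X) * d2 Y"
    "R \<in> vanishing_forms E 1"
proof -
  have l: "Vector_Spaces.linear (*s) (*) (\<lambda>X. c0 X - c2 X)" "Vector_Spaces.linear (*s) (*) (\<lambda>X. c0 X - k\<^sup>2 * c2 X)"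
    by unfold_locales (simp_all add: coord_simps algebra_simps)
  obtain R1 where R1: "Vector_Spaces.linear (*s) (*) R1" "\<And>X Y. R1 (tensor X Y) = (c0 X - c2 X) * d0 Y"
    using tensor_functional[OF l(1) F2.lin(1)] by blast
  obtain R2 where R2: "Vector_Spaces.linear (*s) (*) R2" "\<And>X Y. R2 (tensor X Y) = (c0 X - k\<^sup>2 * c2 X) * d2 Y"
    using tensor_functional[OF l(2) F2.lin(3)] by blast
  interpret R1: Vector_Spaces.linear "(*s)" "(*)" R1 by (rule R1)
  interpret R2: Vector_Spaces.linear "(*s)" "(*)" R2 by (rule R2)
  define R where "R z = R1 z - R2 z" for z
  have R: "Vector_Spaces.linear (*s) (*) R"
    by unfold_locales (simp_all add: R_def R1.add R2.add R1.scale R2.scale algebra_simps)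
  have val: "R (tensor X Y) = (c0 X - c2 X) * d0 Y - (c0 X - k\<^sup>2 * c2 X) * d2 Y" for X Y
    by (simp add: R_def R1(2) R2(2))
  have "R \<in> vanishing_forms E 1"
  proof (rule vanishing_E_I)
    show "R \<in> forms 1" by (rule forms_linear[OF R])
    show "R (\<Gamma> s t x y) = 0" if "(s, t) \<noteq> (0, 0)" "x\<^sup>2 = Q s t" "y\<^sup>2 = P s t" for s t x y
      using that by (simp add: \<Gamma>_def val P_def Q_def)
  qed
  then show ?thesis using that R val by blast
qed

text \<open>
  The Segre quadrics make a point on which all vanishing forms vanish a tensor product, the
  equations of the two conics put its factors on the conics, and the linear form
  vanishing on the curve gives the remaining equation.
\<close>

lemma zariski_closed_E: "zariski_closed E"
proof (rule zariski_closedI[OF E_subset_proj_space])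
  fix z :: "complex^(4 \<times> 4)"
  assume z: "z \<noteq> 0" and v: "\<And>d f. f \<in> vanishing_forms E d \<Longrightarrow> f z = 0"
  obtain m l where kl: "z $ (m, l) \<noteq> 0" using z by (auto simp: vec_eq_iff)
  define X where "X = (\<chi> i. z $ (i, l))"
  define Y where "Y = (\<chi> j. z $ (m, j))"
  have X0: "X \<noteq> 0" and Y0: "Y \<noteq> 0" using kl by (auto simp: X_def Y_def vec_eq_iff)
  have "z $ (m, l) * z $ (i, j) = X $ i * Y $ j" for i j
    using v[OF segre_quadric_vanishing, of i j m l] by (simp add: X_def Y_def mult.commute)
  then have zXY: "z $ (m, l) *s z = tensor X Y" by (simp add: tensor_eq_iff)
  have "vec.span {X} \<in> curve"
    by (rule zariski_closed_mem[OF zariski_closed_conic X0]) (use v[OF row_vanishing[where l=l]] in \<open>simp add: X_def\<close>)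
  then obtain s t where st: "(s, t) \<noteq> (0, 0)" "vec.span {X} = vec.span {pt s t}" by (rule conic_mem_cases)
  have "vec.span {Y} \<in> C2"
    by (rule zariski_closed_mem[OF F2.zariski_closed_conic Y0]) (use v[OF column_vanishing[where l=m]] in \<open>simp add: Y_def\<close>)
  then obtain x y where xy: "(x, y) \<noteq> (0, 0)" "vec.span {Y} = vec.span {pt2 x y}" by (rule F2.conic_mem_cases)
  obtain \<alpha> where \<alpha>: "\<alpha> \<noteq> 0" "X = \<alpha> *s pt s t" using st(2) span_line_eq_iff[OF X0] by metis
  obtain \<beta> where \<beta>: "\<beta> \<noteq> 0" "Y = \<beta> *s pt2 x y" using xy(2) span_line_eq_iff[OF Y0] by metis
  have zt: "z $ (m, l) *s z = (\<alpha> * \<beta>) *s tensor (pt s t) (pt2 x y)"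
    unfolding zXY \<alpha> \<beta> by (rule tensor_scale)
  obtain R where R: "Vector_Spaces.linear (*s) (*) R"
    "\<And>X Y. R (tensor X Y) = (c0 X - c2 X) * d0 Y - (c0 X - k\<^sup>2 * c2 X) * d2 Y"
    "R \<in> vanishing_forms E 1" using edge_functional by blast
  interpret R: Vector_Spaces.linear "(*s)" "(*)" R by (rule R)
  have "R (z $ (m, l) *s z) = 0" using v[OF R(3)] by (simp add: R.scale)
  then have "R (tensor (pt s t) (pt2 x y)) = 0" unfolding zt using \<alpha> \<beta> by (simp add: R.scale)
  then have "x\<^sup>2 * P s t = y\<^sup>2 * Q s t" by (simp add: R(2) P_def Q_def mult.commute)
  then have "(vec.span {pt s t}, vec.span {pt2 x y}) \<in> stationary_pairs curve C2"
    unfolding stationary_pairs_eq using st(1) xy(1) by blast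
  then have "segre (vec.span {pt s t}, vec.span {pt2 x y}) \<in> E"
    unfolding segre_stationary_pairs[symmetric] by (rule imageI)
  moreover have "vec.span {z} = vec.span {tensor (pt s t) (pt2 x y)}"
    using span_line_scale[OF kl, of z] span_line_scale[of "\<alpha> * \<beta>" "tensor (pt s t) (pt2 x y)"] zt \<alpha> \<beta> by simp
  ultimately show "vec.span {z} \<in> E" by (simp only: segre_lines)
qed

lemma edge_curve_eq: "edge_curve curve C2 = E"
  unfolding edge_curve_def segre_stationary_pairs by (rule zariski_closure_closed[OF zariski_closed_E])

lemma restricted_normal_form:
  assumes "f \<in> forms n"
  obtains A B N where "binary_form (4 * n) A" "binary_form N B" "n > 0 \<Longrightarrow> N = 4 * n - 2"
    "\<And>s t x y. x\<^sup>2 = Q s t \<Longrightarrow> y\<^sup>2 = P s t \<Longrightarrow> f (\<Gamma> s t x y) = A s t + x * y * B s t"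
proof -
  from normal_form[OF assms] obtain A B U V where A: "binary_form (4 * n) A"
    and B: "n = 0 \<and> B = (\<lambda>s t. 0) \<or> n > 0 \<and> binary_form (4 * n - 2) B"
    and eq: "\<And>s t x y. f (\<Gamma> s t x y) = A s t + x * y * B s t + (x\<^sup>2 - Q s t) * U s t x y + (y\<^sup>2 - P s t) * V s t x y"
    by blast
  have "binary_form (4 * n - 2) B" using B binary_form_zero by blast
  from that[OF A this] eq show ?thesis by simp
qed

text \<open>
  Products of forms not vanishing on the curve do not vanish on it, since their normal forms are
  taken from a domain.
\<close>

lemma irreducible_E: "irreducible_set E"
  unfolding irreducible_set_def
proof (intro conjI allI impI)
  have "vec.span {\<Gamma> 1 0 1 1} \<in> E" by (rule E_I) (simp_all add: P_def Q_def)
  then show "E \<noteq> {}" by blast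
  fix A B :: "(4 \<times> 4) point set"
  assume AB: "zariski_closed A \<and> zariski_closed B \<and> E \<subseteq> A \<union> B"
  have ex: "\<exists>f d s t x y. f \<in> vanishing_forms Z d \<and> (s, t) \<noteq> (0, 0) \<and> x\<^sup>2 = Q s t \<and> y\<^sup>2 = P s t \<and> f (\<Gamma> s t x y) \<noteq> 0"
    if "zariski_closed Z" "\<not> E \<subseteq> Z" for Z
  proof -
    obtain e where "e \<in> E" "e \<notin> Z" using \<open>\<not> E \<subseteq> Z\<close> by blast
    then obtain s t x y where h: "(s, t) \<noteq> (0, 0)" "x\<^sup>2 = Q s t" "y\<^sup>2 = P s t" "vec.span {\<Gamma> s t x y} \<notin> Z"
      unfolding E_def by blast
    then have "\<exists>d f. f \<in> vanishing_forms Z d \<and> f (\<Gamma> s t x y) \<noteq> 0"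
      using zariski_closed_mem[OF \<open>zariski_closed Z\<close> \<Gamma>_nonzero[OF h(1-3)]] by blast
    then show ?thesis using h by blast
  qed
  show "E \<subseteq> A \<or> E \<subseteq> B"
  proof (rule ccontr)
    assume not: "\<not> (E \<subseteq> A \<or> E \<subseteq> B)"
    obtain f m s1 t1 x1 y1 where f: "f \<in> vanishing_forms A m" and f1: "x1\<^sup>2 = Q s1 t1" "y1\<^sup>2 = P s1 t1" "f (\<Gamma> s1 t1 x1 y1) \<noteq> 0"
      using ex[of A] AB not by blast
    obtain g n s2 t2 x2 y2 where g: "g \<in> vanishing_forms B n" and g1: "x2\<^sup>2 = Q s2 t2" "y2\<^sup>2 = P s2 t2" "g (\<Gamma> s2 t2 x2 y2) \<noteq> 0"
      using ex[of B] AB not by blast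
    have fd: "f \<in> forms m" "g \<in> forms n" using f g by (auto simp: vanishing_forms_def)
    obtain A1 B1 N1 where F: "binary_form (4 * m) A1" "binary_form N1 B1"
      "\<And>s t x y. x\<^sup>2 = Q s t \<Longrightarrow> y\<^sup>2 = P s t \<Longrightarrow> f (\<Gamma> s t x y) = A1 s t + x * y * B1 s t"
      using restricted_normal_form[OF fd(1)] by metis
    obtain A2 B2 N2 where G: "binary_form (4 * n) A2" "binary_form N2 B2"
      "\<And>s t x y. x\<^sup>2 = Q s t \<Longrightarrow> y\<^sup>2 = P s t \<Longrightarrow> g (\<Gamma> s t x y) = A2 s t + x * y * B2 s t"
      using restricted_normal_form[OF fd(2)] by metis
    have "A1 = (\<lambda>s t. 0) \<and> B1 = (\<lambda>s t. 0) \<or> A2 = (\<lambda>s t. 0) \<and> B2 = (\<lambda>s t. 0)"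
    proof (rule quartic_functions_domain[OF F(1,2) G(1,2)])
      fix s t x y assume h: "(s, t) \<noteq> (0, 0)" "x\<^sup>2 = Q s t" "y\<^sup>2 = P s t"
      then have "vec.span {\<Gamma> s t x y} \<in> A \<union> B" using E_I AB by blast
      then have "f (\<Gamma> s t x y) = 0 \<or> g (\<Gamma> s t x y) = 0"
        using f g line_base unfolding vanishing_forms_def by blast
      then show "(A1 s t + x * y * B1 s t) * (A2 s t + x * y * B2 s t) = 0"
        using F(3)[OF h(2,3)] G(3)[OF h(2,3)] by auto
    qed
    then show False using F(3)[OF f1(1,2)] G(3)[OF g1(1,2)] f1(3) g1(3) by auto
  qed
qed

section \<open>Smoothness\<close>

lemma complementary_direction:
  fixes s t :: complex
  assumes "(s, t) \<noteq> (0, 0)"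
  obtains s' t' where "s * t' - t * s' = 1"
proof (cases "s = 0")
  case True
  then show ?thesis using assms by (intro that[of 0 "-1 / t"] that[of "-1/t" 0]) auto
next
  case False
  then show ?thesis by (intro that[of "1 / s" 0]) auto
qed

text \<open>
  Differentiating the parametrisation of the curve along a tangent vector of the quartic gives a
  tangent vector of the curve, because a form vanishing on the curve pulls back to a combination of
  the two equations of the quartic.
\<close>

lemma tangent_vector_of_quartic:
  assumes h: "(s, t) \<noteq> (0, 0)" "x\<^sup>2 = Q s t" "y\<^sup>2 = P s t"
    and tan: "x * x' = s * s' - k\<^sup>2 * t * t'" "y * y' = s * s' - t * t'"
  shows "tensor (s' *s (s *s u0 + t *s u1) + t' *s (s *s u1 + t *s u2)) (pt2 x y)
     + tensor (pt s t) (x' *s (x *s a + y *s v) + y' *s (x *s v + y *s b))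
     \<in> tangent_space E (vec.span {\<Gamma> s t x y})" (is "?w \<in> _")
proof -
  have "2 *s ?w \<in> tangent_space E (vec.span {\<Gamma> s t x y})"
  proof (rule tangent_spaceI[OF \<Gamma>_nonzero[OF h]])
    fix d f assume f: "f \<in> vanishing_forms E d"
    then have fd: "f \<in> forms d" by (simp add: vanishing_forms_def)
    define c where "c \<tau> = \<Gamma> (s + \<tau> * s') (t + \<tau> * t') (x + \<tau> * x') (y + \<tau> * y')" for \<tau>
    have "((\<lambda>\<tau>. c \<tau> $ l) has_field_derivative (2 *s ?w) $ l) (at 0)" for l
    proof -
      obtain i j where l: "l = (i, j)" by (cases l)
      show ?thesis unfolding l c_def \<Gamma>_def conic_pt_def
        by (auto intro!: derivative_eq_intros simp: power2_eq_square algebra_simps)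
    qed
    from forms_deriv_curve[OF fd this]
    have D: "((\<lambda>\<tau>. f (c \<tau>)) has_field_derivative deriv (\<lambda>\<tau>. f (\<Gamma> s t x y + \<tau> *s (2 *s ?w))) 0) (at 0)"
      by (simp add: c_def)
    obtain U V where U: "line_differentiable U" and V: "line_differentiable V"
      and eq: "\<And>s t x y. f (\<Gamma> s t x y) = (x\<^sup>2 - Q s t) * U s t x y + (y\<^sup>2 - P s t) * V s t x y"
      using vanishing_normal_form[OF f] by blast
    define U1 where "U1 \<tau> = U (s + \<tau> * s') (t + \<tau> * t') (x + \<tau> * x') (y + \<tau> * y')" for \<tau>
    define V1 where "V1 \<tau> = V (s + \<tau> * s') (t + \<tau> * t') (x + \<tau> * x') (y + \<tau> * y')" for \<tau>
    obtain U1' where U1': "(U1 has_field_derivative U1') (at 0)"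
      using U unfolding line_differentiable_def U1_def[abs_def] field_differentiable_def by blast
    obtain V1' where V1': "(V1 has_field_derivative V1') (at 0)"
      using V unfolding line_differentiable_def V1_def[abs_def] field_differentiable_def by blast
    define F1 where "F1 \<tau> = (x + \<tau> * x')\<^sup>2 - Q (s + \<tau> * s') (t + \<tau> * t')" for \<tau>
    define F2 where "F2 \<tau> = (y + \<tau> * y')\<^sup>2 - P (s + \<tau> * s') (t + \<tau> * t')" for \<tau>
    have F0: "F1 0 = 0" "F2 0 = 0" using h by (simp_all add: F1_def F2_def)
    have "(F1 has_field_derivative 2 * (x * x' - (s * s' - k\<^sup>2 * t * t'))) (at 0)"
      unfolding F1_def[abs_def] Q_def by (auto intro!: derivative_eq_intros simp: algebra_simps)
    then have F1': "(F1 has_field_derivative 0) (at 0)" using tan by simp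
    have "(F2 has_field_derivative 2 * (y * y' - (s * s' - t * t'))) (at 0)"
      unfolding F2_def[abs_def] P_def by (auto intro!: derivative_eq_intros simp: algebra_simps)
    then have F2': "(F2 has_field_derivative 0) (at 0)" using tan by simp
    have "((\<lambda>\<tau>. F1 \<tau> * U1 \<tau> + F2 \<tau> * V1 \<tau>) has_field_derivative 0) (at 0)"
      using DERIV_add[OF DERIV_mult[OF F1' U1'] DERIV_mult[OF F2' V1']] F0 by simp
    moreover have "F1 \<tau> * U1 \<tau> + F2 \<tau> * V1 \<tau> = f (c \<tau>)" for \<tau>
      by (simp add: c_def eq F1_def F2_def U1_def V1_def)
    ultimately have "((\<lambda>\<tau>. f (c \<tau>)) has_field_derivative 0) (at 0)" by simp
    then show "deriv (\<lambda>\<tau>. f (\<Gamma> s t x y + \<tau> *s (2 *s ?w))) 0 = 0" using D DERIV_unique by blast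
  qed
  then have "(1 / 2) *s (2 *s ?w) \<in> tangent_space E (vec.span {\<Gamma> s t x y})"
    by (rule vec.subspace_scale[OF subspace_tangent_space])
  then show ?thesis by (simp add: vector_smult_assoc)
qed

text \<open>
  Conversely, the quadrics of the Segre variety and the equations of the two conics force a tangent
  vector to be a combination of tangent vectors of the factors.
\<close>

lemma tangent_vector_decomposition:
  assumes h: "(s, t) \<noteq> (0, 0)" "x\<^sup>2 = Q s t" "y\<^sup>2 = P s t"
    and w: "w \<in> tangent_space E (vec.span {\<Gamma> s t x y})"
  obtains \<xi> \<eta> where "\<xi> \<in> tangent_space curve (vec.span {pt s t})"
    "\<eta> \<in> tangent_space C2 (vec.span {pt2 x y})" "w = tensor \<xi> (pt2 x y) + tensor (pt s t) \<eta>"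
proof -
  define X Y where "X = pt s t" and "Y = pt2 x y"
  have xy: "(x, y) \<noteq> (0, 0)" by (rule quartic_xy_nonzero[OF h])
  have \<Gamma>: "\<Gamma> s t x y = tensor X Y" by (simp add: \<Gamma>_def X_def Y_def)
  have X0: "X \<noteq> 0" and Y0: "Y \<noteq> 0" unfolding X_def Y_def using pt_nonzero[OF h(1)] F2.pt_nonzero[OF xy] by auto
  obtain m where m: "X $ m \<noteq> 0" using X0 by (auto simp: vec_eq_iff)
  obtain l where l: "Y $ l \<noteq> 0" using Y0 by (auto simp: vec_eq_iff)
  note \<Gamma>0 = \<Gamma>_nonzero[OF h]
  define \<xi> where "\<xi> = (\<chi> i. w $ (i, l))"
  define \<eta> where "\<eta> = (\<chi> j. w $ (m, j))"
  have \<xi>: "\<xi> \<in> tangent_space curve (vec.span {X})"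
  proof -
    have "\<xi> \<in> tangent_space curve (vec.span {Y $ l *s X})"
    proof (rule tangent_spaceI)
      show "Y $ l *s X \<noteq> 0" using l X0 by simp
      fix d f assume f: "f \<in> vanishing_forms curve d"
      have "deriv (\<lambda>\<tau>. f (\<chi> i. (\<Gamma> s t x y + \<tau> *s w) $ (i, l))) 0 = 0"
        by (rule tangent_spaceD[OF w \<Gamma>0 row_vanishing[OF f, of l]])
      moreover have "(\<chi> i. (\<Gamma> s t x y + \<tau> *s w) $ (i, l)) = Y $ l *s X + \<tau> *s \<xi>" for \<tau>
        by (simp add: \<Gamma> \<xi>_def vec_eq_iff)
      ultimately show "deriv (\<lambda>\<tau>. f (Y $ l *s X + \<tau> *s \<xi>)) 0 = 0" by simp
    qed
    then show ?thesis using l by (simp add: span_line_scale)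
  qed
  have \<eta>: "\<eta> \<in> tangent_space C2 (vec.span {Y})"
  proof -
    have "\<eta> \<in> tangent_space C2 (vec.span {X $ m *s Y})"
    proof (rule tangent_spaceI)
      show "X $ m *s Y \<noteq> 0" using m Y0 by simp
      fix d f assume f: "f \<in> vanishing_forms C2 d"
      have "deriv (\<lambda>\<tau>. f (\<chi> j. (\<Gamma> s t x y + \<tau> *s w) $ (m, j))) 0 = 0"
        by (rule tangent_spaceD[OF w \<Gamma>0 column_vanishing[OF f, of m]])
      moreover have "(\<chi> j. (\<Gamma> s t x y + \<tau> *s w) $ (m, j)) = X $ m *s Y + \<tau> *s \<eta>" for \<tau>
        by (simp add: \<Gamma> \<eta>_def vec_eq_iff)
      ultimately show "deriv (\<lambda>\<tau>. f (X $ m *s Y + \<tau> *s \<eta>)) 0 = 0" by simp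
    qed
    then show ?thesis using m by (simp add: span_line_scale)
  qed
  have Yt: "Y \<in> tangent_space C2 (vec.span {Y})"
  proof -
    have "Y = x *s (x *s a + y *s v) + y *s (x *s v + y *s b)"
      by (simp add: Y_def conic_pt_def vec_eq_iff power2_eq_square algebra_simps)
    then show ?thesis using F2.tangent_space_conic[OF xy, of Y] unfolding Y_def[symmetric] by blast
  qed
  have rel: "w $ (i, j) * (X $ m * Y $ l) = \<xi> $ i * (X $ m * Y $ j) + X $ i * Y $ l * \<eta> $ j - X $ i * Y $ j * w $ (m, l)" for i j
  proof -
    have "deriv (\<lambda>\<tau>. (\<Gamma> s t x y + \<tau> *s w) $ (i, j) * (\<Gamma> s t x y + \<tau> *s w) $ (m, l)
        - (\<Gamma> s t x y + \<tau> *s w) $ (i, l) * (\<Gamma> s t x y + \<tau> *s w) $ (m, j)) 0 = 0"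
      by (rule tangent_spaceD[OF w \<Gamma>0 segre_quadric_vanishing])
    moreover have "deriv (\<lambda>\<tau>. (\<Gamma> s t x y + \<tau> *s w) $ (i, j) * (\<Gamma> s t x y + \<tau> *s w) $ (m, l)
        - (\<Gamma> s t x y + \<tau> *s w) $ (i, l) * (\<Gamma> s t x y + \<tau> *s w) $ (m, j)) 0
      = w $ (i, j) * (X $ m * Y $ l) + X $ i * Y $ j * w $ (m, l) - (w $ (i, l) * (X $ m * Y $ j) + X $ i * Y $ l * w $ (m, j))"
      unfolding \<Gamma> by (rule DERIV_imp_deriv) (auto intro!: derivative_eq_intros simp: algebra_simps)
    ultimately show ?thesis by (simp add: \<xi>_def \<eta>_def algebra_simps)
  qed
  define \<eta>' where "\<eta>' = (1 / X $ m) *s \<eta> - (w $ (m, l) / (X $ m * Y $ l)) *s Y"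
  have "\<eta>' \<in> tangent_space C2 (vec.span {Y})"
    unfolding \<eta>'_def by (intro vec.subspace_diff vec.subspace_scale subspace_tangent_space \<eta> Yt)
  moreover have "(1 / Y $ l) *s \<xi> \<in> tangent_space curve (vec.span {X})"
    by (intro vec.subspace_scale subspace_tangent_space \<xi>)
  moreover have "w = tensor ((1 / Y $ l) *s \<xi>) Y + tensor X \<eta>'"
    unfolding tensor_eq_iff
  proof (intro allI)
    fix i j
    have "w $ (i, j) = (\<xi> $ i * (X $ m * Y $ j) + X $ i * Y $ l * \<eta> $ j - X $ i * Y $ j * w $ (m, l)) / (X $ m * Y $ l)"
      using rel[of i j] m l by (simp add: nonzero_eq_divide_eq)
    then show "w $ (i, j) = (tensor ((1 / Y $ l) *s \<xi>) Y + tensor X \<eta>') $ (i, j)"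
      using m l by (simp add: \<eta>'_def field_simps)
  qed
  ultimately show ?thesis using that unfolding X_def Y_def by blast
qed

lemma tensor_independent:
  assumes X: "\<And>\<alpha> \<beta>. \<alpha> *s X + \<beta> *s X1 = 0 \<Longrightarrow> \<alpha> = 0 \<and> \<beta> = 0"
    and Y: "\<And>\<alpha> \<beta>. \<alpha> *s Y + \<beta> *s Y1 = 0 \<Longrightarrow> \<alpha> = 0 \<and> \<beta> = 0"
    and eq: "\<alpha> *s tensor X Y + \<beta> *s tensor X1 Y + \<gamma> *s tensor X Y1 = 0"
  shows "\<alpha> = 0" "\<beta> = 0" "\<gamma> = 0"
proof -
  have "(\<alpha> * Y $ j + \<gamma> * Y1 $ j) *s X + (\<beta> * Y $ j) *s X1 = 0" for j
    using eq by (simp add: vec_eq_iff algebra_simps)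
  then have j: "\<alpha> * Y $ j + \<gamma> * Y1 $ j = 0 \<and> \<beta> * Y $ j = 0" for j by (rule X)
  then have "\<alpha> *s Y + \<gamma> *s Y1 = 0" by (simp add: vec_eq_iff)
  from Y[OF this] show "\<alpha> = 0" "\<gamma> = 0" by auto
  have "\<beta> *s Y + 0 *s Y1 = 0" using j by (simp add: vec_eq_iff)
  from Y[OF this] show "\<beta> = 0" by auto
qed

text \<open>
  By the decomposition of tangent vectors, the tangent space is contained in the span of
  \<open>X \<otimes> Y\<close>, \<open>X1 \<otimes> Y\<close> and \<open>X \<otimes> Y1\<close>, where \<open>X1\<close> and \<open>Y1\<close> complete \<open>X\<close> and \<open>Y\<close> to bases of the
  tangent lines. The linear equation of the curve in this space is a relation between the
  last two coefficients, which is nontrivial because \<open>s t\<close> and \<open>x y\<close> do not vanish simultaneously;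
  this leaves dimension two. The tangent vectors of the quartic show that this dimension is attained.
\<close>

lemma smooth_E:
  assumes "e \<in> E"
  shows "vec.dim (tangent_space E e) = 2"
proof -
  obtain s t x y where h: "(s, t) \<noteq> (0, 0)" "x\<^sup>2 = Q s t" "y\<^sup>2 = P s t" and e: "e = vec.span {\<Gamma> s t x y}"
    using assms by (rule E_cases)
  have xy: "(x, y) \<noteq> (0, 0)" by (rule quartic_xy_nonzero[OF h])
  obtain s' t' where st': "s * t' - t * s' = 1" using complementary_direction[OF h(1)] .
  obtain x' y' where xy': "x * y' - y * x' = 1" using complementary_direction[OF xy] .
  define X Y where "X = pt s t" and "Y = pt2 x y"
  define X1 where "X1 = s' *s (s *s u0 + t *s u1) + t' *s (s *s u1 + t *s u2)"
  define Y1 where "Y1 = x' *s (x *s a + y *s v) + y' *s (x *s v + y *s b)"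
  have dX: "p *s (s *s u0 + t *s u1) + r *s (s *s u1 + t *s u2) = (p * t' - r * s') *s X + (s * r - t * p) *s X1" for p r
    unfolding X_def X1_def conic_pt_def vec_eq_iff using st' by (simp, algebra)
  have dY: "p *s (x *s a + y *s v) + r *s (x *s v + y *s b) = (p * y' - r * x') *s Y + (x * r - y * p) *s Y1" for p r
    unfolding Y_def Y1_def conic_pt_def[of a v b] vec_eq_iff using xy' by (simp, algebra)
  have indX: "\<alpha> = 0 \<and> \<beta> = 0" if "\<alpha> *s X + \<beta> *s X1 = 0" for \<alpha> \<beta>
  proof -
    have "c0 (\<alpha> *s X + \<beta> *s X1) = 0" "c1 (\<alpha> *s X + \<beta> *s X1) = 0" "c2 (\<alpha> *s X + \<beta> *s X1) = 0"
      using that by (simp_all add: coord_simps)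
    then have "\<alpha> * s\<^sup>2 + \<beta> * s' * s = 0" "\<alpha> * (2 * s * t) + \<beta> * (s' * t + t' * s) = 0" "\<alpha> * t\<^sup>2 + \<beta> * t' * t = 0"
      by (simp_all add: X_def X1_def coord_simps algebra_simps)
    then have "\<beta> * s = 0" "\<beta> * t = 0" "\<alpha> * s\<^sup>2 + \<beta> * s' * s = 0" "\<alpha> * t\<^sup>2 + \<beta> * t' * t = 0" using st' by algebra+
    then show ?thesis using h(1) by auto
  qed
  have indY: "\<alpha> = 0 \<and> \<beta> = 0" if "\<alpha> *s Y + \<beta> *s Y1 = 0" for \<alpha> \<beta>
  proof -
    have "d0 (\<alpha> *s Y + \<beta> *s Y1) = 0" "c3 (\<alpha> *s Y + \<beta> *s Y1) = 0" "d2 (\<alpha> *s Y + \<beta> *s Y1) = 0"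
      using that by (simp_all only: F2.coord_simps)
    then have "\<alpha> * x\<^sup>2 + \<beta> * x' * x = 0" "\<alpha> * (2 * x * y) + \<beta> * (x' * y + y' * x) = 0" "\<alpha> * y\<^sup>2 + \<beta> * y' * y = 0"
      by (simp_all add: Y_def Y1_def F2.coord_simps algebra_simps)
    then have "\<beta> * x = 0" "\<beta> * y = 0" "\<alpha> * x\<^sup>2 + \<beta> * x' * x = 0" "\<alpha> * y\<^sup>2 + \<beta> * y' * y = 0" using xy' by algebra+
    then show ?thesis using xy by auto
  qed
  define r where "r = (k\<^sup>2 - 1) * (s * t)"
  have r_xy: "r \<noteq> 0 \<or> x * y \<noteq> 0"
  proof (cases "s * t = 0")
    case True
    have "(x * y)\<^sup>2 = (s\<^sup>2 - k\<^sup>2 * t\<^sup>2) * (s\<^sup>2 - t\<^sup>2)" using h by (simp add: power_mult_distrib P_def Q_def)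
    then have "(x * y)\<^sup>2 = s ^ 4 + k\<^sup>2 * t ^ 4" using True by algebra
    then show ?thesis using True h(1) k0 by auto
  next
    case False
    then show ?thesis using k1' by (simp add: r_def)
  qed
  \<comment> \<open>the image of a tangent vector of the quartic which is not radial\<close>
  define p q where "p = s * s' - t * t'" and "q = s * s' - k\<^sup>2 * t * t'"
  define V where "V = (x * y) *s tensor X1 Y + ((y * q) * y' - (x * p) * x') *s tensor X Y + r *s tensor X Y1"
  have V: "V \<in> tangent_space E e"
  proof -
    have "tensor ((x * y * s') *s (s *s u0 + t *s u1) + (x * y * t') *s (s *s u1 + t *s u2)) (pt2 x y)
     + tensor (pt s t) ((y * q) *s (x *s a + y *s v) + (x * p) *s (x *s v + y *s b)) \<in> tangent_space E e"
      unfolding e by (rule tangent_vector_of_quartic[OF h]) (simp_all add: p_def q_def algebra_simps)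
    moreover have "(x * y * s') *s (s *s u0 + t *s u1) + (x * y * t') *s (s *s u1 + t *s u2) = (x * y) *s X1"
      by (simp add: X1_def vec_eq_iff algebra_simps)
    moreover have "x * (x * p) - y * (y * q) = r"
    proof -
      have "x * (x * p) - y * (y * q) = x\<^sup>2 * p - y\<^sup>2 * q" by (simp add: power2_eq_square)
      then show ?thesis unfolding h p_def q_def r_def P_def Q_def using st' by algebra
    qed
    ultimately have "tensor ((x * y) *s X1) Y + tensor X (((y * q) * y' - (x * p) * x') *s Y + r *s Y1) \<in> tangent_space E e"
      unfolding dY X_def[symmetric] Y_def[symmetric] by metis
    moreover have "tensor ((x * y) *s X1) Y + tensor X (((y * q) * y' - (x * p) * x') *s Y + r *s Y1) = V"
      by (simp add: V_def tensor_eq_iff algebra_simps)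
    ultimately show ?thesis by simp
  qed
  have \<Gamma>T: "tensor X Y \<in> tangent_space E e"
  proof -
    have "s *s (s *s u0 + t *s u1) + t *s (s *s u1 + t *s u2) = X" "x *s (x *s a + y *s v) + y *s (x *s v + y *s b) = Y"
      by (simp_all add: X_def Y_def conic_pt_def vec_eq_iff power2_eq_square algebra_simps)
    moreover have "tensor (s *s (s *s u0 + t *s u1) + t *s (s *s u1 + t *s u2)) (pt2 x y)
     + tensor (pt s t) (x *s (x *s a + y *s v) + y *s (x *s v + y *s b)) \<in> tangent_space E e"
      unfolding e using h by (intro tangent_vector_of_quartic h) (simp_all add: P_def Q_def power2_eq_square)
    ultimately have "tensor X Y + tensor X Y \<in> tangent_space E e" by (simp add: X_def Y_def)
    then have "(1/2) *s (tensor X Y + tensor X Y) \<in> tangent_space E e"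
      by (rule vec.subspace_scale[OF subspace_tangent_space])
    moreover have "(1/2) *s (tensor X Y + tensor X Y) = tensor X Y" by (simp add: vec_eq_iff)
    ultimately show ?thesis by simp
  qed
  have Vn: "V \<notin> vec.span {tensor X Y}"
  proof
    assume "V \<in> vec.span {tensor X Y}"
    then obtain c where "V = c *s tensor X Y" by (auto simp: span_line)
    then have "((y * q) * y' - (x * p) * x' - c) *s tensor X Y + (x * y) *s tensor X1 Y + r *s tensor X Y1 = 0"
      by (simp add: V_def vec_eq_iff algebra_simps)
    from tensor_independent(2,3)[OF indX indY this] show False using r_xy by blast
  qed
  have XY0: "tensor X Y \<noteq> 0"
    unfolding X_def Y_def by (intro tensor_nonzero pt_nonzero F2.pt_nonzero h xy)
  have "tangent_space E e \<subseteq> vec.span {V, tensor X Y}"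
  proof
    fix w assume w: "w \<in> tangent_space E e"
    obtain \<xi> \<eta> where xi: "\<xi> \<in> tangent_space curve (vec.span {pt s t})"
      and eta: "\<eta> \<in> tangent_space C2 (vec.span {pt2 x y})" and weq: "w = tensor \<xi> Y + tensor X \<eta>"
      using tangent_vector_decomposition[OF h] w unfolding e X_def Y_def by blast
    obtain \<alpha> \<beta> where \<xi>: "\<xi> = \<alpha> *s X + \<beta> *s X1"
      using xi unfolding tangent_space_conic[OF h(1)] dX by blast
    obtain \<gamma> \<delta> where \<eta>: "\<eta> = \<gamma> *s Y + \<delta> *s Y1"
      using eta unfolding F2.tangent_space_conic[OF xy] dY by blast
    have w': "w = (\<alpha> + \<gamma>) *s tensor X Y + \<beta> *s tensor X1 Y + \<delta> *s tensor X Y1"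
      unfolding weq \<xi> \<eta> by (simp add: tensor_eq_iff algebra_simps)
    obtain R where R: "Vector_Spaces.linear (*s) (*) R"
      "\<And>X Y. R (tensor X Y) = (c0 X - c2 X) * d0 Y - (c0 X - k\<^sup>2 * c2 X) * d2 Y"
      "R \<in> vanishing_forms E 1" using edge_functional by blast
    interpret R: Vector_Spaces.linear "(*s)" "(*)" R by (rule R)
    have "deriv (\<lambda>\<tau>. R (\<Gamma> s t x y + \<tau> *s w)) 0 = 0"
      by (rule tangent_spaceD[OF w[unfolded e] \<Gamma>_nonzero[OF h] R(3)])
    moreover have "deriv (\<lambda>\<tau>. R (\<Gamma> s t x y + \<tau> *s w)) 0 = R w"
      unfolding R.add R.scale by (rule DERIV_imp_deriv) (auto intro!: derivative_eq_intros)
    ultimately have Rw: "R w = 0" by simp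
    have cX: "c0 X = s\<^sup>2" "c2 X = t\<^sup>2" "c0 X1 = s' * s" "c2 X1 = t' * t"
      by (simp_all add: X_def X1_def coord_simps)
    have dY': "d0 Y = x\<^sup>2" "d2 Y = y\<^sup>2" "d0 Y1 = x' * x" "d2 Y1 = y' * y"
      by (simp_all add: Y_def Y1_def F2.coord_simps)
    have R0: "R (tensor X Y) = 0" using h by (simp add: R(2) cX dY' P_def Q_def)
    have R1: "R (tensor X1 Y) = r"
      unfolding R(2) cX dY' h r_def P_def Q_def using st' by algebra
    have R2: "R (tensor X Y1) = - (x * y)"
    proof -
      have "R (tensor X Y1) = y\<^sup>2 * (x' * x) - x\<^sup>2 * (y' * y)" unfolding R(2) cX dY' h P_def Q_def by simp
      then show ?thesis using xy' by algebra
    qed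
    have rel: "\<beta> * r = \<delta> * (x * y)" using Rw unfolding w' by (simp add: R.add R.scale R0 R1 R2)
    obtain \<theta> where th: "\<beta> = \<theta> * (x * y)" "\<delta> = \<theta> * r"
    proof (cases "r = 0")
      case True
      then have "x * y \<noteq> 0" using r_xy by simp
      then show ?thesis using rel True by (intro that[of "\<beta> / (x * y)"]) auto
    next
      case False
      then show ?thesis using rel by (intro that[of "\<delta> / r"]) (auto simp: field_simps)
    qed
    have "w = \<theta> *s V + (\<alpha> + \<gamma> - \<theta> * ((y * q) * y' - (x * p) * x')) *s tensor X Y"
      unfolding w' th by (simp add: V_def vec_eq_iff algebra_simps)
    then show "w \<in> vec.span {V, tensor X Y}"
      by (metis insertCI vec.span_add vec.span_base vec.span_scale)
  qed
  moreover have "vec.span {V, tensor X Y} \<subseteq> tangent_space E e"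
    using V \<Gamma>T by (intro vec.span_minimal subspace_tangent_space) auto
  ultimately have T: "tangent_space E e = vec.span {V, tensor X Y}" by blast
  have "vec.independent {V, tensor X Y}" using Vn XY0 by (simp add: vec.independent_insert)
  moreover have "V \<noteq> tensor X Y" using Vn by auto
  then have "card {V, tensor X Y} = 2" by simp
  ultimately show ?thesis unfolding T using vec.dim_span_eq_card_independent by metis
qed

end

section \<open>The Hilbert function\<close>

lemma (in vector_space) independent_family:
  fixes b :: "'i \<Rightarrow> 'b"
  assumes "finite I" and "\<And>c. (\<Sum>i\<in>I. scale (c i) (b i)) = 0 \<Longrightarrow> \<forall>i\<in>I. c i = 0"
  shows "inj_on b I" "independent (b ` I)"
proof -
  show inj: "inj_on b I"
  proof (rule inj_onI, rule ccontr)
    fix i j assume ij: "i \<in> I" "j \<in> I" "b i = b j" "i \<noteq> j"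
    define c :: "'i \<Rightarrow> 'a" where "c l = (if l = i then 1 else if l = j then -1 else 0)" for l
    have "(\<Sum>l\<in>I. scale (c l) (b l)) = (\<Sum>l\<in>{i, j}. scale (c l) (b l))"
      using ij assms(1) by (intro sum.mono_neutral_right) (auto simp: c_def)
    also have "\<dots> = 0" using ij by (simp add: c_def)
    finally have "c i = 0" using assms(2) ij by blast
    then show False by (simp add: c_def)
  qed
  show "independent (b ` I)"
  proof (rule independent_if_scalars_zero)
    fix f x assume eq: "(\<Sum>x\<in>b ` I. scale (f x) x) = 0" and x: "x \<in> b ` I"
    have "(\<Sum>i\<in>I. scale (f (b i)) (b i)) = 0" using eq inj by (simp add: sum.reindex)
    then have "\<forall>i\<in>I. f (b i) = 0" by (rule assms(2)[of "\<lambda>i. f (b i)"])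
    then show "f x = 0" using x by blast
  qed (use assms(1) in simp)
qed

lemma vector_space_functions: "vector_space (\<lambda>(c :: complex) g x. c * g x)"
  by unfold_locales (auto simp: fun_eq_iff algebra_simps)

lemma sum_fun_apply: "(\<Sum>i\<in>I. F i) x = (\<Sum>i\<in>I. F i x :: complex)"
  by (induction I rule: infinite_finite_induct) auto

context edge
begin

lemma quartic_eq:
  assumes "x\<^sup>2 = Q s t" "y\<^sup>2 = P s t"
  shows "(k\<^sup>2 * y\<^sup>2 - x\<^sup>2) / (k\<^sup>2 - 1) = s\<^sup>2" "(y\<^sup>2 - x\<^sup>2) / (k\<^sup>2 - 1) = t\<^sup>2"
  using k1' unfolding assms P_def Q_def by (simp_all add: field_simps)

text \<open>
  Every quartic form in \<open>s, t\<close>, and every quadratic form in \<open>s, t\<close> times \<open>x y\<close>, is the restriction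
  of a linear form, because \<open>P\<close> and \<open>Q\<close> span the same space as \<open>s^2\<close> and \<open>t^2\<close>.
\<close>

lemma linear_monomials:
  shows "i \<le> 4 \<Longrightarrow> \<exists>f\<in>forms 1. \<forall>s t x y. x\<^sup>2 = Q s t \<longrightarrow> y\<^sup>2 = P s t \<longrightarrow> f (\<Gamma> s t x y) = s ^ i * t ^ (4 - i)"
    and "i \<le> 2 \<Longrightarrow> \<exists>f\<in>forms 1. \<forall>s t x y. x\<^sup>2 = Q s t \<longrightarrow> y\<^sup>2 = P s t \<longrightarrow> f (\<Gamma> s t x y) = x * y * (s ^ i * t ^ (2 - i))"
proof -
  define S T where "S z = (k\<^sup>2 * d2 z - d0 z) / (k\<^sup>2 - 1)" and "T z = (d2 z - d0 z) / (k\<^sup>2 - 1)" for z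
  have S: "S (pt2 x y) = s\<^sup>2" and T: "T (pt2 x y) = t\<^sup>2" if "x\<^sup>2 = Q s t" "y\<^sup>2 = P s t" for s t x y
    using quartic_eq[OF that] by (simp_all add: S_def T_def)
  have l: "Vector_Spaces.linear (*s) (*) (\<lambda>z. c1 z / 2)" "Vector_Spaces.linear (*s) (*) (\<lambda>z. c3 z / 2)"
    "Vector_Spaces.linear (*s) (*) S" "Vector_Spaces.linear (*s) (*) T"
    by unfold_locales
      (simp_all add: S_def T_def F2.coord_simps add_divide_distrib diff_divide_distrib algebra_simps)
  have ex: "\<exists>f\<in>forms 1. \<forall>x y. f (tensor x y) = c x * d y"
    if "Vector_Spaces.linear (*s) (*) c" "Vector_Spaces.linear (*s) (*) d"
    for c d :: "complex^4 \<Rightarrow> complex"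
    using tensor_functional[OF that] forms_linear by metis
  {
    assume "i \<le> 4"
    then consider "i = 4" | "i = 3" | "i = 2" | "i = 1" | "i = 0" by linarith
    then show "\<exists>f\<in>forms 1. \<forall>s t x y. x\<^sup>2 = Q s t \<longrightarrow> y\<^sup>2 = P s t \<longrightarrow> f (\<Gamma> s t x y) = s ^ i * t ^ (4 - i)"
    proof cases
      case 1
      obtain f where f: "f \<in> forms 1" "\<And>x y. f (tensor x y) = c0 x * S y" using ex[OF lin(1) l(3)] by blast
      show ?thesis unfolding 1 using f(1) by (rule bexI[rotated]) (simp add: \<Gamma>_def f(2) S flip: power_add)
    next
      case 2
      obtain f where f: "f \<in> forms 1" "\<And>x y. f (tensor x y) = c1 x / 2 * S y" using ex[OF l(1) l(3)] by blast
      show ?thesis unfolding 2 using f(1) by (rule bexI[rotated]) (simp add: \<Gamma>_def f(2) S power2_eq_square power3_eq_cube)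
    next
      case 3
      obtain f where f: "f \<in> forms 1" "\<And>x y. f (tensor x y) = c0 x * T y" using ex[OF lin(1) l(4)] by blast
      show ?thesis unfolding 3 using f(1) by (rule bexI[rotated]) (simp add: \<Gamma>_def f(2) T)
    next
      case 4
      obtain f where f: "f \<in> forms 1" "\<And>x y. f (tensor x y) = c1 x / 2 * T y" using ex[OF l(1) l(4)] by blast
      show ?thesis unfolding 4 using f(1) by (rule bexI[rotated]) (simp add: \<Gamma>_def f(2) T power2_eq_square power3_eq_cube)
    next
      case 5
      obtain f where f: "f \<in> forms 1" "\<And>x y. f (tensor x y) = c2 x * T y" using ex[OF lin(3) l(4)] by blast
      show ?thesis unfolding 5 using f(1) by (rule bexI[rotated]) (simp add: \<Gamma>_def f(2) T flip: power_add)
    qed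
  next
    assume "i \<le> 2"
    then consider "i = 2" | "i = 1" | "i = 0" by linarith
    then show "\<exists>f\<in>forms 1. \<forall>s t x y. x\<^sup>2 = Q s t \<longrightarrow> y\<^sup>2 = P s t \<longrightarrow> f (\<Gamma> s t x y) = x * y * (s ^ i * t ^ (2 - i))"
    proof cases
      case 1
      obtain f where f: "f \<in> forms 1" "\<And>x y. f (tensor x y) = c0 x * (c3 y / 2)" using ex[OF lin(1) l(2)] by blast
      show ?thesis unfolding 1 using f(1) by (rule bexI[rotated]) (simp add: \<Gamma>_def f(2))
    next
      case 2
      obtain f where f: "f \<in> forms 1" "\<And>x y. f (tensor x y) = c1 x / 2 * (c3 y / 2)" using ex[OF l(1) l(2)] by blast
      show ?thesis unfolding 2 using f(1) by (rule bexI[rotated]) (simp add: \<Gamma>_def f(2))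
    next
      case 3
      obtain f where f: "f \<in> forms 1" "\<And>x y. f (tensor x y) = c2 x * (c3 y / 2)" using ex[OF lin(3) l(2)] by blast
      show ?thesis unfolding 3 using f(1) by (rule bexI[rotated]) (simp add: \<Gamma>_def f(2))
    qed
  }
qed

lemma even_monomial:
  assumes "i \<le> 4 * n"
  shows "\<exists>f\<in>forms n. \<forall>s t x y. x\<^sup>2 = Q s t \<longrightarrow> y\<^sup>2 = P s t \<longrightarrow> f (\<Gamma> s t x y) = s ^ i * t ^ (4 * n - i)"
  using assms
proof (induction n arbitrary: i)
  case 0
  then show ?case by (intro bexI[OF _ forms_const[of 1]]) simp
next
  case (Suc n)
  define j where "j = min i 4"
  have j: "j \<le> 4" "i - j \<le> 4 * n" "j \<le> i" using Suc.prems by (auto simp: j_def)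
  obtain f where f: "f \<in> forms 1" "\<And>s t x y. x\<^sup>2 = Q s t \<Longrightarrow> y\<^sup>2 = P s t \<Longrightarrow> f (\<Gamma> s t x y) = s ^ j * t ^ (4 - j)"
    using linear_monomials(1)[OF j(1)] by blast
  obtain g where g: "g \<in> forms n" "\<And>s t x y. x\<^sup>2 = Q s t \<Longrightarrow> y\<^sup>2 = P s t \<Longrightarrow> g (\<Gamma> s t x y) = s ^ (i - j) * t ^ (4 * n - (i - j))"
    using Suc.IH[OF j(2)] by blast
  have e: "i = j + (i - j)" "4 * Suc n - i = (4 - j) + (4 * n - (i - j))" using j Suc.prems by auto
  show ?case
  proof (rule bexI)
    show "(\<lambda>z. f z * g z) \<in> forms (Suc n)" using forms_mult[OF f(1) g(1)] by simp
    have "s ^ j * t ^ (4 - j) * (s ^ (i - j) * t ^ (4 * n - (i - j))) = s ^ i * t ^ (4 * Suc n - i)" for s t :: complex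
    proof -
      have "s ^ i = s ^ j * s ^ (i - j)" by (metis e(1) power_add)
      then show ?thesis unfolding e(2) by (simp only: power_add ac_simps)
    qed
    then show "\<forall>s t x y. x\<^sup>2 = Q s t \<longrightarrow> y\<^sup>2 = P s t \<longrightarrow> f (\<Gamma> s t x y) * g (\<Gamma> s t x y) = s ^ i * t ^ (4 * Suc n - i)"
      using f(2) g(2) by simp
  qed
qed

lemma odd_monomial:
  assumes "n > 0" "i \<le> 4 * n - 2"
  shows "\<exists>f\<in>forms n. \<forall>s t x y. x\<^sup>2 = Q s t \<longrightarrow> y\<^sup>2 = P s t \<longrightarrow> f (\<Gamma> s t x y) = x * y * (s ^ i * t ^ (4 * n - 2 - i))"
proof -
  obtain m where m: "n = Suc m" using assms(1) by (cases n) auto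
  define j where "j = min i 2"
  have j: "j \<le> 2" "i - j \<le> 4 * m" "j \<le> i" using assms m by (auto simp: j_def)
  obtain f where f: "f \<in> forms 1" "\<And>s t x y. x\<^sup>2 = Q s t \<Longrightarrow> y\<^sup>2 = P s t \<Longrightarrow> f (\<Gamma> s t x y) = x * y * (s ^ j * t ^ (2 - j))"
    using linear_monomials(2)[OF j(1)] by blast
  obtain g where g: "g \<in> forms m" "\<And>s t x y. x\<^sup>2 = Q s t \<Longrightarrow> y\<^sup>2 = P s t \<Longrightarrow> g (\<Gamma> s t x y) = s ^ (i - j) * t ^ (4 * m - (i - j))"
    using even_monomial[OF j(2)] by blast
  have e: "i = j + (i - j)" "4 * n - 2 - i = (2 - j) + (4 * m - (i - j))" using j assms m by auto
  show ?thesis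
  proof (rule bexI)
    show "(\<lambda>z. f z * g z) \<in> forms n" using forms_mult[OF f(1) g(1)] m by simp
    have "s ^ j * t ^ (2 - j) * (s ^ (i - j) * t ^ (4 * m - (i - j))) = s ^ i * t ^ (4 * n - 2 - i)" for s t :: complex
    proof -
      have "s ^ i = s ^ j * s ^ (i - j)" by (metis e(1) power_add)
      then show ?thesis unfolding e(2) by (simp only: power_add ac_simps)
    qed
    then show "\<forall>s t x y. x\<^sup>2 = Q s t \<longrightarrow> y\<^sup>2 = P s t \<longrightarrow> f (\<Gamma> s t x y) * g (\<Gamma> s t x y) = x * y * (s ^ i * t ^ (4 * n - 2 - i))"
      using f(2) g(2) by (simp add: mult.assoc)
  qed
qed

lemma zero_binary_form_coeffs:
  fixes c :: "nat \<Rightarrow> complex"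
  assumes "(\<lambda>s t. \<Sum>i\<le>N. c i * (s ^ i * t ^ (N - i))) = (\<lambda>s t. 0)" "i \<le> N"
  shows "c i = 0"
proof -
  have "(\<Sum>i\<le>N. c i * s ^ i) = 0" for s
    using fun_cong[OF fun_cong[OF assms(1)], of s 1] by simp
  then show ?thesis using assms(2) polyfun_eq_0[of c N] by blast
qed

text \<open>
  By the normal form and the monomials just constructed, the forms of degree \<open>n\<close> restrict to the
  functions \<open>A + x y B\<close> with arbitrary binary forms \<open>A\<close> and \<open>B\<close> of degrees \<open>4 n\<close> and \<open>4 n - 2\<close>. These
  make up a space of dimension \<open>(4 n + 1) + (4 n - 1)\<close>.
\<close>

lemma hilbert_function_E:
  assumes n: "n > 0"
  shows "hilbert_function E n = 8 * n"
proof -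
  interpret fn: vector_space "\<lambda>(c :: complex) (g :: complex^(4 \<times> 4) \<Rightarrow> complex) x. c * g x"
    by (rule vector_space_functions)
  define res where "res f z = (if z \<in> \<Union>E then f z else (0 :: complex))" for f z
  have "\<forall>i. \<exists>f. i \<le> 4 * n \<longrightarrow> f \<in> forms n \<and> (\<forall>s t x y. x\<^sup>2 = Q s t \<longrightarrow> y\<^sup>2 = P s t \<longrightarrow> f (\<Gamma> s t x y) = s ^ i * t ^ (4 * n - i))"
    using even_monomial by blast
  then obtain F where F: "\<And>i. i \<le> 4 * n \<Longrightarrow> F i \<in> forms n"
    "\<And>i s t x y. i \<le> 4 * n \<Longrightarrow> x\<^sup>2 = Q s t \<Longrightarrow> y\<^sup>2 = P s t \<Longrightarrow> F i (\<Gamma> s t x y) = s ^ i * t ^ (4 * n - i)"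
    by metis
  have "\<forall>i. \<exists>f. i \<le> 4 * n - 2 \<longrightarrow> f \<in> forms n \<and> (\<forall>s t x y. x\<^sup>2 = Q s t \<longrightarrow> y\<^sup>2 = P s t \<longrightarrow> f (\<Gamma> s t x y) = x * y * (s ^ i * t ^ (4 * n - 2 - i)))"
    using odd_monomial[OF n] by blast
  then obtain G where G: "\<And>i. i \<le> 4 * n - 2 \<Longrightarrow> G i \<in> forms n"
    "\<And>i s t x y. i \<le> 4 * n - 2 \<Longrightarrow> x\<^sup>2 = Q s t \<Longrightarrow> y\<^sup>2 = P s t \<Longrightarrow> G i (\<Gamma> s t x y) = x * y * (s ^ i * t ^ (4 * n - 2 - i))"
    by metis
  define I where "I = {..4 * n} <+> {..4 * n - 2}"
  have I: "finite I" "card I = 8 * n" using n by (simp_all add: I_def card_Plus)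
  define f where "f l = (case l of Inl i \<Rightarrow> F i | Inr i \<Rightarrow> G i)" for l
  have f: "f l \<in> forms n" if "l \<in> I" for l using that F(1) G(1) by (auto simp: I_def f_def)
  have val: "(\<Sum>l\<in>I. c l * f l (\<Gamma> s t x y))
      = (\<Sum>i\<le>4 * n. c (Inl i) * (s ^ i * t ^ (4 * n - i)))
        + x * y * (\<Sum>i\<le>4 * n - 2. c (Inr i) * (s ^ i * t ^ (4 * n - 2 - i)))"
    if "x\<^sup>2 = Q s t" "y\<^sup>2 = P s t" for c s t x y
  proof -
    have "(\<Sum>l\<in>I. c l * f l (\<Gamma> s t x y)) = (\<Sum>i\<le>4 * n. c (Inl i) * F i (\<Gamma> s t x y)) + (\<Sum>i\<le>4 * n - 2. c (Inr i) * G i (\<Gamma> s t x y))"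
      by (simp add: I_def f_def sum.Plus)
    also have "(\<Sum>i\<le>4 * n. c (Inl i) * F i (\<Gamma> s t x y)) = (\<Sum>i\<le>4 * n. c (Inl i) * (s ^ i * t ^ (4 * n - i)))"
      using F(2) that by (intro sum.cong) auto
    also have "(\<Sum>i\<le>4 * n - 2. c (Inr i) * G i (\<Gamma> s t x y)) = x * y * (\<Sum>i\<le>4 * n - 2. c (Inr i) * (s ^ i * t ^ (4 * n - 2 - i)))"
      unfolding sum_distrib_left using G(2) that by (intro sum.cong) auto
    finally show ?thesis .
  qed
  have bf: "binary_form N (\<lambda>s t. \<Sum>i\<le>N. c i * (s ^ i * t ^ (N - i)))" for N c
    by (intro binary_form_sum binary_form_cmult binary_form_monomial) simp
  have sum_at: "(\<Sum>l\<in>I. (\<lambda>x. c l * res (f l) x)) z = (\<Sum>l\<in>I. c l * res (f l) z)" for c z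
    by (rule sum_fun_apply)
  have ind0: "\<forall>l\<in>I. c l = 0" if zero: "(\<Sum>l\<in>I. (\<lambda>x. c l * res (f l) x)) = 0" for c
  proof -
    have van: "(\<Sum>l\<in>I. c l * f l (\<Gamma> s t x y)) = 0" if h: "(s, t) \<noteq> (0, 0)" "x\<^sup>2 = Q s t" "y\<^sup>2 = P s t" for s t x y
    proof -
      have "\<Gamma> s t x y \<in> \<Union>E" using E_I[OF h] line_base by blast
      then have "(\<Sum>l\<in>I. c l * f l (\<Gamma> s t x y)) = (\<Sum>l\<in>I. c l * res (f l) (\<Gamma> s t x y))"
        by (simp add: res_def)
      also have "\<dots> = 0" unfolding sum_at[symmetric] zero by simp
      finally show ?thesis .
    qed
    have "(\<lambda>s t. \<Sum>i\<le>4 * n. c (Inl i) * (s ^ i * t ^ (4 * n - i))) = (\<lambda>s t. 0) \<and>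
       (\<lambda>s t. \<Sum>i\<le>4 * n - 2. c (Inr i) * (s ^ i * t ^ (4 * n - 2 - i))) = (\<lambda>s t. 0) \<or>
       (\<lambda>s t. 1) = (\<lambda>(s :: complex) (t :: complex). 0 :: complex) \<and> (\<lambda>s t. 0) = (\<lambda>(s :: complex) (t :: complex). 0 :: complex)"
    proof (rule quartic_functions_domain[OF bf bf binary_form_const binary_form_const])
      fix s t x y assume h: "(s, t) \<noteq> (0, 0)" "x\<^sup>2 = Q s t" "y\<^sup>2 = P s t"
      show "((\<Sum>i\<le>4 * n. c (Inl i) * (s ^ i * t ^ (4 * n - i))) + x * y * (\<Sum>i\<le>4 * n - 2. c (Inr i) * (s ^ i * t ^ (4 * n - 2 - i))))
         * (1 + x * y * 0) = 0"
        using van[OF h] unfolding val[OF h(2,3)] by simp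
    qed
    then have z: "(\<lambda>s t. \<Sum>i\<le>4 * n. c (Inl i) * (s ^ i * t ^ (4 * n - i))) = (\<lambda>s t. 0)"
      "(\<lambda>s t. \<Sum>i\<le>4 * n - 2. c (Inr i) * (s ^ i * t ^ (4 * n - 2 - i))) = (\<lambda>s t. 0)"
      by (auto simp: fun_eq_iff)
    have "c (Inl i) = 0" if "i \<le> 4 * n" for i
      by (rule zero_binary_form_coeffs[OF z(1) that])
    moreover have "c (Inr i) = 0" if "i \<le> 4 * n - 2" for i
      by (rule zero_binary_form_coeffs[OF z(2) that])
    ultimately show ?thesis by (auto simp: I_def)
  qed
  note ind = fn.independent_family[of I "\<lambda>l. res (f l)", OF I(1) ind0]
  have span: "res h \<in> fn.span ((\<lambda>l. res (f l)) ` I)" if h: "h \<in> forms n" for h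
  proof -
    obtain A B N where A: "binary_form (4 * n) A" and B: "binary_form N B" "N = 4 * n - 2"
      and eq: "\<And>s t x y. x\<^sup>2 = Q s t \<Longrightarrow> y\<^sup>2 = P s t \<Longrightarrow> h (\<Gamma> s t x y) = A s t + x * y * B s t"
      using restricted_normal_form[OF h] n by metis
    obtain p q where p: "A = (\<lambda>s t. \<Sum>i\<le>4 * n. coeff p i * s ^ i * t ^ (4 * n - i))"
      and q: "B = (\<lambda>s t. \<Sum>i\<le>4 * n - 2. coeff q i * s ^ i * t ^ (4 * n - 2 - i))"
      using A B unfolding binary_form_def by blast
    define c where "c l = (case l of Inl i \<Rightarrow> coeff p i | Inr i \<Rightarrow> coeff q i)" for l
    have "res h = (\<Sum>l\<in>I. (\<lambda>x. c l * res (f l) x))"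
    proof
      fix z
      show "res h z = (\<Sum>l\<in>I. (\<lambda>x. c l * res (f l) x)) z"
      proof (cases "z \<in> \<Union>E")
        case True
        then obtain s t x y where g: "(s, t) \<noteq> (0, 0)" "x\<^sup>2 = Q s t" "y\<^sup>2 = P s t" and "z \<in> vec.span {\<Gamma> s t x y}"
          unfolding E_def by blast
        then obtain m where z: "z = m *s \<Gamma> s t x y" by (auto simp: span_line)
        have "(\<Sum>l\<in>I. c l * res (f l) z) = (\<Sum>l\<in>I. c l * f l z)" using True by (simp add: res_def)
        also have "\<dots> = (\<Sum>l\<in>I. m ^ n * (c l * f l (\<Gamma> s t x y)))"
          by (intro sum.cong refl) (simp add: z forms_homogeneous[OF f])
        also have "\<dots> = m ^ n * (\<Sum>l\<in>I. c l * f l (\<Gamma> s t x y))" by (simp add: sum_distrib_left)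
        also have "\<dots> = m ^ n * h (\<Gamma> s t x y)"
          unfolding val[OF g(2,3)] eq[OF g(2,3)] p q by (simp add: c_def mult.assoc)
        also have "\<dots> = res h z" using True by (simp add: res_def z forms_homogeneous[OF h])
        finally show ?thesis by (simp add: sum_at)
      next
        case False
        then show ?thesis unfolding sum_at by (simp add: res_def)
      qed
    qed
    also have "\<dots> \<in> fn.span ((\<lambda>l. res (f l)) ` I)"
      by (intro fn.span_sum fn.span_scale fn.span_base) simp
    finally show ?thesis .
  qed
  have "fn.dim (res ` forms n) = 8 * n"
  proof (rule fn.dim_unique)
    show "(\<lambda>l. res (f l)) ` I \<subseteq> res ` forms n" using f by blast
    show "res ` forms n \<subseteq> fn.span ((\<lambda>l. res (f l)) ` I)" using span by blast
    show "fn.independent ((\<lambda>l. res (f l)) ` I)" by (rule ind(2))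
    show "card ((\<lambda>l. res (f l)) ` I) = 8 * n" using card_image[OF ind(1)] I(2) by simp
  qed
  moreover have "hilbert_function E n = fn.dim (res ` forms n)"
    unfolding hilbert_function_def res_def[abs_def] by (rule refl)
  ultimately show ?thesis by simp
qed

lemma genus_one_E: "smooth_curve_of_genus 1 E"
  unfolding smooth_curve_of_genus_def
proof (intro conjI exI[of _ 8] ballI)
  show "\<forall>\<^sub>F n in sequentially. int (hilbert_function E n) = int 8 * int n + 1 - int 1"
    using eventually_gt_at_top[of 0] by eventually_elim (simp add: hilbert_function_E)
qed (simp_all add: zariski_closed_E irreducible_E smooth_E)

section \<open>The projection to the first conic\<close>

lemma first_projection_\<Gamma>:
  assumes "(s, t) \<noteq> (0, 0)" "x\<^sup>2 = Q s t" "y\<^sup>2 = P s t"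
  shows "first_projection (vec.span {\<Gamma> s t x y}) = vec.span {pt s t}"
  unfolding \<Gamma>_def
  by (rule first_projection_tensor[OF pt_nonzero[OF assms(1)] F2.pt_nonzero[OF quartic_xy_nonzero[OF assms]]])

text \<open>
  Changing the signs of both \<open>x\<close> and \<open>y\<close> does not change the point, so a fibre is exhausted by the
  two signs of \<open>x\<close>.
\<close>

lemma fibre_eq:
  assumes st: "(s, t) \<noteq> (0, 0)" and xy: "x\<^sup>2 = Q s t" "y\<^sup>2 = P s t"
  shows "{e \<in> E. first_projection e = vec.span {pt s t}} = {vec.span {\<Gamma> s t x y}, vec.span {\<Gamma> s t (- x) y}}"
proof -
  have minus: "\<Gamma> s t (- x') (- y') = \<Gamma> s t x' y'" for x' y'
    by (simp add: \<Gamma>_def conic_pt_def)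
  show ?thesis
  proof (intro equalityI subsetI)
    fix e assume "e \<in> {e \<in> E. first_projection e = vec.span {pt s t}}"
    then have e: "e \<in> E" "first_projection e = vec.span {pt s t}" by auto
    obtain s' t' x' y' where h: "(s', t') \<noteq> (0, 0)" "x'\<^sup>2 = Q s' t'" "y'\<^sup>2 = P s' t'" and e': "e = vec.span {\<Gamma> s' t' x' y'}"
      using e(1) by (rule E_cases)
    have "vec.span {pt s' t'} = vec.span {pt s t}" using first_projection_\<Gamma>[OF h] e(2) e' by simp
    then have eq: "s' * t = s * t'" using pt_line_eq_iff[OF h(1) st] by simp
    obtain c where c: "c \<noteq> 0" "s = c * s'" "t = c * t'"
    proof (cases "s' = 0")
      case True
      then show ?thesis using eq h(1) st by (intro that[of "t / t'"]) auto
    next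
      case False
      then have "s \<noteq> 0" using eq st by auto
      then show ?thesis using eq False by (intro that[of "s / s'"]) (auto simp: field_simps)
    qed
    have "(c * x')\<^sup>2 = x\<^sup>2" "(c * y')\<^sup>2 = y\<^sup>2"
      unfolding xy power_mult_distrib h c P_def Q_def by (simp_all add: algebra_simps power_mult_distrib)
    then have "c * x' = x \<or> c * x' = - x" "c * y' = y \<or> c * y' = - y" by (simp_all add: power2_eq_iff)
    moreover have "vec.span {\<Gamma> s t (c * x') (c * y')} = e"
      unfolding e' c \<Gamma>_scale using c(1) by (simp add: span_line_scale)
    ultimately show "e \<in> {vec.span {\<Gamma> s t x y}, vec.span {\<Gamma> s t (- x) y}}"
      using minus[of x y] minus[of "- x" y] by auto
  next
    fix e assume "e \<in> {vec.span {\<Gamma> s t x y}, vec.span {\<Gamma> s t (- x) y}}"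
    then obtain x' where x': "x'\<^sup>2 = Q s t" "e = vec.span {\<Gamma> s t x' y}" using xy by (metis insertE power2_minus singletonD)
    then show "e \<in> {e \<in> E. first_projection e = vec.span {pt s t}}"
      using first_projection_\<Gamma>[OF st x'(1) xy(2)] E_I[OF st x'(1) xy(2)] by simp
  qed
qed

text \<open>
  The points with \<open>x\<close> and \<open>- x\<close> coincide exactly if \<open>x y = 0\<close>, that is, over the zeros of \<open>P Q\<close>.
\<close>

lemma card_fibre:
  assumes "(s, t) \<noteq> (0, 0)"
  shows "card {e \<in> E. first_projection e = vec.span {pt s t}} = (if P s t * Q s t = 0 then 1 else 2)"
proof -
  define x y where "x = csqrt (Q s t)" and "y = csqrt (P s t)"
  have xy: "x\<^sup>2 = Q s t" "y\<^sup>2 = P s t" by (simp_all add: x_def y_def)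
  have nz: "(x, y) \<noteq> (0, 0)" "(- x, y) \<noteq> (0, 0)" using quartic_xy_nonzero[OF assms xy] by auto
  have "vec.span {\<Gamma> s t x y} = vec.span {\<Gamma> s t (- x) y} \<longleftrightarrow> vec.span {pt2 x y} = vec.span {pt2 (- x) y}"
    unfolding \<Gamma>_def segre_lines[symmetric]
    using tensor_line_eqD(2)[OF pt_nonzero[OF assms] F2.pt_nonzero[OF nz(1)] pt_nonzero[OF assms] F2.pt_nonzero[OF nz(2)]]
    by (metis segre_lines)
  also have "\<dots> \<longleftrightarrow> x * y = - x * y" by (rule F2.pt_line_eq_iff[OF nz])
  also have "\<dots> \<longleftrightarrow> P s t * Q s t = 0" using xy by (auto simp: x_def y_def)
  finally show ?thesis unfolding fibre_eq[OF assms xy] by (simp add: card_insert_if)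
qed

definition branch_points where
  "branch_points = {vec.span {pt 1 1}, vec.span {pt 1 (-1)}, vec.span {pt k 1}, vec.span {pt k (-1)}}"

lemma branch_points_iff:
  assumes "(s, t) \<noteq> (0, 0)"
  shows "vec.span {pt s t} \<in> branch_points \<longleftrightarrow> P s t * Q s t = 0"
proof -
  have "vec.span {pt s t} \<in> branch_points \<longleftrightarrow> s * 1 = 1 * t \<or> s * (-1) = 1 * t \<or> s * 1 = k * t \<or> s * (-1) = k * t"
    unfolding branch_points_def insert_iff empty_iff using k0
    by (subst (1 2 3 4) pt_line_eq_iff[OF assms]) auto
  also have "\<dots> \<longleftrightarrow> (s - t) * (s + t) * ((s - k * t) * (s + k * t)) = 0"
    by (simp add: neg_eq_iff_add_eq_0)
  also have "(s - t) * (s + t) * ((s - k * t) * (s + k * t)) = P s t * Q s t"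
    by (simp add: P_def Q_def power2_eq_square algebra_simps)
  finally show ?thesis .
qed

lemma regular_first_projection: "regular_map E curve first_projection"
  unfolding regular_map_def
proof (intro conjI ballI)
  show "first_projection ` E \<subseteq> curve"
  proof (rule image_subsetI)
    fix e assume "e \<in> E"
    then obtain s t x y where h: "(s, t) \<noteq> (0, 0)" "x\<^sup>2 = Q s t" "y\<^sup>2 = P s t" "e = vec.span {\<Gamma> s t x y}" by (rule E_cases)
    show "first_projection e \<in> curve" unfolding h(4) first_projection_\<Gamma>[OF h(1-3)] by (rule conicI[OF h(1)])
  qed
  fix e assume "e \<in> E"
  then obtain s t x y where h: "(s, t) \<noteq> (0, 0)" "x\<^sup>2 = Q s t" "y\<^sup>2 = P s t" "e = vec.span {\<Gamma> s t x y}" by (rule E_cases)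
  obtain l where l: "pt2 x y $ l \<noteq> 0"
    using F2.pt_nonzero[OF quartic_xy_nonzero[OF h(1-3)]] by (auto simp: vec_eq_iff)
  define F :: "complex^(4 \<times> 4) \<Rightarrow> complex^4" where "F z = (\<chi> i. z $ (i, l))" for z
  have F\<Gamma>: "F (c *s \<Gamma> s' t' x' y') = (c * pt2 x' y' $ l) *s pt s' t'" for c s' t' x' y'
    by (simp add: F_def \<Gamma>_def vec_eq_iff)
  have "\<forall>i. (\<lambda>z. F z $ i) \<in> forms 1" by (simp add: F_def forms_coord del: One_nat_def)
  moreover have "F (\<Gamma> s t x y) \<noteq> 0" using F\<Gamma>[of 1 s t x y] l pt_nonzero[OF h(1)] by simp
  then have "\<exists>z\<in>e. F z \<noteq> 0" unfolding h(4) using line_base by blast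
  moreover have "first_projection q = vec.span {F z}" if q: "q \<in> E" "z \<in> q" "F z \<noteq> 0" for q z
  proof -
    obtain s' t' x' y' where h': "(s', t') \<noteq> (0, 0)" "x'\<^sup>2 = Q s' t'" "y'\<^sup>2 = P s' t'" "q = vec.span {\<Gamma> s' t' x' y'}"
      using q(1) by (rule E_cases)
    then obtain c where z: "z = c *s \<Gamma> s' t' x' y'" using q(2) by (auto simp: span_line)
    have "c * pt2 x' y' $ l \<noteq> 0" using q(3) unfolding z F\<Gamma> by auto
    then show ?thesis unfolding z F\<Gamma> h'(4) first_projection_\<Gamma>[OF h'(1-3)] by (simp only: span_line_scale not_False_eq_True)
  qed
  ultimately show "\<exists>d F. (\<forall>i. (\<lambda>x. F x $ i) \<in> forms d) \<and> (\<exists>x\<in>e. F x \<noteq> 0) \<and>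
      (\<forall>q\<in>E. \<forall>x\<in>q. F x \<noteq> 0 \<longrightarrow> first_projection q = vec.span {F x})"
    by blast
qed

lemma double_cover_first_projection: "double_cover E curve first_projection branch_points"
  unfolding double_cover_def
proof (intro conjI ballI)
  show "branch_points \<subseteq> curve" unfolding branch_points_def by (auto intro!: conicI)
  show "finite branch_points" by (simp add: branch_points_def)
  show "card {x \<in> E. first_projection x = y} = 2" if y: "y \<in> curve - branch_points" for y
  proof -
    obtain s t where st: "(s, t) \<noteq> (0, 0)" "y = vec.span {pt s t}" using y by (blast elim: conic_mem_cases)
    then show ?thesis using y branch_points_iff[OF st(1)] card_fibre[OF st(1)] by simp
  qed
  show "card {x \<in> E. first_projection x = y} = 1" if y: "y \<in> branch_points" for y
  proof -
    have "y \<in> curve" using y \<open>branch_points \<subseteq> curve\<close> by blast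
    then obtain s t where st: "(s, t) \<noteq> (0, 0)" "y = vec.span {pt s t}" by (rule conic_mem_cases)
    then show ?thesis using y branch_points_iff[OF st(1)] card_fibre[OF st(1)] by simp
  qed
qed (rule regular_first_projection)

end

subsection \<open>Composition of regular maps and covers\<close>

lemma regular_map_comp:
  assumes f: "regular_map X Y f" and g: "regular_map Y Z g"
  shows "regular_map X Z (g \<circ> f)"
  unfolding regular_map_def
proof (intro conjI ballI)
  have fX: "f ` X \<subseteq> Y" and gY: "g ` Y \<subseteq> Z" using f g by (auto simp: regular_map_def)
  then show "(g \<circ> f) ` X \<subseteq> Z" by auto
  fix p assume p: "p \<in> X"
  then obtain d F x0 where F: "\<And>i. (\<lambda>x. F x $ i) \<in> forms d" "x0 \<in> p" "F x0 \<noteq> 0"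
    "\<And>q x. q \<in> X \<Longrightarrow> x \<in> q \<Longrightarrow> F x \<noteq> 0 \<Longrightarrow> f q = vec.span {F x}"
    using f unfolding regular_map_def by metis
  have "f p \<in> Y" using p fX by blast
  then obtain e G y0 where G: "\<And>i. (\<lambda>x. G x $ i) \<in> forms e" "y0 \<in> f p" "G y0 \<noteq> 0"
    "\<And>q x. q \<in> Y \<Longrightarrow> x \<in> q \<Longrightarrow> G x \<noteq> 0 \<Longrightarrow> g q = vec.span {G x}"
    using g unfolding regular_map_def by metis
  have "y0 \<in> vec.span {F x0}" using F(4)[OF p F(2,3)] G(2) by simp
  then obtain c where c: "y0 = c *s F x0" by (auto simp: span_line)
  have "G y0 = c ^ e *s G (F x0)"
    unfolding c by (simp add: vec_eq_iff forms_homogeneous[OF G(1)])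
  then have GF0: "G (F x0) \<noteq> 0" using G(3) by auto
  obtain i where i: "F x0 $ i \<noteq> 0" using F(3) by (auto simp: vec_eq_iff)
  \<comment> \<open>the factor \<open>F x $ i\<close> makes sure that \<open>H\<close> vanishes wherever \<open>F\<close> does, also if \<open>G\<close> is constant\<close>
  define H where "H x = F x $ i *s G (F x)" for x
  have "(\<lambda>x. H x $ j) \<in> forms (d + e * d)" for j
    unfolding H_def by (simp add: forms_mult[OF F(1) forms_comp[OF G(1) F(1)]])
  moreover have "H x0 \<noteq> 0" using i GF0 by (simp add: H_def)
  moreover have "(g \<circ> f) q = vec.span {H x}" if q: "q \<in> X" "x \<in> q" "H x \<noteq> 0" for q x
  proof -
    have nz: "F x $ i \<noteq> 0" "G (F x) \<noteq> 0" "F x \<noteq> 0" using q(3) by (auto simp: H_def)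
    have "f q = vec.span {F x}" by (rule F(4)[OF q(1,2) nz(3)])
    then have "F x \<in> f q" by simp
    moreover have "f q \<in> Y" using q(1) fX by blast
    ultimately have "g (f q) = vec.span {G (F x)}" using G(4) nz(2) by blast
    then show ?thesis using nz(1) by (simp add: H_def span_line_scale)
  qed
  ultimately show "\<exists>d F. (\<forall>i. (\<lambda>x. F x $ i) \<in> forms d) \<and> (\<exists>x\<in>p. F x \<noteq> 0) \<and>
         (\<forall>q\<in>X. \<forall>x\<in>q. F x \<noteq> 0 \<longrightarrow> (g \<circ> f) q = vec.span {F x})"
    using F(2) by blast
qed

lemma double_cover_isomorphism:
  assumes f: "double_cover X Y f B" and i: "isomorphism Y Z \<phi>"
  shows "double_cover X Z (\<phi> \<circ> f) (\<phi> ` B)"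
  unfolding double_cover_def
proof (intro conjI ballI)
  have bij: "bij_betw \<phi> Y Z" and reg: "regular_map Y Z \<phi>" using i by (auto simp: isomorphism_def)
  have regf: "regular_map X Y f" and B: "finite B" "B \<subseteq> Y" using f by (auto simp: double_cover_def)
  then have fX: "f ` X \<subseteq> Y" by (simp add: regular_map_def)
  show "regular_map X Z (\<phi> \<circ> f)" by (rule regular_map_comp[OF regf reg])
  show "finite (\<phi> ` B)" using B by simp
  show "\<phi> ` B \<subseteq> Z" using B bij by (auto simp: bij_betw_def)
  have fib: "{x \<in> X. (\<phi> \<circ> f) x = \<phi> y} = {x \<in> X. f x = y}" if "y \<in> Y" for y
    using that bij fX by (auto simp: bij_betw_def inj_on_def)
  show "card {x \<in> X. (\<phi> \<circ> f) x = z} = 2" if z: "z \<in> Z - \<phi> ` B" for z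
  proof -
    obtain y where "y \<in> Y - B" "z = \<phi> y" using z bij by (auto simp: bij_betw_def)
    then show ?thesis using fib[of y] f by (simp add: double_cover_def)
  qed
  show "card {x \<in> X. (\<phi> \<circ> f) x = z} = 1" if z: "z \<in> \<phi> ` B" for z
  proof -
    obtain y where "y \<in> B" "z = \<phi> y" using z by auto
    then show ?thesis using fib[of y] f B by (auto simp: double_cover_def)
  qed
qed

lemma regular_map_identity:
  assumes "X \<subseteq> proj_space" "\<And>q. q \<in> X \<Longrightarrow> f q = q"
  shows "regular_map X X f"
  unfolding regular_map_def
proof (intro conjI ballI)
  show "f ` X \<subseteq> X" using assms(2) by auto
  fix p assume "p \<in> X"
  then obtain v where v: "v \<noteq> 0" "p = vec.span {v}" using assms(1) by (blast elim: proj_space_cases)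
  have "f q = vec.span {x}" if q: "q \<in> X" "x \<in> q" "x \<noteq> 0" for q x
  proof -
    obtain w where "q = vec.span {w}" using q assms(1) by (blast elim: proj_space_cases)
    then obtain c where "q = vec.span {w}" "x = c *s w" using q(2) by (auto simp: span_line)
    moreover from this have "c \<noteq> 0" using q(3) by auto
    ultimately show ?thesis using assms(2)[OF q(1)] by (simp add: span_line_scale)
  qed
  then show "\<exists>d F. (\<forall>i. (\<lambda>x. F x $ i) \<in> forms d) \<and> (\<exists>x\<in>p. F x \<noteq> 0) \<and>
         (\<forall>q\<in>X. \<forall>x\<in>q. F x \<noteq> 0 \<longrightarrow> f q = vec.span {F x})"
    using v forms_coord line_base[of v] by (intro exI[of _ 1] exI[of _ "\<lambda>x. x"]) blast
qed

lemma isomorphism_identity: "X \<subseteq> proj_space \<Longrightarrow> isomorphism X X (\<lambda>x. x)"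
  unfolding isomorphism_def
  by (auto simp: bij_betw_def image_ident intro!: regular_map_identity inv_into_f_eq)

text \<open>
  The isomorphism to the projective line that witnesses the invariant of the branch points turns the
  given cover into a cover of the projective line.
\<close>

lemma has_j_invariantI:
  assumes "double_cover X Y f B" "branch_j_invariant Y B J"
  shows "has_j_invariant X J"
proof -
  obtain \<phi> lam where \<phi>: "isomorphism Y (proj_space :: 2 point set) \<phi>" and lam: "lam \<noteq> 0" "lam \<noteq> 1"
    "\<phi> ` B = {P1_point 0, P1_point 1, P1_point lam, P1_infinity}"
    "J = 2^8 * ((lam^2 - lam + 1)^3 / (lam^2 * (lam - 1)^2))"
    using assms(2) unfolding branch_j_invariant_def by blast
  have "branch_j_invariant (proj_space :: 2 point set) (\<phi> ` B) J"
    unfolding branch_j_invariant_def using lam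
    by (intro exI[of _ "\<lambda>x. x"] exI[of _ lam] conjI isomorphism_identity) (auto simp: image_ident)
  then show ?thesis unfolding has_j_invariant_def using double_cover_isomorphism[OF assms(1) \<phi>] by blast
qed

lemma (in edge) edge_curve_properties:
  assumes "branch_j_invariant curve branch_points J"
  shows "smooth_conic C2" "spanned_plane C2 \<noteq> spanned_plane curve"
    "smooth_curve_of_genus 1 (edge_curve curve C2)" "has_j_invariant (edge_curve curve C2) J"
    "double_cover (edge_curve curve C2) curve first_projection branch_points"
proof -
  show "smooth_conic C2" by (rule F2.smooth_conic_conic)
  show "spanned_plane C2 \<noteq> spanned_plane curve"
  proof
    assume "spanned_plane C2 = spanned_plane curve"
    then have "v \<in> {z. c1 z = 0} \<longleftrightarrow> v \<in> {z. c3 z = 0}"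
      unfolding F2.spanned_plane_conic spanned_plane_conic by blast
    then show False by simp
  qed
  show "smooth_curve_of_genus 1 (edge_curve curve C2)" unfolding edge_curve_eq by (rule genus_one_E)
  show "double_cover (edge_curve curve C2) curve first_projection branch_points"
    unfolding edge_curve_eq by (rule double_cover_first_projection)
  then show "has_j_invariant (edge_curve curve C2) J" using assms by (rule has_j_invariantI)
qed

section \<open>Real structures\<close>

definition cnj_vec :: "complex^'n \<Rightarrow> complex^'n" where
  "cnj_vec v = (\<chi> i. cnj (v $ i))"

lemma cnj_vec_simps:
  "cnj_vec (v + w) = cnj_vec v + cnj_vec w" "cnj_vec (c *s v) = cnj c *s cnj_vec v"
  "cnj_vec (cnj_vec v) = v" "cnj_vec 0 = 0"
  by (simp_all add: cnj_vec_def vec_eq_iff)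

lemma conj_point_eq: "conj_point p = cnj_vec ` p"
  by (simp add: conj_point_def cnj_vec_def[abs_def])

lemma conj_point_involution: "conj_point (conj_point p) = p"
  by (simp add: conj_point_eq image_image cnj_vec_simps)

lemma cnj_vec_span:
  assumes "z \<in> vec.span S"
  shows "cnj_vec z \<in> vec.span (cnj_vec ` S)"
  using assms
proof (induction rule: vec.span_induct_alt)
  case base
  then show ?case by (simp add: cnj_vec_simps vec.span_zero)
next
  case (step c x y)
  from step(1) have "cnj_vec x \<in> vec.span (cnj_vec ` S)" by (intro vec.span_base imageI)
  then show ?case unfolding cnj_vec_simps using step(2) by (intro vec.span_add vec.span_scale)
qed

lemma real_set_Union:
  assumes "real_set C"
  shows "cnj_vec ` \<Union>C = \<Union>C"
proof -
  have "cnj_vec ` \<Union>C = \<Union>(conj_point ` C)" by (auto simp: conj_point_eq)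
  then show ?thesis using assms by (simp add: real_set_def)
qed

text \<open>
  The line through a point of a conic and \<open>z\<close> is tangent if it meets the conic only there. Unlike
  an equation of the tangent line, this description is visibly compatible with complex conjugation.
\<close>

definition touches :: "4 point set \<Rightarrow> 4 point \<Rightarrow> complex^4 \<Rightarrow> bool" where
  "touches C p z \<longleftrightarrow> z \<in> spanned_plane C \<and>
     (\<forall>y\<in>p. \<forall>c. y + c *s z \<in> \<Union>C \<longrightarrow> y + c *s z \<in> p)"

lemma touches_conj:
  assumes C: "real_set C" and z: "touches C p z"
  shows "touches C (conj_point p) (cnj_vec z)"
  unfolding touches_def
proof (intro conjI ballI allI impI)
  show "cnj_vec z \<in> spanned_plane C"
    using cnj_vec_span[of z "\<Union>C"] z unfolding spanned_plane_def real_set_Union[OF C]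
    by (simp add: touches_def spanned_plane_def)
  fix y c assume y: "y \<in> conj_point p" "y + c *s cnj_vec z \<in> \<Union>C"
  then obtain y' where y': "y' \<in> p" "y = cnj_vec y'" by (auto simp: conj_point_eq)
  have e: "y + c *s cnj_vec z = cnj_vec (y' + cnj c *s z)" by (simp add: y' cnj_vec_simps)
  then have "cnj_vec (cnj_vec (y' + cnj c *s z)) \<in> cnj_vec ` \<Union>C" using y(2) by (metis imageI)
  then have "y' + cnj c *s z \<in> \<Union>C" by (simp only: cnj_vec_simps(3) real_set_Union[OF C])
  then have "y' + cnj c *s z \<in> p" using z y'(1) unfolding touches_def by blast
  then show "y + c *s cnj_vec z \<in> conj_point p" unfolding e conj_point_eq by (rule imageI)
qed

text \<open>
  If \<open>z\<close> is not on the tangent line, the line to it has a second point on the conic, which can be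
  computed. Being on both tangent lines is a system of two linear equations, solved by the pole.
\<close>

lemma (in frame) pole_iff:
  assumes "s \<noteq> 0" "t \<noteq> 0"
  shows "touches curve (vec.span {pt s t}) z \<and> touches curve (vec.span {pt s (- t)}) z
    \<longleftrightarrow> z \<in> vec.span {s\<^sup>2 *s e0 - t\<^sup>2 *s e2}"
proof
  have mem: "x \<in> \<Union>curve \<longleftrightarrow> c3 x = 0 \<and> (c1 x)\<^sup>2 = 4 * c0 x * c2 x" for x
  proof (cases "x = 0")
    case True
    have "(1 :: complex, 0 :: complex) \<noteq> (0, 0)" by simp
    then have "vec.span {pt 1 0} \<in> curve" by (rule conicI)
    then show ?thesis using True vec.span_zero by (auto simp: coord_simps)
  next
    case False
    have "x \<in> \<Union>curve \<longleftrightarrow> vec.span {x} \<in> curve"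
    proof
      assume "x \<in> \<Union>curve"
      then obtain p where "p \<in> curve" "x \<in> p" by blast
      then obtain s t where st: "(s, t) \<noteq> (0, 0)" "x \<in> vec.span {pt s t}" by (metis conic_mem_cases)
      then obtain c where c: "x = c *s pt s t" by (auto simp: span_line)
      then have "vec.span {x} = vec.span {pt s t}" using False by (auto intro!: span_line_scale)
      then show "vec.span {x} \<in> curve" using conicI[OF st(1)] by simp
    next
      assume "vec.span {x} \<in> curve" then show "x \<in> \<Union>curve" using line_base by blast
    qed
    then show ?thesis using conic_mem_iff[OF False] by simp
  qed
  {
    assume h: "touches curve (vec.span {pt s t}) z \<and> touches curve (vec.span {pt s (- t)}) z"
    have z3: "c3 z = 0" using h spanned_plane_conic by (auto simp: touches_def)
    have polar: "s * t' * c1 z = s\<^sup>2 * c2 z + t'\<^sup>2 * c0 z"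
      if tz: "touches curve (vec.span {pt s t'}) z" for t'
    proof (rule ccontr)
      define \<beta> where "\<beta> = s * t' * c1 z - (s\<^sup>2 * c2 z + t'\<^sup>2 * c0 z)"
      assume "s * t' * c1 z \<noteq> s\<^sup>2 * c2 z + t'\<^sup>2 * c0 z"
      then have \<beta>: "\<beta> \<noteq> 0" by (simp add: \<beta>_def)
      \<comment> \<open>the second point of intersection of the line with the conic\<close>
      define \<mu> where "\<mu> = ((c1 z)\<^sup>2 - 4 * c0 z * c2 z) / (- 4 * \<beta>)"
      have \<mu>: "4 * \<mu> * \<beta> + ((c1 z)\<^sup>2 - 4 * c0 z * c2 z) = 0" using \<beta> by (simp add: \<mu>_def)
      have "(\<mu> * (2 * s * t') + c1 z)\<^sup>2 = 4 * (\<mu> * s\<^sup>2 + c0 z) * (\<mu> * t'\<^sup>2 + c2 z)"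
        using \<mu> unfolding \<beta>_def by algebra
      then have "\<mu> *s pt s t' + 1 *s z \<in> \<Union>curve" unfolding mem using z3 by (simp add: coord_simps)
      moreover have "\<mu> *s pt s t' \<in> vec.span {pt s t'}" by (intro vec.span_scale line_base)
      ultimately have "\<mu> *s pt s t' + 1 *s z \<in> vec.span {pt s t'}" using tz unfolding touches_def by blast
      then obtain c where "\<mu> *s pt s t' + 1 *s z = c *s pt s t'" by (auto simp: span_line)
      then have "1 *s z = (c - \<mu>) *s pt s t'" by (metis add_diff_cancel_left' vec.scale_left_diff_distrib)
      then have z: "z = (c - \<mu>) *s pt s t'" by simp
      have "\<beta> = 0" unfolding \<beta>_def by (subst (1 2 3) z) (simp add: coord_simps power2_eq_square algebra_simps)
      then show False using \<beta> by simp
    qed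
    have p1: "s * t * c1 z = s\<^sup>2 * c2 z + t\<^sup>2 * c0 z" using polar[of t] h by simp
    have p2: "- (s * t * c1 z) = s\<^sup>2 * c2 z + t\<^sup>2 * c0 z" using polar[of "- t"] h by simp
    have "2 * (s * t * c1 z) = 0" "s\<^sup>2 * c2 z + t\<^sup>2 * c0 z = 0" using p1 p2 by algebra+
    then have "c1 z = 0" "c2 z = - (t\<^sup>2 * c0 z / s\<^sup>2)" using assms
      by (simp_all add: field_simps eq_neg_iff_add_eq_0)
    then have "z = (c0 z / s\<^sup>2) *s (s\<^sup>2 *s e0 - t\<^sup>2 *s e2)"
      using assms z3 by (intro coords_eqI) (simp_all add: coord_simps)
    then show "z \<in> vec.span {s\<^sup>2 *s e0 - t\<^sup>2 *s e2}" by (metis vec.span_scale line_base)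
  }
  assume "z \<in> vec.span {s\<^sup>2 *s e0 - t\<^sup>2 *s e2}"
  then obtain m where z: "z = m *s (s\<^sup>2 *s e0 - t\<^sup>2 *s e2)" by (auto simp: span_line)
  have zc: "c0 z = m * s\<^sup>2" "c1 z = 0" "c2 z = - (m * t\<^sup>2)" "c3 z = 0" by (simp_all add: z coord_simps)
  have "touches curve (vec.span {pt s t'}) z" if t': "t'\<^sup>2 = t\<^sup>2" for t'
    unfolding touches_def
  proof (intro conjI ballI allI impI)
    show "z \<in> spanned_plane curve" by (simp add: spanned_plane_conic zc)
    fix y c assume y: "y \<in> vec.span {pt s t'}" "y + c *s z \<in> \<Union>curve"
    then obtain l where l: "y = l *s pt s t'" by (auto simp: span_line)
    have "(l * (2 * s * t'))\<^sup>2 = 4 * (l * s\<^sup>2 + c * (m * s\<^sup>2)) * (l * t'\<^sup>2 - c * (m * t\<^sup>2))"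
      using y(2) unfolding mem by (simp add: l coord_simps zc)
    then have "4 * ((c * m)\<^sup>2 * (s\<^sup>2 * t\<^sup>2)) = 0" using t' by algebra
    then have "c * m = 0" using assms by simp
    moreover have "c *s z = (c * m) *s (s\<^sup>2 *s e0 - t\<^sup>2 *s e2)" unfolding z by (rule vector_smult_assoc)
    ultimately have "c *s z = 0" by (simp only: vec.scale_zero_left)
    then show "y + c *s z \<in> vec.span {pt s t'}" using y(1) by (simp only: add_0_right)
  qed
  then show "touches curve (vec.span {pt s t}) z \<and> touches curve (vec.span {pt s (- t)}) z" by simp
qed

text \<open>
  The real part of a generator spans the line, unless it is zero; then the generator is imaginary.
\<close>

lemma real_vector_on_line:
  fixes e :: "complex^'n::finite"
  assumes "e \<noteq> 0" "cnj_vec e \<in> vec.span {e}"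
  obtains c where "c \<noteq> 0" "cnj_vec (c *s e) = c *s e"
proof -
  obtain d where d: "cnj_vec e = d *s e" using assms(2) by (auto simp: span_line)
  show ?thesis
  proof (cases "1 + d = 0")
    case False
    have "e + cnj_vec e = (1 + d) *s e" by (simp add: d vec_eq_iff algebra_simps)
    moreover have "cnj_vec (e + cnj_vec e) = e + cnj_vec e" by (simp add: cnj_vec_simps add.commute)
    ultimately show ?thesis using False that[of "1 + d"] by simp
  next
    case True
    then have "d = -1" by (simp add: add_eq_0_iff)
    then have "cnj_vec (\<i> *s e) = \<i> *s e" by (simp add: cnj_vec_simps d vec_eq_iff)
    then show ?thesis using that[of \<i>] by simp
  qed
qed

text \<open>
  If the involution moves some point, this point and its image form one of the two pairs; otherwise
  every partition works.
\<close>

lemma involution_pairs: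
  assumes \<sigma>: "\<sigma> ` S = S" "\<And>x. \<sigma> (\<sigma> x) = x" and "card S = 4"
  obtains s1 s2 s3 s4 where "S = {s1, s2, s3, s4}" "distinct [s1, s2, s3, s4]"
    "{\<sigma> s1, \<sigma> s2} = {s1, s2}" "{\<sigma> s3, \<sigma> s4} = {s3, s4}"
proof (cases "\<forall>x\<in>S. \<sigma> x = x")
  case True
  obtain xs where xs: "set xs = S" "distinct xs" "length xs = 4"
    using assms(3) by (metis card.infinite distinct_card finite_distinct_list zero_neq_numeral)
  then obtain s1 s2 s3 s4 where "xs = [s1, s2, s3, s4]"
    by (auto simp: numeral_eq_Suc length_Suc_conv)
  then show ?thesis using xs True by (intro that[of s1 s2 s3 s4]) auto
next
  case False
  then obtain x where x: "x \<in> S" "\<sigma> x \<noteq> x" by blast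
  have fin: "finite S" using assms(3) by (metis card.infinite zero_neq_numeral)
  define T where "T = S - {x, \<sigma> x}"
  have sx: "\<sigma> x \<in> S" using x \<sigma>(1) by blast
  have "card T = 2" unfolding T_def using x sx fin assms(3) by (simp add: card_Diff_subset)
  then obtain s3 s4 where T: "T = {s3, s4}" "s3 \<noteq> s4" by (auto simp: card_2_iff)
  have "\<sigma> ` T = T"
  proof -
    have "inj \<sigma>" using \<sigma>(2) by (metis injI)
    then have "\<sigma> ` T = \<sigma> ` S - \<sigma> ` {x, \<sigma> x}" unfolding T_def by (rule image_set_diff)
    then show ?thesis using \<sigma> by (auto simp: T_def)
  qed
  moreover have "S = {x, \<sigma> x, s3, s4}" using T(1) x sx by (auto simp: T_def)
  moreover have "distinct [x, \<sigma> x, s3, s4]" using T x by (auto simp: T_def)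
  ultimately show ?thesis using T \<sigma>(2) by (intro that[of x "\<sigma> x" s3 s4]) auto
qed

section \<open>Circles\<close>

text \<open>
  A conic with a real parametrisation is a circle in the affine chart in which the line at infinity
  of its plane is \<open>c0 + c2 = 0\<close>, and \<open>c0 - c2\<close> and \<open>c1\<close> are the orthonormal coordinates: its
  equation \<open>c1^2 = 4 c0 c2\<close> then reads \<open>(c0 - c2)^2 + c1^2 = (c0 + c2)^2\<close>.
\<close>

lemma (in frame) real_conic_is_circle:
  assumes real: "cnj_vec e0 = e0" "cnj_vec e1 = e1" "cnj_vec e2 = e2"
  obtains A where "invertible A" "is_circle_in A curve"
proof -
  define cvec :: "real^4 \<Rightarrow> complex^4" where "cvec r = (\<chi> i. complex_of_real (r $ i))" for r
  have cvec: "cvec (x + y) = cvec x + cvec y" "cvec (c *s x) = complex_of_real c *s cvec x" for x y c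
    by (simp_all add: cvec_def vec_eq_iff)
  have re: "\<exists>r. cvec r = e" if "cnj_vec e = e" for e
  proof (intro exI[of _ "\<chi> i. Re (e $ i)"])
    have "cnj (e $ i) = e $ i" for i using arg_cong[OF that, of "\<lambda>v. v $ i"] by (simp add: cnj_vec_def)
    then have "of_real (Re (e $ i)) = e $ i" for i
      by (metis Reals_cnj_iff complex_is_Real_iff complex_of_real_def complex_surj of_real_Re)
    then show "cvec (\<chi> i. Re (e $ i)) = e" by (simp add: cvec_def vec_eq_iff)
  qed
  obtain r0 where r0: "cvec r0 = e0" using re real by blast
  obtain r1 where r1: "cvec r1 = e1" using re real by blast
  obtain r2 where r2: "cvec r2 = e2" using re real by blast
  obtain m where m: "c3 (axis m 1) \<noteq> 0"
  proof (rule ccontr)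
    assume "\<not> thesis"
    then have 0: "c3 (axis m 1) = 0" for m using that by blast
    have "e3 \<in> vec.span (range (\<lambda>m. axis m 1))"
      by (subst basis_expansion[symmetric]) (intro vec.span_sum vec.span_scale vec.span_base rangeI)
    moreover have "vec.span (range (\<lambda>m. axis m 1)) \<subseteq> {z. c3 z = 0}"
      by (rule vec.span_minimal) (auto intro!: vec.subspaceI simp: coord_simps 0)
    ultimately show False by auto
  qed
  define r3 :: "real^4" where "r3 = axis m 1"
  have r3: "cvec r3 = axis m 1" by (simp add: cvec_def r3_def axis_def vec_eq_iff)
  define A :: "real^4^4" where
    "A = (\<chi> i j. vector [(r0 $ i + r2 $ i) / 2, (r0 $ i - r2 $ i) / 2, r1 $ i, r3 $ i] $ j)"
  have Av: "cvec (A *v x) = complex_of_real ((x $ 1 + x $ 2) / 2) *s e0 + complex_of_real (x $ 3) *s e1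
     + complex_of_real ((x $ 1 - x $ 2) / 2) *s e2 + complex_of_real (x $ 4) *s axis m 1" for x
  proof -
    have "A *v x = ((x $ 1 + x $ 2) / 2) *s r0 + x $ 3 *s r1 + ((x $ 1 - x $ 2) / 2) *s r2 + x $ 4 *s r3"
      by (simp add: vec_eq_iff A_def matrix_vector_mult_def sum_4 field_simps)
    then show ?thesis by (simp only: cvec r0 r1 r2 r3)
  qed
  have "x = 0" if "A *v x = 0" for x
  proof -
    have z: "cvec (A *v x) = 0" using that by (simp add: cvec_def vec_eq_iff)
    have "c3 (cvec (A *v x)) = 0" by (simp add: z coord_simps)
    then have 4: "x $ 4 = 0" using m unfolding Av by (simp add: coord_simps)
    have "c0 (cvec (A *v x)) = 0" "c1 (cvec (A *v x)) = 0" "c2 (cvec (A *v x)) = 0" by (simp_all add: z coord_simps)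
    then have "complex_of_real ((x $ 1 + x $ 2) / 2) = 0" "complex_of_real (x $ 3) = 0" "complex_of_real ((x $ 1 - x $ 2) / 2) = 0"
      unfolding Av using 4 by (simp_all add: coord_simps)
    then have "(x $ 1 + x $ 2) / 2 = 0" "x $ 3 = 0" "(x $ 1 - x $ 2) / 2 = 0" unfolding of_real_eq_0_iff .
    then show ?thesis using 4 by (simp add: vec_eq_iff forall_4)
  qed
  then obtain B where "B ** A = mat 1" using matrix_left_invertible_ker[of A] by blast
  then have inv: "invertible A" unfolding invertible_def using matrix_left_right_inverse by blast
  define n :: "real^3" where "n = axis 3 1"
  define K :: "(real^3) set" where "K = {u \<in> sphere 0 1. n \<bullet> (u - 0) = 0}"
  have "circle K" unfolding circle_def
    by (intro exI[of _ 0] exI[of _ n] exI[of _ 1] conjI K_def) (simp_all add: n_def)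
  have K: "u \<in> K \<longleftrightarrow> (u $ 1)\<^sup>2 + (u $ 2)\<^sup>2 = 1 \<and> u $ 3 = 0" for u
  proof -
    have "n \<bullet> u = u $ 3" by (simp add: n_def inner_axis')
    moreover have "norm u = 1 \<longleftrightarrow> (u $ 1)\<^sup>2 + (u $ 2)\<^sup>2 + (u $ 3)\<^sup>2 = 1"
      by (simp add: norm_vec_def L2_set_def sum_3)
    ultimately show ?thesis by (auto simp: K_def)
  qed
  have chart: "affine_chart A u = vec.span {complex_of_real ((1 + u $ 1) / 2) *s e0 + complex_of_real (u $ 2) *s e1
     + complex_of_real ((1 - u $ 1) / 2) *s e2}" if "u \<in> K" for u
  proof -
    have "affine_chart A u = vec.span {cvec (A *v vector [1, u $ 1, u $ 2, u $ 3])}"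
      by (simp add: affine_chart_def cvec_def)
    then show ?thesis using that K[of u] unfolding Av by simp
  qed
  have "zariski_closure (affine_chart A ` K) = curve"
  proof
    have "affine_chart A ` K \<subseteq> curve"
    proof (rule image_subsetI)
      fix u assume u: "u \<in> K"
      define z where "z = complex_of_real ((1 + u $ 1) / 2) *s e0 + complex_of_real (u $ 2) *s e1
        + complex_of_real ((1 - u $ 1) / 2) *s e2"
      have zc: "c0 z = complex_of_real ((1 + u $ 1) / 2)" "c1 z = complex_of_real (u $ 2)"
        "c2 z = complex_of_real ((1 - u $ 1) / 2)" "c3 z = 0" by (simp_all add: z_def coord_simps)
      have "c0 z + c2 z = complex_of_real ((1 + u $ 1) / 2 + (1 - u $ 1) / 2)" unfolding zc by simp
      also have "(1 + u $ 1) / 2 + (1 - u $ 1) / 2 = 1" by (simp add: field_simps)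
      finally have "c0 z + c2 z = 1" by simp
      then have "z \<noteq> 0" by (auto simp: coord_simps)
      moreover have "(u $ 2)\<^sup>2 = 4 * ((1 + u $ 1) / 2) * ((1 - u $ 1) / 2)"
        using u unfolding K by (simp add: field_simps power2_eq_square)
      then have "complex_of_real ((u $ 2)\<^sup>2) = complex_of_real (4 * ((1 + u $ 1) / 2) * ((1 - u $ 1) / 2))"
        by (rule arg_cong)
      then have "(c1 z)\<^sup>2 = 4 * c0 z * c2 z"
        unfolding zc by (simp only: of_real_mult of_real_power of_real_numeral)
      ultimately have "vec.span {z} \<in> curve" using conic_mem_iff zc(4) by blast
      then show "affine_chart A u \<in> curve" unfolding chart[OF u] z_def .
    qed
    then show "zariski_closure (affine_chart A ` K) \<subseteq> curve"
      unfolding zariski_closure_def using zariski_closed_conic by blast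
    show "curve \<subseteq> zariski_closure (affine_chart A ` K)"
      unfolding zariski_closure_def
    proof (intro Inter_greatest subsetI, elim CollectE conjE)
      fix Z p assume Z: "zariski_closed Z" "affine_chart A ` K \<subseteq> Z" and "p \<in> curve"
      then obtain s t where st: "(s, t) \<noteq> (0, 0)" "p = vec.span {pt s t}" by (blast elim: conic_mem_cases)
      show "p \<in> Z" unfolding st(2)
      proof (rule zariski_closed_mem[OF Z(1) pt_nonzero[OF st(1)]])
        fix d f assume f: "f \<in> vanishing_forms Z d"
        then have "f \<in> forms d" by (simp add: vanishing_forms_def)
        then have "binary_form (2 * d) (\<lambda>s t. f (pt s t))" by (rule binary_form_conic_pt)
        then obtain g where g: "\<And>s. f (pt s 1) = poly g s" "g = 0 \<Longrightarrow> (\<lambda>s t. f (pt s t)) = (\<lambda>s t. 0)"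
          by (rule binary_form_poly) blast
        have "poly g (complex_of_real x) = 0" for x
        proof -
          define N where "N = x\<^sup>2 + 1"
          have N: "N > 0" unfolding N_def by (rule add_nonneg_pos) simp_all
          define u :: "real^3" where "u = vector [(x\<^sup>2 - 1) / N, 2 * x / N, 0]"
          have "(x\<^sup>2 - 1)\<^sup>2 + (2 * x)\<^sup>2 = N\<^sup>2" unfolding N_def by (simp add: power2_eq_square algebra_simps)
          then have "u \<in> K" using N unfolding K u_def
            by (simp add: power_divide add_divide_distrib[symmetric])
          then have "affine_chart A u \<in> Z" using Z(2) by blast
          moreover have "pt (complex_of_real x) 1 = complex_of_real N *s
              (complex_of_real ((1 + u $ 1) / 2) *s e0 + complex_of_real (u $ 2) *s e1 + complex_of_real ((1 - u $ 1) / 2) *s e2)"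
          proof -
            have "x\<^sup>2 = N * ((1 + u $ 1) / 2)" "2 * x = N * u $ 2" "1 = N * ((1 - u $ 1) / 2)"
              using N by (simp_all add: u_def field_simps) (simp_all add: N_def algebra_simps)
            then have "complex_of_real (x\<^sup>2) = complex_of_real (N * ((1 + u $ 1) / 2))"
              "complex_of_real (2 * x) = complex_of_real (N * u $ 2)" "complex_of_real 1 = complex_of_real (N * ((1 - u $ 1) / 2))"
              by presburger+
            then show ?thesis
              by (intro coords_eqI) (simp_all only: coords_pt coord_simps dual of_real_mult of_real_1 of_real_power
                  of_real_numeral mult_1_right mult_zero_right add_0_right add_0_left power_one)
          qed
          then have "pt (complex_of_real x) 1 \<in> affine_chart A u"
            unfolding chart[OF \<open>u \<in> K\<close>] by (simp only: vec.span_scale line_base)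
          ultimately have "f (pt (complex_of_real x) 1) = 0" using f by (auto simp: vanishing_forms_def)
          then show ?thesis using g(1) by simp
        qed
        then have "range complex_of_real \<subseteq> {x. poly g x = 0}" by auto
        moreover have "infinite (range complex_of_real)"
          by (simp add: finite_image_iff inj_of_real infinite_UNIV_char_0)
        ultimately have "g = 0" using poly_roots_finite finite_subset by blast
        from fun_cong[OF fun_cong[OF g(2)[OF this], of s], of t] show "f (pt s t) = 0" .
      qed
    qed
  qed
  then have "is_circle_in A curve" unfolding is_circle_in_def using \<open>circle K\<close> by blast
  then show ?thesis using that inv by blast
qed

text \<open>
  Real multiples of the poles are obtained from complex ones by a substitution in the parameters of
  the second conic.
\<close>

lemma conic_of_rescale:
  assumes "l \<noteq> 0" "m \<noteq> 0"
  shows "conic_of (l\<^sup>2 *s e0) ((l * m) *s e1) (m\<^sup>2 *s e2) = conic_of e0 e1 e2"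
proof -
  have pt: "conic_pt (l\<^sup>2 *s e0) ((l * m) *s e1) (m\<^sup>2 *s e2) s t = conic_pt e0 e1 e2 (l * s) (m * t)" for s t
    by (simp add: conic_pt_def vec_eq_iff power_mult_distrib algebra_simps)
  show ?thesis
  proof (intro equalityI subsetI)
    fix p assume "p \<in> conic_of (l\<^sup>2 *s e0) ((l * m) *s e1) (m\<^sup>2 *s e2)"
    then obtain s t where "(s, t) \<noteq> (0, 0)" "p = vec.span {conic_pt e0 e1 e2 (l * s) (m * t)}"
      unfolding conic_of_def pt by blast
    moreover from this have "(l * s, m * t) \<noteq> (0, 0)" using assms by simp
    ultimately show "p \<in> conic_of e0 e1 e2" unfolding conic_of_def by blast
  next
    fix p assume "p \<in> conic_of e0 e1 e2"
    then obtain s t where st: "(s, t) \<noteq> (0, 0)" "p = vec.span {conic_pt e0 e1 e2 s t}"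
      unfolding conic_of_def by blast
    then have "(s / l, t / m) \<noteq> (0, 0)" "p = vec.span {conic_pt e0 e1 e2 (l * (s / l)) (m * (t / m))}"
      using assms by simp_all
    then show "p \<in> conic_of (l\<^sup>2 *s e0) ((l * m) *s e1) (m\<^sup>2 *s e2)" unfolding conic_of_def pt by blast
  qed
qed

lemma frame_rescale:
  assumes "frame e0 e1 e2 e3 c0 c1 c2 c3" "l \<noteq> 0" "m \<noteq> 0" "n \<noteq> 0"
  obtains d0 d1 d2 d3 where "frame (l *s e0) (m *s e1) (n *s e2) e3 d0 d1 d2 d3"
proof -
  interpret frame e0 e1 e2 e3 c0 c1 c2 c3 by (rule assms)
  have "\<alpha> = 0 \<and> \<beta> = 0 \<and> \<gamma> = 0 \<and> \<delta> = 0"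
    if eq: "\<alpha> *s (l *s e0) + \<beta> *s (m *s e1) + \<gamma> *s (n *s e2) + \<delta> *s e3 = 0" for \<alpha> \<beta> \<gamma> \<delta>
  proof -
    let ?z = "\<alpha> *s (l *s e0) + \<beta> *s (m *s e1) + \<gamma> *s (n *s e2) + \<delta> *s e3"
    have "c0 ?z = 0" "c1 ?z = 0" "c2 ?z = 0" "c3 ?z = 0" by (simp_all only: eq coord_simps)
    then show ?thesis using assms by (simp add: coord_simps)
  qed
  then show ?thesis using that by (rule frame_exists)
qed

section \<open>Existence of the second conic\<close>

text \<open>
  Any root of \<open>256 (x^2 - x + 1)^3 = J x^2 (x - 1)^2\<close> works, because \<open>0\<close> and \<open>1\<close> are not roots. The
  values at \<open>0\<close>, \<open>2\<close> and \<open>3\<close> are not compatible with a constant polynomial.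
\<close>

lemma j_surjective:
  fixes J :: complex
  obtains lam where "lam \<noteq> 0" "lam \<noteq> 1" "J = 2^8 * ((lam^2 - lam + 1)^3 / (lam^2 * (lam - 1)^2))"
proof -
  define p where "p = smult (2^8) ([:1, -1, 1:] ^ 3) - smult J ([:0, 1:] ^ 2 * [:-1, 1:] ^ 2)"
  have p: "poly p x = 2^8 * (x^2 - x + 1)^3 - J * (x^2 * (x - 1)^2)" for x
    by (simp add: p_def power2_eq_square algebra_simps)
  have "\<not> constant (poly p)"
  proof
    assume "constant (poly p)"
    then have "poly p 0 = poly p 2" "poly p 0 = poly p 3" unfolding constant_def by blast+
    then have "J * 4 = 6656" "J * 36 = 87552" unfolding p by (simp_all add: algebra_simps)
    moreover have "J * 36 = (J * 4) * 9" by simp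
    ultimately have "(6656 :: complex) * 9 = 87552" by metis
    then show False by simp
  qed
  then obtain z where z: "poly p z = 0" using fundamental_theorem_of_algebra by blast
  have "poly p 0 \<noteq> 0" "poly p 1 \<noteq> 0" unfolding p by simp_all
  then have z01: "z \<noteq> 0" "z \<noteq> 1" using z by auto
  then have "z^2 * (z - 1)^2 \<noteq> 0" by simp
  moreover have "2^8 * (z^2 - z + 1)^3 = J * (z^2 * (z - 1)^2)" using z unfolding p by simp
  ultimately have "J = 2^8 * ((z^2 - z + 1)^3 / (z^2 * (z - 1)^2))" by (simp add: nonzero_eq_divide_eq)
  then show ?thesis using that z01 by blast
qed

lemma four_points_with_j_invariant:
  assumes "smooth_conic C"
  obtains s1 s2 s3 s4 where "s1 \<in> C" "s2 \<in> C" "s3 \<in> C" "s4 \<in> C" "distinct [s1, s2, s3, s4]"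
    "branch_j_invariant C {s1, s2, s3, s4} J"
proof -
  obtain p q where "p \<in> C" "q \<in> C" "p \<noteq> q" using smooth_conic_two_points[OF assms] .
  then obtain e0 e1 e2 where C: "C = conic_of e0 e1 e2"
    and fr: "\<And>v. v \<notin> spanned_plane C \<Longrightarrow> \<exists>c0 c1 c2 c3. frame e0 e1 e2 v c0 c1 c2 c3"
    and "spanned_plane C \<noteq> UNIV" using smooth_conic_frame[OF assms] by metis
  then obtain v c0 c1 c2 c3 where F: "frame e0 e1 e2 v c0 c1 c2 c3" by blast
  interpret frame e0 e1 e2 v c0 c1 c2 c3 by (rule F)
  obtain lam where lam: "lam \<noteq> 0" "lam \<noteq> 1" "J = 2^8 * ((lam^2 - lam + 1)^3 / (lam^2 * (lam - 1)^2))"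
    by (rule j_surjective)
  let ?p = "\<lambda>s t. vec.span {pt s t}"
  have nz: "(0 :: complex, 1 :: complex) \<noteq> (0, 0)" "(1 :: complex, 1 :: complex) \<noteq> (0, 0)"
    "(lam, 1 :: complex) \<noteq> (0, 0)" "(1 :: complex, 0 :: complex) \<noteq> (0, 0)" by simp_all
  show ?thesis
  proof (rule that[of "?p 0 1" "?p 1 1" "?p lam 1" "?p 1 0"])
    show "?p 0 1 \<in> C" "?p 1 1 \<in> C" "?p lam 1 \<in> C" "?p 1 0 \<in> C"
      unfolding C by (rule conicI[OF nz(1)] conicI[OF nz(2)] conicI[OF nz(3)] conicI[OF nz(4)])+
    show "distinct [?p 0 1, ?p 1 1, ?p lam 1, ?p 1 0]"
      using lam(1,2) by (simp add: pt_line_eq_iff)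
    have "param_inverse ` {?p 0 1, ?p 1 1, ?p lam 1, ?p 1 0} = {P1_point 0, P1_point 1, P1_point lam, P1_infinity}"
      by (simp only: image_insert image_empty param_inverse[OF nz(1)] param_inverse[OF nz(2)]
          param_inverse[OF nz(3)] param_inverse[OF nz(4)] P1_point_def P1_infinity_def)
    then show "branch_j_invariant C {?p 0 1, ?p 1 1, ?p lam 1, ?p 1 0} J"
      unfolding branch_j_invariant_def C using isomorphism_param_inverse lam by blast
  qed
qed

text \<open>
  The second conic has to pass through the poles \<open>a\<close> and \<open>b\<close> of the two pairs of branch points; the
  point \<open>v\<close>, the pole of the line \<open>a b\<close> with respect to it, is arbitrary outside the plane of the first
  conic.
\<close>

lemma edge_conic_through_poles:
  assumes C: "smooth_conic C"
    and "s1 \<in> C" "s2 \<in> C" "s3 \<in> C" "s4 \<in> C" "distinct [s1, s2, s3, s4]"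
    and J: "branch_j_invariant C {s1, s2, s3, s4} J"
  obtains a b where
    "\<And>z. touches C s1 z \<and> touches C s2 z \<longleftrightarrow> z \<in> vec.span {a}"
    "\<And>z. touches C s3 z \<and> touches C s4 z \<longleftrightarrow> z \<in> vec.span {b}"
    "\<And>v. v \<notin> spanned_plane C \<Longrightarrow> \<exists>w d0 d1 d2 d3. frame a v b w d0 d1 d2 d3"
    "\<And>v. v \<notin> spanned_plane C \<Longrightarrow> smooth_conic (conic_of a v b) \<and>
        spanned_plane (conic_of a v b) \<noteq> spanned_plane C \<and>
        smooth_curve_of_genus 1 (edge_curve C (conic_of a v b)) \<and>
        has_j_invariant (edge_curve C (conic_of a v b)) J \<and>
        double_cover (edge_curve C (conic_of a v b)) C first_projection {s1, s2, s3, s4}"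
    "spanned_plane C \<noteq> UNIV"
proof -
  obtain u0 u1 u2 k where Cu: "C = conic_of u0 u1 u2" and k: "k \<noteq> 0" "k\<^sup>2 \<noteq> 1"
    and s: "s1 = vec.span {conic_pt u0 u1 u2 1 1}" "s2 = vec.span {conic_pt u0 u1 u2 1 (-1)}"
    "s3 = vec.span {conic_pt u0 u1 u2 k 1}" "s4 = vec.span {conic_pt u0 u1 u2 k (-1)}"
    and fr: "\<And>v. v \<notin> spanned_plane C \<Longrightarrow> \<exists>c0 c1 c2 c3. frame u0 u1 u2 v c0 c1 c2 c3"
    and pl: "spanned_plane C \<noteq> UNIV"
    using symmetric_frame[OF assms(1-6)] by metis
  have edge: "\<exists>c0 c1 c2 c3. edge u0 u1 u2 v c0 c1 c2 c3 k" if v: "v \<notin> spanned_plane C" for v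
  proof -
    obtain c0 c1 c2 c3 where "frame u0 u1 u2 v c0 c1 c2 c3" using fr[OF v] by blast
    then have "edge u0 u1 u2 v c0 c1 c2 c3 k" using k by (simp add: edge_def edge_axioms_def)
    then show ?thesis by blast
  qed
  obtain v0 where "v0 \<notin> spanned_plane C" using pl by blast
  then obtain c0 c1 c2 c3 where E0: "edge u0 u1 u2 v0 c0 c1 c2 c3 k" using edge by blast
  interpret E0: edge u0 u1 u2 v0 c0 c1 c2 c3 k by (rule E0)
  show ?thesis
  proof (rule that[of "u0 - u2" "k\<^sup>2 *s u0 - u2"])
    show "touches C s1 z \<and> touches C s2 z \<longleftrightarrow> z \<in> vec.span {u0 - u2}" for z
      using E0.pole_iff[of 1 1 z] by (simp add: s Cu)
    show "touches C s3 z \<and> touches C s4 z \<longleftrightarrow> z \<in> vec.span {k\<^sup>2 *s u0 - u2}" for z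
      using E0.pole_iff[of k 1 z] k by (simp add: s Cu)
    show "spanned_plane C \<noteq> UNIV" by (rule pl)
    fix v assume "v \<notin> spanned_plane C"
    then obtain c0 c1 c2 c3 where E: "edge u0 u1 u2 v c0 c1 c2 c3 k" using edge by blast
    interpret E: edge u0 u1 u2 v c0 c1 c2 c3 k by (rule E)
    show "\<exists>w d0 d1 d2 d3. frame (u0 - u2) v (k\<^sup>2 *s u0 - u2) w d0 d1 d2 d3"
      using E.F2.frame_axioms unfolding E.a_def E.b_def by blast
    have S: "{s1, s2, s3, s4} = E.branch_points" by (simp add: s E.branch_points_def)
    have "branch_j_invariant E.curve E.branch_points J" using J by (simp only: S Cu)
    from E.edge_curve_properties[OF this]
    show "smooth_conic (conic_of (u0 - u2) v (k\<^sup>2 *s u0 - u2)) \<and>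
        spanned_plane (conic_of (u0 - u2) v (k\<^sup>2 *s u0 - u2)) \<noteq> spanned_plane C \<and>
        smooth_curve_of_genus 1 (edge_curve C (conic_of (u0 - u2) v (k\<^sup>2 *s u0 - u2))) \<and>
        has_j_invariant (edge_curve C (conic_of (u0 - u2) v (k\<^sup>2 *s u0 - u2))) J \<and>
        double_cover (edge_curve C (conic_of (u0 - u2) v (k\<^sup>2 *s u0 - u2))) C first_projection {s1, s2, s3, s4}"
      unfolding E.a_def E.b_def S Cu by blast
  qed
qed

text \<open>
  Complex conjugation maps tangent lines of a real conic to tangent lines. It therefore preserves the
  intersection of the tangent lines at two points if it preserves the pair of points.
\<close>

lemma real_pole:
  assumes C: "real_set C" and pair: "{conj_point p, conj_point q} = {p, q}"
    and pole: "\<And>z. touches C p z \<and> touches C q z \<longleftrightarrow> z \<in> vec.span {e}" and "e \<noteq> 0"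
  obtains c where "c \<noteq> 0" "cnj_vec (c *s e) = c *s e"
proof -
  have "touches C p e" "touches C q e" using pole[of e] by simp_all
  then have "touches C (conj_point p) (cnj_vec e)" "touches C (conj_point q) (cnj_vec e)"
    using touches_conj[OF C] by blast+
  then have "\<forall>r\<in>{conj_point p, conj_point q}. touches C r (cnj_vec e)" by blast
  then have "cnj_vec e \<in> vec.span {e}" unfolding pair using pole by blast
  then show ?thesis using real_vector_on_line[OF \<open>e \<noteq> 0\<close>] that by blast
qed

theorem theorem3p10:
  fixes C1 :: "4 point set" and J :: complex
  assumes "smooth_conic C1"
  shows "(\<exists>C2. smooth_conic C2 \<and> spanned_plane C2 \<noteq> spanned_plane C1 \<and>
            smooth_curve_of_genus 1 (edge_curve C1 C2) \<and> has_j_invariant (edge_curve C1 C2) J)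
       \<and> (\<forall>S. real_set C1 \<and> S \<subseteq> C1 \<and> real_set S \<and> card S = 4 \<and> branch_j_invariant C1 S J \<longrightarrow>
            (\<exists>A :: real^4^4. invertible A \<and>
              (\<exists>C2. smooth_conic C2 \<and> spanned_plane C2 \<noteq> spanned_plane C1 \<and>
                 smooth_curve_of_genus 1 (edge_curve C1 C2) \<and>
                 has_j_invariant (edge_curve C1 C2) J \<and>
                 is_circle_in A C2 \<and>
                 double_cover (edge_curve C1 C2) C1 first_projection S)))"
proof (intro conjI allI impI)
  obtain s1 s2 s3 s4 where s: "s1 \<in> C1" "s2 \<in> C1" "s3 \<in> C1" "s4 \<in> C1" "distinct [s1, s2, s3, s4]"
    "branch_j_invariant C1 {s1, s2, s3, s4} J"
    by (rule four_points_with_j_invariant[OF assms])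
  obtain a b where ab: "\<And>v. v \<notin> spanned_plane C1 \<Longrightarrow> smooth_conic (conic_of a v b) \<and>
        spanned_plane (conic_of a v b) \<noteq> spanned_plane C1 \<and>
        smooth_curve_of_genus 1 (edge_curve C1 (conic_of a v b)) \<and>
        has_j_invariant (edge_curve C1 (conic_of a v b)) J \<and>
        double_cover (edge_curve C1 (conic_of a v b)) C1 first_projection {s1, s2, s3, s4}"
    and "spanned_plane C1 \<noteq> UNIV"
    using edge_conic_through_poles[OF assms s] by metis
  then obtain v where "v \<notin> spanned_plane C1" by blast
  then show "\<exists>C2. smooth_conic C2 \<and> spanned_plane C2 \<noteq> spanned_plane C1 \<and>
            smooth_curve_of_genus 1 (edge_curve C1 C2) \<and> has_j_invariant (edge_curve C1 C2) J"
    using ab by blast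
next
  fix S assume h: "real_set C1 \<and> S \<subseteq> C1 \<and> real_set S \<and> card S = 4 \<and> branch_j_invariant C1 S J"
  then have rC: "real_set C1" by simp
  \<comment> \<open>pairing conjugate points makes the poles of the two pairs real\<close>
  obtain s1 s2 s3 s4 where S: "S = {s1, s2, s3, s4}" "distinct [s1, s2, s3, s4]"
    and pairs: "{conj_point s1, conj_point s2} = {s1, s2}" "{conj_point s3, conj_point s4} = {s3, s4}"
    using involution_pairs[of conj_point S] h conj_point_involution unfolding real_set_def by metis
  have s: "s1 \<in> C1" "s2 \<in> C1" "s3 \<in> C1" "s4 \<in> C1" "branch_j_invariant C1 {s1, s2, s3, s4} J"
    using h S by auto
  obtain a b where
    pole: "\<And>z. touches C1 s1 z \<and> touches C1 s2 z \<longleftrightarrow> z \<in> vec.span {a}"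
      "\<And>z. touches C1 s3 z \<and> touches C1 s4 z \<longleftrightarrow> z \<in> vec.span {b}"
    and fr: "\<And>v. v \<notin> spanned_plane C1 \<Longrightarrow> \<exists>w d0 d1 d2 d3. frame a v b w d0 d1 d2 d3"
    and ab: "\<And>v. v \<notin> spanned_plane C1 \<Longrightarrow> smooth_conic (conic_of a v b) \<and>
        spanned_plane (conic_of a v b) \<noteq> spanned_plane C1 \<and>
        smooth_curve_of_genus 1 (edge_curve C1 (conic_of a v b)) \<and>
        has_j_invariant (edge_curve C1 (conic_of a v b)) J \<and>
        double_cover (edge_curve C1 (conic_of a v b)) C1 first_projection {s1, s2, s3, s4}"
    and pl: "spanned_plane C1 \<noteq> UNIV"
    using edge_conic_through_poles[OF assms s(1-4) S(2) s(5)] by metis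
  have sub: "vec.subspace (spanned_plane C1)" unfolding spanned_plane_def by (rule vec.subspace_span)
  obtain i where i: "axis i 1 \<notin> spanned_plane C1"
  proof (rule ccontr)
    assume "\<not> thesis"
    then have "axis i 1 \<in> spanned_plane C1" for i using that by blast
    then have "(\<Sum>i\<in>UNIV. x $ i *s axis i 1) \<in> spanned_plane C1" for x
      by (intro vec.subspace_sum vec.subspace_scale sub)
    then show False using pl unfolding basis_expansion by blast
  qed
  define v :: "complex^4" where "v = axis i 1"
  have v: "v \<notin> spanned_plane C1" "cnj_vec v = v"
    using i by (simp_all add: v_def cnj_vec_def axis_def vec_eq_iff)
  obtain w0 f0 f1 f2 f3 where F: "frame a v b w0 f0 f1 f2 f3" using fr[OF v(1)] by blast
  interpret F: frame a v b w0 f0 f1 f2 f3 by (rule F)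
  have "a \<noteq> 0" "b \<noteq> 0" by (auto simp: F.coords_eq_iff F.coord_simps)
  obtain \<alpha> where \<alpha>: "\<alpha> \<noteq> 0" "cnj_vec (\<alpha> *s a) = \<alpha> *s a"
    using real_pole[OF rC pairs(1) pole(1) \<open>a \<noteq> 0\<close>] by blast
  obtain \<beta> where \<beta>: "\<beta> \<noteq> 0" "cnj_vec (\<beta> *s b) = \<beta> *s b"
    using real_pole[OF rC pairs(2) pole(2) \<open>b \<noteq> 0\<close>] by blast
  define l m where "l = csqrt \<alpha>" and "m = csqrt \<beta>"
  have lm: "l\<^sup>2 = \<alpha>" "m\<^sup>2 = \<beta>" "l \<noteq> 0" "m \<noteq> 0" using \<alpha> \<beta> by (simp_all add: l_def m_def)
  define v' where "v' = (1 / (l * m)) *s v"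
  have vv': "v = (l * m) *s v'" using lm by (simp add: v'_def vector_smult_assoc)
  have v': "v' \<notin> spanned_plane C1" using v(1) vec.subspace_scale[OF sub, of v' "l * m"] vv' by auto
  have C2: "conic_of (\<alpha> *s a) v (\<beta> *s b) = conic_of a v' b"
    using conic_of_rescale[OF lm(3,4), of a v' b] by (simp add: lm(1,2) vv')
  obtain d0 d1 d2 d3 where D: "frame (\<alpha> *s a) (1 *s v) (\<beta> *s b) w0 d0 d1 d2 d3"
    using frame_rescale[OF F \<alpha>(1) one_neq_zero \<beta>(1)] by blast
  interpret D: frame "\<alpha> *s a" v "\<beta> *s b" w0 d0 d1 d2 d3 using D by simp
  obtain A where A: "invertible A" "is_circle_in A (conic_of (\<alpha> *s a) v (\<beta> *s b))"
    using D.real_conic_is_circle[OF \<alpha>(2) v(2) \<beta>(2)] by blast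
  show "\<exists>A :: real^4^4. invertible A \<and>
              (\<exists>C2. smooth_conic C2 \<and> spanned_plane C2 \<noteq> spanned_plane C1 \<and>
                 smooth_curve_of_genus 1 (edge_curve C1 C2) \<and>
                 has_j_invariant (edge_curve C1 C2) J \<and>
                 is_circle_in A C2 \<and>
                 double_cover (edge_curve C1 C2) C1 first_projection S)"
    using A ab[OF v'] unfolding C2 S by blast
qed

end
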